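(* Let $\alpha$ be an ordinal. Then the algebra of operators $\mathscr{B}(C([0,\alpha]))$ and the Calkin algebra $\mathscr{B}(C([0,\alpha]))/\mathscr{K}(C([0,\alpha]))$ each admit a unique algebra norm; that is, any two algebra norms on $\mathscr{B}(C([0,\alpha]))$ are equivalent, and any two algebra norms on $\mathscr{B}(C([0,\alpha]))/\mathscr{K}(C([0,\alpha]))$ are equivalent.
   Context: All spaces and algebras are over a scalar field $\mathbb{K}$ which is either $\mathbb{R}$ or $\mathbb{C}$. $[0,\alpha]$ is the set of ordinals $\le\alpha$ with the order topology, $C([0,\alpha])$ is the Banach space of continuous $\mathbb{K}$-valued functions on it with the supremum norm. $\mathscr{B}(X)$ is the algebra of bounded linear operators on a Banach space $X$ and $\mathscr{K}(X)$ is the ideal of compact operators. An algebra norm on an algebra is a submultiplicative vector space norm; it is not assumed complete. *)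

theory Defs
  imports
    "HOL-Analysis.Bounded_Continuous_Function"
    "HOL-Analysis.Bounded_Linear_Function"
    "HOL-Algebra.Module"
    "HOL-Algebra.QuotRing"
begin

text \<open>
  An algebra over the scalar field \<open>'k\<close> is given as a record of type \<^typ>\<open>('k, 'b) module\<close>
  (a ring record together with a scalar multiplication); the locale of the same library theory
  that is called \<open>algebra\<close> is not used, because it requires commutativity.
  A norm on an algebra is a function on the whole type of which only the values on the carrier
  matter.
\<close>

definition algebra_norm :: "('k::real_normed_field, 'b) module \<Rightarrow> ('b \<Rightarrow> real) \<Rightarrow> bool" where
  "algebra_norm A N \<longleftrightarrow>
     (\<forall>x\<in>carrier A. 0 \<le> N x) \<and>
     (\<forall>x\<in>carrier A. N x = 0 \<longleftrightarrow> x = \<zero>\<^bsub>A\<^esub>) \<and>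
     (\<forall>x\<in>carrier A. \<forall>y\<in>carrier A. N (x \<oplus>\<^bsub>A\<^esub> y) \<le> N x + N y) \<and>
     (\<forall>c. \<forall>x\<in>carrier A. N (c \<odot>\<^bsub>A\<^esub> x) = norm c * N x) \<and>
     (\<forall>x\<in>carrier A. \<forall>y\<in>carrier A. N (x \<otimes>\<^bsub>A\<^esub> y) \<le> N x * N y)"

definition equivalent_norms :: "('k, 'b) module \<Rightarrow> ('b \<Rightarrow> real) \<Rightarrow> ('b \<Rightarrow> real) \<Rightarrow> bool" where
  "equivalent_norms A N N' \<longleftrightarrow>
     (\<exists>c>0. \<exists>C>0. \<forall>x\<in>carrier A. c * N x \<le> N' x \<and> N' x \<le> C * N x)"

definition unique_algebra_norm :: "('k::real_normed_field, 'b) module \<Rightarrow> bool" where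
  "unique_algebra_norm A \<longleftrightarrow>
     (\<forall>N N'. algebra_norm A N \<longrightarrow> algebra_norm A N' \<longrightarrow> equivalent_norms A N N')"

context
  includes bcontfun.lifting
begin

lift_definition scale_bcontfun ::
    "'k::real_normed_field \<Rightarrow> ('a::topological_space \<Rightarrow>\<^sub>C 'k) \<Rightarrow> ('a \<Rightarrow>\<^sub>C 'k)"
  is "\<lambda>c f x. c * f x"
  by (auto simp: bcontfun_def bounded_iff norm_mult intro!: continuous_intros)
    (meson mult_left_mono norm_ge_zero)

end

lemma bounded_linear_scale_bcontfun:
  fixes c :: "'k::real_normed_field"
  shows "bounded_linear (scale_bcontfun c :: ('a::topological_space \<Rightarrow>\<^sub>C 'k) \<Rightarrow> ('a \<Rightarrow>\<^sub>C 'k))"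
proof (rule bounded_linear_intro[where K = "norm c"])
  show "norm (scale_bcontfun c f) \<le> norm f * norm c" for f :: "'a \<Rightarrow>\<^sub>C 'k"
    by (rule norm_bound)
      (simp add: scale_bcontfun.rep_eq norm_mult mult.commute mult_left_mono norm_bounded)
qed (auto intro!: bcontfun_eqI simp: scale_bcontfun.rep_eq algebra_simps)

lift_definition scale_blinfun :: "'k::real_normed_field \<Rightarrow>
    (('a::topological_space \<Rightarrow>\<^sub>C 'k) \<Rightarrow>\<^sub>L ('a \<Rightarrow>\<^sub>C 'k)) \<Rightarrow> (('a \<Rightarrow>\<^sub>C 'k) \<Rightarrow>\<^sub>L ('a \<Rightarrow>\<^sub>C 'k))"
  is "\<lambda>c T f. scale_bcontfun c (T f)"
  by (rule bounded_linear_compose[OF bounded_linear_scale_bcontfun])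

text \<open>
  The algebra of bounded \<open>'k\<close>-linear operators on the space of continuous \<open>'k\<close>-valued functions
  on a compact space \<open>'a\<close> (where every continuous function is bounded). The elements of the
  type \<open>\<Rightarrow>\<^sub>L\<close> are only real-linear, hence the restriction of the carrier.
\<close>

definition operator_algebra ::
    "('k::real_normed_field, ('a::topological_space \<Rightarrow>\<^sub>C 'k) \<Rightarrow>\<^sub>L ('a \<Rightarrow>\<^sub>C 'k)) module" where
  "operator_algebra =
     \<lparr>carrier = {T. \<forall>c f. blinfun_apply T (scale_bcontfun c f) = scale_bcontfun c (blinfun_apply T f)},
      mult = blinfun_compose, one = id_blinfun, zero = 0, add = (+), smult = scale_blinfun\<rparr>"

definition compact_operators ::
    "(('a::topological_space \<Rightarrow>\<^sub>C 'k::real_normed_field) \<Rightarrow>\<^sub>L ('a \<Rightarrow>\<^sub>C 'k)) set" where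
  "compact_operators =
     {T \<in> carrier operator_algebra. compact (closure (blinfun_apply T ` cball 0 1))}"

text \<open>
  The library's quotient ring with the induced scalar multiplication, which sends the coset
  of \<open>x\<close> to the coset of \<open>c \<odot> x\<close> and is written in the manner of \<^const>\<open>rcoset_mult\<close>.
\<close>

definition quotient_algebra :: "('k, 'b) module \<Rightarrow> 'b set \<Rightarrow> ('k, 'b set) module" where
  "quotient_algebra A I =
     ring.extend (A Quot I) (module.fields (\<lambda>c S. \<Union>x\<in>S. I +>\<^bsub>A\<^esub> (c \<odot>\<^bsub>A\<^esub> x)))"

definition calkin_algebra ::
    "('k::real_normed_field, (('a::topological_space \<Rightarrow>\<^sub>C 'k) \<Rightarrow>\<^sub>L ('a \<Rightarrow>\<^sub>C 'k)) set) module" where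
  "calkin_algebra = quotient_algebra operator_algebra compact_operators"

text \<open>
  Up to order isomorphism, the intervals \<open>[0, \<alpha>]\<close> of ordinals are exactly the well-ordered sets
  with a greatest element. So \<open>[0, \<alpha>]\<close> with the order topology is rendered as a type of class
  \<^class>\<open>wellorder\<close> and \<^class>\<open>linorder_topology\<close> that satisfies \<open>UNIV = {..\<alpha>}\<close>. Such a space
  is compact, so that \<open>\<Rightarrow>\<^sub>C\<close> contains all continuous functions on it.
\<close>

end

theory Submission
  imports Defs "HOL-Library.Nat_Bijection"
begin

text \<open>
  Let \<open>K\<close> be the well-ordered space and \<open>A\<close> the algebra of bounded operators on \<open>C(K)\<close>.
  A norm on \<open>A\<close>, or on the quotient by the compact operators, gives a submultiplicative
  seminorm \<open>n\<close> on \<open>A\<close>, whose null space is zero or the ideal of the compact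
  operators, respectively. The operator norm bounds \<open>n\<close> from above, and the operator norm or the
  distance to the compact operators bounds it from below, up to constants.

  Upper bound. An operator \<open>R\<close> is tame if \<open>n (R T)\<close> and \<open>n (T R)\<close> are at most a constant times
  the operator norm of \<open>T\<close>. If \<open>V\<^sub>j U\<^sub>k\<close> is \<open>R\<close> for \<open>j = k\<close> and \<open>0\<close> otherwise, then \<open>R\<close> is tame,
  because countably many operators \<open>T\<^sub>k\<close> can be glued to a single \<open>\<Sum>\<^sub>k c\<^sub>k U\<^sub>k T\<^sub>k\<close>, from which \<open>V\<^sub>j\<close>
  recovers \<open>R T\<^sub>j\<close> (\<open>tame_if_replicable\<close>). Each \<open>t\<close> that is not the least point has a left
  neighbourhood \<open>(b, t]\<close> with \<open>(b, t)\<close> of least possible order type, so that all tails of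
  \<open>(b, t)\<close> are order isomorphic to it. Finitely many such intervals, and the least point, cover
  \<open>K\<close>, which writes the identity as a finite sum of operators of rank one and of operators
  \<open>Q\<close> that subtract the value at \<open>t\<close> on \<open>(b, t]\<close> (\<open>proj_atMost_pieces\<close>). So it is enough to
  bound \<open>n (Q T Q')\<close> for two such \<open>Q\<close>, \<open>Q'\<close>. If the order types of the intervals differ, then the
  longer one contains infinitely many disjoint copies of the shorter one, and \<open>Q\<close> or \<open>Q'\<close> is tame.
  If they agree, a homeomorphism reduces the claim to \<open>Q = Q'\<close>. For \<open>t\<close> of countable cofinality
  \<open>Q\<close> is tame, as the gaps of a sequence that increases to \<open>t\<close> embed into later gaps. For
  uncountable cofinality choose a closed cofinal set \<open>D\<close>. The functions that vanish on \<open>D\<close>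
  form a tame part of \<open>Q\<close>, again by moving gaps to later gaps (\<open>tame_gap_op\<close>). On the other
  part, the functions constant on the gaps of \<open>D\<close>, a closing-off argument shows that any
  countable family of operators acts by scalars up to functions that vanish on a smaller closed
  cofinal set (\<open>closing_off\<close>), so tameness of the gap part applies once more.

  Lower bound on \<open>A\<close>. For \<open>S g = g(t) f\<close> one has \<open>S T S = (T f)(t) S\<close>, hence
  \<open>|(T f)(t)| \<le> n S n T\<close>, and \<open>n S\<close> is at most a constant times the norm of \<open>f\<close> by the upper bound.

  Lower bound modulo compact operators. If \<open>T\<close> has distance more than \<open>r\<close> from the compact
  operators, then some points \<open>s\<^sub>k\<close> increase to \<open>s'\<close> while the functionals
  \<open>f \<mapsto> (T f)(s\<^sub>k) - (T f)(s')\<close> have norm more than \<open>r\<close>. These functionals tend to zero pointwise,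
  and a gliding hump yields disjointly supported \<open>g\<^sub>k\<close> of norm at most \<open>2\<close> on which they are at
  least \<open>r/4\<close>. After thinning out they are almost biorthogonal, and then \<open>R T S\<close> is close to
  an idempotent that is not compact, with \<open>R\<close> and \<open>S\<close> controlled by \<open>1/r\<close>
  (\<open>compact_approximation_or_factorization\<close>). A submultiplicative seminorm is at least \<open>1\<close> at an
  idempotent where it does not vanish, so \<open>n T\<close> is at least a constant times \<open>r\<close>.
\<close>

section \<open>The topology of a well-ordered set\<close>

text \<open>
  The initial segment up to \<open>x\<close> is also the open segment below the successor of \<open>x\<close>. Hence
  half-open intervals are clopen, and they form a base.
\<close>

lemma open_atMost_wellorder: "open {..x}"
  for x :: "'a::{wellorder, linorder_topology}"
proof (cases "\<exists>y. x < y")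
  case True
  have "{..x} = {..<LEAST y. x < y}"
    using LeastI_ex[OF True] not_less_Least[of _ "\<lambda>y. x < y"]
    by (auto simp: not_le[symmetric])
  then show ?thesis by (metis open_lessThan)
next
  case False
  then have "{..x} = UNIV" by (auto simp: not_less)
  then show ?thesis by simp
qed

lemma closed_greaterThan_wellorder: "closed {x<..}"
  for x :: "'a::{wellorder, linorder_topology}"
  by (simp add: closed_def open_atMost_wellorder Compl_greaterThan)

definition clopen :: "'a::topological_space set \<Rightarrow> bool" where
  "clopen E \<longleftrightarrow> open E \<and> closed E"

lemma clopen_basic [simp, intro]:
  "clopen {}" "clopen UNIV"
  "clopen A \<Longrightarrow> clopen B \<Longrightarrow> clopen (A \<inter> B)"
  "clopen A \<Longrightarrow> clopen B \<Longrightarrow> clopen (A \<union> B)"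
  "clopen A \<Longrightarrow> clopen B \<Longrightarrow> clopen (A - B)"
  "clopen A \<Longrightarrow> clopen (- A)"
  by (auto simp: clopen_def intro: open_Diff closed_Diff)

lemma clopen_UN [intro]:
  assumes "finite I" "\<And>i. i \<in> I \<Longrightarrow> clopen (A i)"
  shows "clopen (\<Union>i\<in>I. A i)"
  using assms by (auto simp: clopen_def)

lemma clopen_intervals [simp, intro]:
  fixes x y :: "'a::{wellorder, linorder_topology}"
  shows "clopen {..x}" "clopen {x<..}" "clopen {y<..x}"
proof -
  show 1: "clopen {..x}" and 2: "clopen {x<..}" for x :: 'a
    by (auto simp: clopen_def open_atMost_wellorder closed_greaterThan_wellorder)
  have "{y<..x} = {..x} \<inter> {y<..}" by auto
  then show "clopen {y<..x}" using 1 2 by (metis clopen_basic(3))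
qed

lemma left_neighbourhood:
  fixes x :: "'a::{wellorder, linorder_topology}"
  assumes "open S" "x \<in> S" "y < x"
  obtains w where "y \<le> w" "w < x" "{w<..x} \<subseteq> S"
proof -
  obtain b where b: "b < x" "{b<..x} \<subseteq> S" using open_left[OF assms] by auto
  show thesis
    by (rule that[of "max y b"]) (use b assms in auto)
qed

lemma clopen_base:
  fixes x :: "'a::{wellorder, linorder_topology}"
  assumes "open S" "x \<in> S"
  obtains V where "clopen V" "x \<in> V" "V \<subseteq> S"
proof (cases "\<exists>y. y < x")
  case True
  then obtain y where "y < x" by blast
  with assms obtain w where "w < x" "{w<..x} \<subseteq> S" by (metis left_neighbourhood)
  then show ?thesis by (intro that[of "{w<..x}"]) auto
next
  case False
  then have "{..x} = {x}" by (auto simp: not_less intro: antisym)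
  then show ?thesis using assms clopen_intervals(1)[of x] by (intro that[of "{x}"]) auto
qed

text \<open>
  Neighbourhoods of a point only extend to its left. So a map that is locally bounded by its value
  at \<open>x\<close> is continuous at \<open>x\<close> as soon as it exceeds every smaller value near \<open>x\<close>; all
  embeddings and retractions below are of this kind.
\<close>

lemma isCont_monotoneI:
  fixes f :: "'a::{wellorder, linorder_topology} \<Rightarrow> 'b::{wellorder, linorder_topology}"
  assumes "v < x" "\<And>x'. v < x' \<Longrightarrow> x' \<le> x \<Longrightarrow> f x' \<le> f x"
    and "\<And>u. u < f x \<Longrightarrow> \<exists>w<x. \<forall>x'. w < x' \<longrightarrow> x' \<le> x \<longrightarrow> u < f x'"
  shows "isCont f x"
  unfolding continuous_at_open
proof (intro allI impI)
  fix S assume S: "open S \<and> f x \<in> S"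
  show "\<exists>T. open T \<and> x \<in> T \<and> (\<forall>x'\<in>T. f x' \<in> S)"
  proof (cases "\<exists>u. u < f x")
    case True
    then obtain u where "u < f x" by blast
    with S obtain u where u: "u < f x" "{u<..f x} \<subseteq> S" by (metis left_neighbourhood)
    from assms(3)[OF u(1)] obtain w where w: "w < x" "\<And>x'. w < x' \<Longrightarrow> x' \<le> x \<Longrightarrow> u < f x'" by auto
    have "f x' \<in> S" if "x' \<in> {max v w<..x}" for x'
      using that u(2) w(2)[of x'] assms(2)[of x'] by (auto simp: subset_iff)
    moreover have "open {max v w<..x}" using clopen_intervals(3) unfolding clopen_def by blast
    moreover have "x \<in> {max v w<..x}" using w(1) assms(1) by simp
    ultimately show ?thesis by blast
  next
    case False
    have "f x' = f x" if "v < x'" "x' \<le> x" for x'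
      using assms(2)[OF that] False by (auto simp: not_less intro: antisym)
    then have "f x' \<in> S" if "x' \<in> {v<..x}" for x' using that S by simp
    moreover have "open {v<..x}" using clopen_intervals(3) unfolding clopen_def by blast
    moreover have "x \<in> {v<..x}" using assms(1) by simp
    ultimately show ?thesis by blast
  qed
qed

lemma continuous_on_clopen_isCont:
  "clopen E \<Longrightarrow> (\<And>x. x \<in> E \<Longrightarrow> isCont f x) \<Longrightarrow> continuous_on E f"
  by (simp add: continuous_at_imp_continuous_on)

lemma continuous_near:
  fixes g :: "'a::{wellorder, linorder_topology} \<Rightarrow> 'b::real_normed_vector"
  assumes "isCont g x" "y < x" "0 < e"
  obtains w where "y \<le> w" "w < x" "\<And>x'. w < x' \<Longrightarrow> x' \<le> x \<Longrightarrow> norm (g x' - g x) < e"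
proof -
  obtain S where S: "open S" "x \<in> S" "\<And>x'. x' \<in> S \<Longrightarrow> g x' \<in> ball (g x) e"
    using assms(1,3) unfolding continuous_at_open by (metis centre_in_ball open_ball)
  obtain w where "y \<le> w" "w < x" "{w<..x} \<subseteq> S" using left_neighbourhood[OF S(1,2) assms(2)] .
  then show thesis using S(3)
    by (intro that[of w]) (auto simp: subset_iff dist_norm norm_minus_commute)
qed

section \<open>Operators on spaces of continuous functions\<close>

text \<open>
  A uniform limit of continuous functions is continuous on every topological space; the
  series of operators and of functions below converge for this reason.
\<close>

instance bcontfun :: (topological_space, complete_space) complete_space
proof
  fix f :: "nat \<Rightarrow> ('a, 'b) bcontfun"
  assume "Cauchy f"
  then have "uniformly_Cauchy_on UNIV (\<lambda>n. apply_bcontfun (f n))"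
    unfolding Cauchy_def uniformly_Cauchy_on_def by (metis dist_fun_lt_imp_dist_val_lt)
  then obtain l where "f \<longlonglongrightarrow> l"
    by (metis Cauchy_uniformly_convergent uniformly_convergent_on_def uniform_limit_bcontfunE
        sequentially_bot)
  then show "convergent f" by (rule convergentI)
qed

instance bcontfun :: (topological_space, banach) banach ..

lemma bcontfunI:
  assumes "continuous_on UNIV f" "\<And>x. norm (f x) \<le> b"
  shows "apply_bcontfun (Bcontfun f) = f"
  using bcontfun_normI[OF assms] by (simp add: Bcontfun_inverse)

declare scale_bcontfun.rep_eq [simp] scale_blinfun.rep_eq [simp]

lemma scale_bcontfun_distrib [simp]:
  "scale_bcontfun c (f + g) = scale_bcontfun c f + scale_bcontfun c g"
  "scale_bcontfun c (f - g) = scale_bcontfun c f - scale_bcontfun c g"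
  "scale_bcontfun (c + d) f = scale_bcontfun c f + scale_bcontfun d f"
  "scale_bcontfun c (scale_bcontfun d f) = scale_bcontfun (c * d) f"
  "scale_bcontfun 0 f = 0" "scale_bcontfun 1 f = f" "scale_bcontfun c 0 = 0"
  by (auto intro!: bcontfun_eqI simp: algebra_simps)

lemma norm_scale_bcontfun [simp]: "norm (scale_bcontfun c f) = norm c * norm f"
proof (rule antisym)
  show le: "norm (scale_bcontfun c f) \<le> norm c * norm f" for c and f :: "'a \<Rightarrow>\<^sub>C 'b"
    by (rule norm_bound) (simp add: norm_mult mult_left_mono norm_bounded)
  show "norm c * norm f \<le> norm (scale_bcontfun c f)"
  proof (cases "c = 0")
    case False
    have "norm f = norm (scale_bcontfun (inverse c) (scale_bcontfun c f))" using False by simp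
    also have "\<dots> \<le> norm (inverse c) * norm (scale_bcontfun c f)" by (rule le)
    finally have "norm c * norm f \<le> norm c * (norm (inverse c) * norm (scale_bcontfun c f))"
      by (intro mult_left_mono) auto
    also have "\<dots> = norm (c * inverse c) * norm (scale_bcontfun c f)" by (simp only: norm_mult mult.assoc)
    also have "\<dots> = norm (scale_bcontfun c f)" using False by simp
    finally show ?thesis .
  qed simp
qed

lemma scaleR_bcontfun_eq: "r *\<^sub>R f = scale_bcontfun (of_real r) f"
  by (rule bcontfun_eqI) (simp add: scaleR_conv_of_real)

lemma scaleR_blinfun_eq: "r *\<^sub>R T = scale_blinfun (of_real r) T"
  by (rule blinfun_eqI) (simp add: scaleR_bcontfun_eq blinfun.scaleR_left)

abbreviation ops :: "(('a::topological_space \<Rightarrow>\<^sub>C 'k::real_normed_field) \<Rightarrow>\<^sub>L ('a \<Rightarrow>\<^sub>C 'k)) set" where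
  "ops \<equiv> carrier operator_algebra"

lemma ops_iff:
  "T \<in> ops \<longleftrightarrow> (\<forall>c f. blinfun_apply T (scale_bcontfun c f) = scale_bcontfun c (blinfun_apply T f))"
  by (simp add: operator_algebra_def)

lemma opsD: "T \<in> ops \<Longrightarrow> blinfun_apply T (scale_bcontfun c f) = scale_bcontfun c (blinfun_apply T f)"
  by (simp add: ops_iff)

lemma ops_closed [simp, intro]:
  "0 \<in> ops" "id_blinfun \<in> ops"
  "S \<in> ops \<Longrightarrow> T \<in> ops \<Longrightarrow> S + T \<in> ops"
  "S \<in> ops \<Longrightarrow> T \<in> ops \<Longrightarrow> S - T \<in> ops"
  "S \<in> ops \<Longrightarrow> T \<in> ops \<Longrightarrow> S o\<^sub>L T \<in> ops"
  "T \<in> ops \<Longrightarrow> scale_blinfun c T \<in> ops"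
  "T \<in> ops \<Longrightarrow> r *\<^sub>R T \<in> ops"
  "T \<in> ops \<Longrightarrow> - T \<in> ops"
  by (auto simp: ops_iff blinfun.add_left blinfun.diff_left blinfun.scaleR_left scaleR_bcontfun_eq
      blinfun.minus_left mult.commute intro!: bcontfun_eqI)

lemma ops_suminf [intro]:
  assumes "summable T" "\<And>k. T k \<in> ops"
  shows "suminf T \<in> ops"
  unfolding ops_iff
proof (intro allI)
  fix c f
  have app: "(\<lambda>k. blinfun_apply (T k) g) sums blinfun_apply (suminf T) g" for g
    by (rule bounded_linear.sums[OF blinfun.bounded_linear_left summable_sums[OF assms(1)]])
  have "(\<lambda>k. scale_bcontfun c (blinfun_apply (T k) f)) sums scale_bcontfun c (blinfun_apply (suminf T) f)"
    by (rule bounded_linear.sums[OF bounded_linear_scale_bcontfun app])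
  with app[of "scale_bcontfun c f"] assms(2)
  show "blinfun_apply (suminf T) (scale_bcontfun c f) = scale_bcontfun c (blinfun_apply (suminf T) f)"
    by (simp add: opsD sums_unique2)
qed

lemma op_eqI: "(\<And>g x. apply_bcontfun (blinfun_apply S g) x = apply_bcontfun (blinfun_apply T g) x) \<Longrightarrow> S = T"
  by (intro blinfun_eqI bcontfun_eqI)

lemma compose_assoc: "(R o\<^sub>L S) o\<^sub>L T = R o\<^sub>L (S o\<^sub>L T)"
  by (rule blinfun_eqI) simp

lemmas compose_add_left = bounded_bilinear.add_left[OF bounded_bilinear_blinfun_compose]
  and compose_add_right = bounded_bilinear.add_right[OF bounded_bilinear_blinfun_compose]
  and compose_scaleR_left = bounded_bilinear.scaleR_left[OF bounded_bilinear_blinfun_compose]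
  and compose_scaleR_right = bounded_bilinear.scaleR_right[OF bounded_bilinear_blinfun_compose]

text \<open>
  Almost all operators of the proof are built from composition operators that are cut off by a
  clopen set.
\<close>

definition comp_op ::
    "'a::topological_space set \<Rightarrow> ('a \<Rightarrow> 'a) \<Rightarrow> ('a \<Rightarrow>\<^sub>C 'k::real_normed_field) \<Rightarrow>\<^sub>L ('a \<Rightarrow>\<^sub>C 'k)" where
  "comp_op E \<phi> = Blinfun (\<lambda>g::'a \<Rightarrow>\<^sub>C 'k. Bcontfun (\<lambda>x. if x \<in> E then g (\<phi> x) else 0))"

context
  fixes E :: "'a::topological_space set" and \<phi> :: "'a \<Rightarrow> 'a"
  assumes E: "clopen E" and \<phi>: "continuous_on E \<phi>"
begin

lemma comp_op_apply [simp]: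
  "apply_bcontfun (blinfun_apply (comp_op E \<phi>) (g :: 'a \<Rightarrow>\<^sub>C 'k::real_normed_field)) x
    = (if x \<in> E then g (\<phi> x) else 0)"
  and norm_comp_op: "norm (comp_op E \<phi> :: ('a \<Rightarrow>\<^sub>C 'k) \<Rightarrow>\<^sub>L ('a \<Rightarrow>\<^sub>C 'k)) \<le> 1"
  and comp_op_ops [simp]: "(comp_op E \<phi> :: ('a \<Rightarrow>\<^sub>C 'k) \<Rightarrow>\<^sub>L ('a \<Rightarrow>\<^sub>C 'k)) \<in> ops"
proof -
  have cont: "continuous_on UNIV (\<lambda>x. if x \<in> E then apply_bcontfun g (\<phi> x) else 0)" for g :: "'a \<Rightarrow>\<^sub>C 'k"
  proof -
    have "continuous_on (E \<union> - E) (\<lambda>x. if x \<in> E then apply_bcontfun g (\<phi> x) else 0)"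
      using E \<phi> by (intro continuous_on_cases) (auto simp: clopen_def intro: continuous_on_compose2)
    then show ?thesis by simp
  qed
  have app: "apply_bcontfun (Bcontfun (\<lambda>x. if x \<in> E then apply_bcontfun g (\<phi> x) else 0))
      = (\<lambda>x. if x \<in> E then apply_bcontfun g (\<phi> x) else 0)" for g :: "'a \<Rightarrow>\<^sub>C 'k"
    by (rule bcontfunI[OF cont, of _ "norm g"]) (auto simp: norm_bounded)
  have "bounded_linear (\<lambda>g. Bcontfun (\<lambda>x. if x \<in> E then apply_bcontfun g (\<phi> x) else 0) :: 'a \<Rightarrow>\<^sub>C 'k)"
    by (rule bounded_linear_intro[where K = 1])
      (auto intro!: bcontfun_eqI norm_bound simp: app norm_bounded)
  then have eq: "blinfun_apply (comp_op E \<phi>) g = Bcontfun (\<lambda>x. if x \<in> E then apply_bcontfun g (\<phi> x) else 0)"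
    for g :: "'a \<Rightarrow>\<^sub>C 'k"
    by (simp add: comp_op_def bounded_linear_Blinfun_apply)
  show *: "apply_bcontfun (blinfun_apply (comp_op E \<phi>) g) x = (if x \<in> E then g (\<phi> x) else 0)" 
    for g :: "'a \<Rightarrow>\<^sub>C 'k" and x
    by (simp add: eq app)
  show "norm (comp_op E \<phi> :: ('a \<Rightarrow>\<^sub>C 'k) \<Rightarrow>\<^sub>L ('a \<Rightarrow>\<^sub>C 'k)) \<le> 1"
    by (rule norm_blinfun_bound) (auto intro!: norm_bound simp: * norm_bounded)
  show "(comp_op E \<phi> :: ('a \<Rightarrow>\<^sub>C 'k) \<Rightarrow>\<^sub>L ('a \<Rightarrow>\<^sub>C 'k)) \<in> ops"
    by (auto simp: ops_iff * intro!: bcontfun_eqI)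
qed

end

abbreviation proj :: "'a::topological_space set \<Rightarrow> ('a \<Rightarrow>\<^sub>C 'k::real_normed_field) \<Rightarrow>\<^sub>L ('a \<Rightarrow>\<^sub>C 'k)" where
  "proj E \<equiv> comp_op E (\<lambda>x. x)"

definition ind :: "'a::topological_space set \<Rightarrow> ('a \<Rightarrow>\<^sub>C 'k::real_normed_field)" where
  "ind E = blinfun_apply (proj E) (const_bcontfun 1)"

lemma ind_apply [simp]: "clopen E \<Longrightarrow> apply_bcontfun (ind E) x = (if x \<in> E then 1 else 0)"
  by (simp add: ind_def continuous_on_id)

section \<open>Submultiplicative seminorms and tame operators\<close>

locale algebra_seminorm =
  fixes n :: "(('a::{wellorder, linorder_topology} \<Rightarrow>\<^sub>C 'k::{real_normed_field, banach, heine_borel})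
      \<Rightarrow>\<^sub>L ('a \<Rightarrow>\<^sub>C 'k)) \<Rightarrow> real"
  assumes nonneg: "T \<in> ops \<Longrightarrow> 0 \<le> n T"
    and triangle: "S \<in> ops \<Longrightarrow> T \<in> ops \<Longrightarrow> n (S + T) \<le> n S + n T"
    and homogeneous: "T \<in> ops \<Longrightarrow> n (scale_blinfun c T) = norm c * n T"
    and submult: "S \<in> ops \<Longrightarrow> T \<in> ops \<Longrightarrow> n (S o\<^sub>L T) \<le> n S * n T"
begin

lemma scaleR: "T \<in> ops \<Longrightarrow> n (r *\<^sub>R T) = \<bar>r\<bar> * n T"
  by (simp add: scaleR_blinfun_eq homogeneous)

lemma zero [simp]: "n 0 = 0"
  using scaleR[of 0 0] by simp

lemma minus: "T \<in> ops \<Longrightarrow> n (- T) = n T"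
  using scaleR[of T "-1"] by simp

lemma diff: "S \<in> ops \<Longrightarrow> T \<in> ops \<Longrightarrow> n (S - T) \<le> n S + n T"
  using triangle[of S "- T"] by (simp add: minus)

text \<open>
  The tame operators form an ideal, and they bound all corners \<open>R T R'\<close> in which they occur. Corners
  are considered separately because replication does not reach everything: \<open>C([0, \<omega>\<^sub>1])\<close> has
  no complemented subspace isomorphic to its square, and the corner at the top point of \<open>[0, \<omega>\<^sub>1]\<close> is bounded directly.
\<close>

definition bounded_between where
  "bounded_between R R' \<longleftrightarrow> (\<exists>C. \<forall>T\<in>ops. n (R o\<^sub>L T o\<^sub>L R') \<le> C * norm T)"

definition tame where
  "tame R \<longleftrightarrow> R \<in> ops \<and> (\<exists>C. \<forall>T\<in>ops. n (R o\<^sub>L T) \<le> C * norm T)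
     \<and> (\<exists>C. \<forall>T\<in>ops. n (T o\<^sub>L R) \<le> C * norm T)"

lemma nonneg_constant:
  assumes "\<forall>T\<in>ops. n (P T) \<le> C * norm T"
  obtains C' where "0 \<le> C'" "\<forall>T\<in>ops. n (P T) \<le> C' * norm T"
proof (rule that[of "max 0 C"])
  show "\<forall>T\<in>ops. n (P T) \<le> max 0 C * norm T"
    using assms by (meson max.cobounded2 mult_right_mono norm_ge_zero order_trans)
qed simp

lemma tameE:
  assumes "tame R"
  obtains C C' where "0 \<le> C" "\<forall>T\<in>ops. n (R o\<^sub>L T) \<le> C * norm T"
    "0 \<le> C'" "\<forall>T\<in>ops. n (T o\<^sub>L R) \<le> C' * norm T"
proof -
  obtain C0 C1 where C: "\<forall>T\<in>ops. n (R o\<^sub>L T) \<le> C0 * norm T" "\<forall>T\<in>ops. n (T o\<^sub>L R) \<le> C1 * norm T"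
    using assms unfolding tame_def by blast
  obtain C where "0 \<le> C" "\<forall>T\<in>ops. n (R o\<^sub>L T) \<le> C * norm T"
    by (rule nonneg_constant[OF C(1)])
  moreover obtain C' where "0 \<le> C'" "\<forall>T\<in>ops. n (T o\<^sub>L R) \<le> C' * norm T"
    by (rule nonneg_constant[OF C(2)])
  ultimately show thesis using that by blast
qed

lemma bounded_betweenE:
  assumes "bounded_between R R'"
  obtains C where "0 \<le> C" "\<forall>T\<in>ops. n (R o\<^sub>L T o\<^sub>L R') \<le> C * norm T"
proof -
  obtain C0 where C: "\<forall>T\<in>ops. n (R o\<^sub>L T o\<^sub>L R') \<le> C0 * norm T"
    using assms unfolding bounded_between_def by blast
  obtain C where "0 \<le> C" "\<forall>T\<in>ops. n (R o\<^sub>L T o\<^sub>L R') \<le> C * norm T"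
    by (rule nonneg_constant[OF C])
  then show thesis using that by blast
qed

lemma tame_ops: "tame R \<Longrightarrow> R \<in> ops"
  by (simp add: tame_def)

lemma tame_compose:
  assumes "tame R" and [simp]: "S \<in> ops" "S' \<in> ops"
  shows "tame (S o\<^sub>L R o\<^sub>L S')"
proof -
  have R [simp]: "R \<in> ops" using assms(1) by (rule tame_ops)
  obtain C C' where C: "0 \<le> C" "\<forall>T\<in>ops. n (R o\<^sub>L T) \<le> C * norm T"
    and C': "0 \<le> C'" "\<forall>T\<in>ops. n (T o\<^sub>L R) \<le> C' * norm T"
    using assms(1) by (rule tameE)
  have "n (S o\<^sub>L R o\<^sub>L S' o\<^sub>L T) \<le> n S * C * norm S' * norm T" if [simp]: "T \<in> ops" for T
  proof -
    have "n (S o\<^sub>L R o\<^sub>L S' o\<^sub>L T) = n (S o\<^sub>L (R o\<^sub>L (S' o\<^sub>L T)))"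
      by (simp add: compose_assoc)
    also have "\<dots> \<le> n S * n (R o\<^sub>L (S' o\<^sub>L T))" by (rule submult) auto
    also have "\<dots> \<le> n S * (C * norm (S' o\<^sub>L T))" using C by (intro mult_left_mono nonneg) auto
    also have "\<dots> \<le> n S * (C * (norm S' * norm T))"
      using C by (intro mult_left_mono nonneg norm_blinfun_compose) auto
    finally show ?thesis by (simp add: mult.assoc)
  qed
  moreover have "n (T o\<^sub>L (S o\<^sub>L R o\<^sub>L S')) \<le> C' * norm S * n S' * norm T" if [simp]: "T \<in> ops" for T
  proof -
    have "n (T o\<^sub>L (S o\<^sub>L R o\<^sub>L S')) = n (((T o\<^sub>L S) o\<^sub>L R) o\<^sub>L S')"
      by (simp add: compose_assoc)
    also have "\<dots> \<le> n ((T o\<^sub>L S) o\<^sub>L R) * n S'" by (rule submult) auto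
    also have "\<dots> \<le> C' * norm (T o\<^sub>L S) * n S'" using C' by (intro mult_right_mono nonneg) auto
    also have "\<dots> \<le> C' * (norm T * norm S) * n S'"
      using C' by (intro mult_right_mono mult_left_mono nonneg norm_blinfun_compose) auto
    finally show ?thesis by (simp add: algebra_simps)
  qed
  ultimately show ?thesis unfolding tame_def by auto
qed

lemma bounded_between_compose:
  assumes "bounded_between R R'"
    and [simp]: "R \<in> ops" "R' \<in> ops" "S \<in> ops" "S' \<in> ops" "P \<in> ops" "P' \<in> ops"
  shows "bounded_between (S o\<^sub>L R o\<^sub>L S') (P' o\<^sub>L R' o\<^sub>L P)"
proof -
  obtain C where C: "0 \<le> C" "\<forall>T\<in>ops. n (R o\<^sub>L T o\<^sub>L R') \<le> C * norm T"
    using assms(1) by (rule bounded_betweenE)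
  have "n (S o\<^sub>L R o\<^sub>L S' o\<^sub>L T o\<^sub>L (P' o\<^sub>L R' o\<^sub>L P)) \<le> n S * C * norm S' * norm P' * n P * norm T"
    if [simp]: "T \<in> ops" for T
  proof -
    let ?T = "S' o\<^sub>L T o\<^sub>L P'"
    have "n (S o\<^sub>L R o\<^sub>L S' o\<^sub>L T o\<^sub>L (P' o\<^sub>L R' o\<^sub>L P)) = n (S o\<^sub>L ((R o\<^sub>L ?T o\<^sub>L R') o\<^sub>L P))"
      by (simp add: compose_assoc)
    also have "\<dots> \<le> n S * n ((R o\<^sub>L ?T o\<^sub>L R') o\<^sub>L P)" by (rule submult) auto
    also have "\<dots> \<le> n S * (n (R o\<^sub>L ?T o\<^sub>L R') * n P)" by (intro mult_left_mono nonneg submult) auto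
    also have "\<dots> \<le> n S * (C * norm ?T * n P)"
      using C by (intro mult_left_mono mult_right_mono nonneg) auto
    also have "\<dots> \<le> n S * (C * (norm S' * norm T * norm P') * n P)"
      using C by (intro mult_left_mono mult_right_mono nonneg)
        (auto intro!: order_trans[OF norm_blinfun_compose] mult_right_mono norm_blinfun_compose)
    finally show ?thesis by (simp add: algebra_simps)
  qed
  then show ?thesis unfolding bounded_between_def by auto
qed

lemma tame_bounded_between:
  assumes "tame R" and [simp]: "S \<in> ops"
  shows "bounded_between R S" "bounded_between S R"
proof -
  have R [simp]: "R \<in> ops" using assms(1) by (rule tame_ops)
  obtain C C' where C: "0 \<le> C" "\<forall>T\<in>ops. n (R o\<^sub>L T) \<le> C * norm T"
    and C': "0 \<le> C'" "\<forall>T\<in>ops. n (T o\<^sub>L R) \<le> C' * norm T"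
    using assms(1) by (rule tameE)
  have "n (R o\<^sub>L T o\<^sub>L S) \<le> C * n S * norm T" if [simp]: "T \<in> ops" for T
  proof -
    have "n (R o\<^sub>L T o\<^sub>L S) \<le> n (R o\<^sub>L T) * n S" by (rule submult) auto
    also have "\<dots> \<le> C * norm T * n S" using C by (intro mult_right_mono nonneg) auto
    finally show ?thesis by (simp add: algebra_simps)
  qed
  then show "bounded_between R S" unfolding bounded_between_def by auto
  have "n (S o\<^sub>L T o\<^sub>L R) \<le> n S * C' * norm T" if [simp]: "T \<in> ops" for T
  proof -
    have "n (S o\<^sub>L T o\<^sub>L R) = n (S o\<^sub>L (T o\<^sub>L R))" by (simp add: compose_assoc)
    also have "\<dots> \<le> n S * n (T o\<^sub>L R)" by (rule submult) auto
    also have "\<dots> \<le> n S * (C' * norm T)" using C' by (intro mult_left_mono nonneg) auto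
    finally show ?thesis by (simp add: algebra_simps)
  qed
  then show "bounded_between S R" unfolding bounded_between_def by auto
qed

lemma bounded_between_add:
  assumes "bounded_between R S" "bounded_between R' S"
    and [simp]: "R \<in> ops" "R' \<in> ops" "S \<in> ops"
  shows "bounded_between (R + R') S"
proof -
  obtain C C' where C: "\<forall>T\<in>ops. n (R o\<^sub>L T o\<^sub>L S) \<le> C * norm T" "\<forall>T\<in>ops. n (R' o\<^sub>L T o\<^sub>L S) \<le> C' * norm T"
    using assms(1,2) unfolding bounded_between_def by blast
  have "n ((R + R') o\<^sub>L T o\<^sub>L S) \<le> (C + C') * norm T" if [simp]: "T \<in> ops" for T
  proof -
    have "n ((R + R') o\<^sub>L T o\<^sub>L S) = n ((R o\<^sub>L T o\<^sub>L S) + (R' o\<^sub>L T o\<^sub>L S))"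
      by (simp add: compose_add_left)
    also have "\<dots> \<le> n (R o\<^sub>L T o\<^sub>L S) + n (R' o\<^sub>L T o\<^sub>L S)" by (rule triangle) auto
    also have "\<dots> \<le> C * norm T + C' * norm T" using C by (intro add_mono) auto
    finally show ?thesis by (simp add: algebra_simps)
  qed
  then show ?thesis unfolding bounded_between_def by auto
qed

lemma bounded_between_add_right:
  assumes "bounded_between S R" "bounded_between S R'"
    and [simp]: "R \<in> ops" "R' \<in> ops" "S \<in> ops"
  shows "bounded_between S (R + R')"
proof -
  obtain C C' where C: "\<forall>T\<in>ops. n (S o\<^sub>L T o\<^sub>L R) \<le> C * norm T" "\<forall>T\<in>ops. n (S o\<^sub>L T o\<^sub>L R') \<le> C' * norm T"
    using assms(1,2) unfolding bounded_between_def by blast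
  have "n (S o\<^sub>L T o\<^sub>L (R + R')) \<le> (C + C') * norm T" if [simp]: "T \<in> ops" for T
  proof -
    have "n (S o\<^sub>L T o\<^sub>L (R + R')) = n ((S o\<^sub>L T o\<^sub>L R) + (S o\<^sub>L T o\<^sub>L R'))"
      by (simp add: compose_add_right)
    also have "\<dots> \<le> n (S o\<^sub>L T o\<^sub>L R) + n (S o\<^sub>L T o\<^sub>L R')" by (rule triangle) auto
    also have "\<dots> \<le> C * norm T + C' * norm T" using C by (intro add_mono) auto
    finally show ?thesis by (simp add: algebra_simps)
  qed
  then show ?thesis unfolding bounded_between_def by auto
qed

text \<open>
  Boundedness of \<open>n \<circ> P\<close> is tested on sequences, and the bounds may carry weights that do not depend
  on the sequence: a bad sequence is chosen after the weights are known.
\<close>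

lemma bounded_if_bounded_on_sequences:
  assumes P: "\<And>r T. T \<in> ops \<Longrightarrow> P (r *\<^sub>R T) = r *\<^sub>R P T" "\<And>T. T \<in> ops \<Longrightarrow> P T \<in> ops"
    and w: "\<And>j::nat. 0 < w j"
    and bd: "\<And>T. (\<And>k. T k \<in> ops \<and> norm (T k) \<le> 1) \<Longrightarrow> \<exists>K. \<forall>j. n (P (T j)) \<le> w j * K"
  shows "\<exists>C. \<forall>T\<in>ops. n (P T) \<le> C * norm T"
proof -
  have "\<exists>K. \<forall>T\<in>ops. norm T \<le> 1 \<longrightarrow> n (P T) \<le> K"
  proof (rule ccontr)
    assume "\<not> ?thesis"
    then have "\<forall>K. \<exists>T. T \<in> ops \<and> norm T \<le> 1 \<and> K < n (P T)" by (meson not_le)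
    then have "\<forall>k::nat. \<exists>T. T \<in> ops \<and> norm T \<le> 1 \<and> real k * w k < n (P T)" by blast
    then obtain T where T: "T k \<in> ops \<and> norm (T k) \<le> 1" "real k * w k < n (P (T k))" for k
      by metis
    have "\<exists>K. \<forall>j. n (P (T j)) \<le> w j * K" by (rule bd) (use T(1) in blast)
    then obtain K where K: "\<forall>j. n (P (T j)) \<le> w j * K" by blast
    obtain k where k: "K < real k" using reals_Archimedean2 by blast
    have "real k * w k < K * w k" using T(2)[of k] K[rule_format, of k] by (simp add: mult.commute)
    with w[of k] k show False by simp
  qed
  then obtain K where K: "\<And>T. T \<in> ops \<Longrightarrow> norm T \<le> 1 \<Longrightarrow> n (P T) \<le> K" by blast
  have "n (P T) \<le> K * norm T" if T: "T \<in> ops" for T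
  proof (cases "T = 0")
    case True
    have "P T = 0" using P(1)[of T 0] T True by simp
    then show ?thesis using True by simp
  next
    case False
    have "n (P (inverse (norm T) *\<^sub>R T)) \<le> K" using False T by (intro K) auto
    then show ?thesis using False T by (simp add: P scaleR field_simps)
  qed
  then show ?thesis by blast
qed

text \<open>
  The coefficients \<open>c B k\<close> make the glued series converge. The value of the seminorm at
  one glued operator bounds all \<open>n (R T\<^sub>j)\<close> at once, with weights determined by \<open>U\<close> and \<open>V\<close>.
\<close>

lemma tame_if_replicable:
  assumes [simp]: "R \<in> ops" "\<And>k. U k \<in> ops" "\<And>k. V k \<in> ops"
    and VU: "\<And>j k::nat. V j o\<^sub>L U k = (if j = k then R else 0)"
  shows "tame R"
proof -
  define c where "c B k = inverse (2 ^ k * (norm (B k) + 1))"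
    for B :: "nat \<Rightarrow> ('a \<Rightarrow>\<^sub>C 'k) \<Rightarrow>\<^sub>L ('a \<Rightarrow>\<^sub>C 'k)" and k :: nat
  have c: "0 < c B k" "c B k * norm (B k) \<le> (1/2) ^ k" for B k
  proof -
    have pos: "0 < norm (B k) + 1" by (rule add_nonneg_pos) auto
    then show "0 < c B k" by (simp add: c_def)
    have "(1/2::real) ^ k = inverse (2 ^ k)" by (simp add: power_one_over inverse_eq_divide)
    then have "c B k * norm (B k) = (1/2) ^ k * (norm (B k) / (norm (B k) + 1))"
      by (simp only: c_def inverse_mult_distrib divide_inverse mult_ac)
    also have "\<dots> \<le> (1/2) ^ k" using pos by (intro mult_left_le) auto
    finally show "c B k * norm (B k) \<le> (1/2) ^ k" .
  qed
  have sm: "summable (\<lambda>k. c B k *\<^sub>R X k)" if "\<And>k. norm (X k) \<le> norm (B k)" for B X :: "nat \<Rightarrow> ('a \<Rightarrow>\<^sub>C 'k) \<Rightarrow>\<^sub>L ('a \<Rightarrow>\<^sub>C 'k)"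
  proof (rule summable_norm_cancel, rule summable_comparison_test)
    show "\<exists>N. \<forall>k\<ge>N. norm (norm (c B k *\<^sub>R X k)) \<le> (1/2) ^ k"
    proof (intro exI allI impI)
      fix k
      have "norm (norm (c B k *\<^sub>R X k)) = c B k * norm (X k)" using c(1)[of B k] by simp
      also have "\<dots> \<le> c B k * norm (B k)" using c(1)[of B k] that[of k] by simp
      finally show "norm (norm (c B k *\<^sub>R X k)) \<le> (1/2) ^ k" using c(2)[of B k] by linarith
    qed
  qed auto
  have "\<exists>C. \<forall>T\<in>ops. n (R o\<^sub>L T) \<le> C * norm T"
  proof (rule bounded_if_bounded_on_sequences[where w = "\<lambda>j. inverse (c U j) * n (V j) + 1"])
    fix T :: "nat \<Rightarrow> ('a \<Rightarrow>\<^sub>C 'k) \<Rightarrow>\<^sub>L ('a \<Rightarrow>\<^sub>C 'k)"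
    assume T: "\<And>k. T k \<in> ops \<and> norm (T k) \<le> 1"
    then have [simp]: "T k \<in> ops" for k by simp
    have "norm (U k o\<^sub>L T k) \<le> norm (U k)" for k
      using norm_blinfun_compose[of "U k" "T k"] T[of k] mult_left_le[of "norm (T k)" "norm (U k)"]
      by simp
    then have s: "summable (\<lambda>k. c U k *\<^sub>R (U k o\<^sub>L T k))" by (rule sm)
    define S where "S = (\<Sum>k. c U k *\<^sub>R (U k o\<^sub>L T k))"
    have S [simp]: "S \<in> ops" unfolding S_def using s by (rule ops_suminf) auto
    have "n (R o\<^sub>L T j) \<le> (inverse (c U j) * n (V j) + 1) * n S" for j
    proof -
      have "(\<lambda>k. V j o\<^sub>L (c U k *\<^sub>R (U k o\<^sub>L T k))) sums (V j o\<^sub>L S)"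
        unfolding S_def
        by (rule bounded_linear.sums[OF bounded_bilinear.bounded_linear_right[OF bounded_bilinear_blinfun_compose] summable_sums[OF s]])
      also have "(\<lambda>k. V j o\<^sub>L (c U k *\<^sub>R (U k o\<^sub>L T k))) = (\<lambda>k. if k = j then c U j *\<^sub>R (R o\<^sub>L T j) else 0)"
        by (rule ext) (auto simp: compose_scaleR_right VU compose_assoc[symmetric])
      finally have "V j o\<^sub>L S = c U j *\<^sub>R (R o\<^sub>L T j)"
        by (rule sums_unique2[OF _ sums_single[of j "\<lambda>_. c U j *\<^sub>R (R o\<^sub>L T j)"]])
      then have "R o\<^sub>L T j = inverse (c U j) *\<^sub>R (V j o\<^sub>L S)" using c(1)[of U j] by simp
      then have "n (R o\<^sub>L T j) = inverse (c U j) * n (V j o\<^sub>L S)" using c(1)[of U j]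
        by (simp add: scaleR)
      also have "\<dots> \<le> inverse (c U j) * (n (V j) * n S)" using c(1)[of U j]
        by (intro mult_left_mono submult) auto
      finally show ?thesis using nonneg[OF S] by (simp add: algebra_simps)
    qed
    then show "\<exists>K. \<forall>j. n (R o\<^sub>L T j) \<le> (inverse (c U j) * n (V j) + 1) * K" by blast
  next
    show "0 < inverse (c U j) * n (V j) + 1" for j
      using c(1)[of U j] nonneg[of "V j"] by (intro add_nonneg_pos mult_nonneg_nonneg) auto
  qed (auto simp: compose_scaleR_right)
  moreover have "\<exists>C. \<forall>T\<in>ops. n (T o\<^sub>L R) \<le> C * norm T"
  proof (rule bounded_if_bounded_on_sequences[where w = "\<lambda>j. inverse (c V j) * n (U j) + 1"])
    fix T :: "nat \<Rightarrow> ('a \<Rightarrow>\<^sub>C 'k) \<Rightarrow>\<^sub>L ('a \<Rightarrow>\<^sub>C 'k)"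
    assume T: "\<And>k. T k \<in> ops \<and> norm (T k) \<le> 1"
    then have [simp]: "T k \<in> ops" for k by simp
    have "norm (T k o\<^sub>L V k) \<le> norm (V k)" for k
      using norm_blinfun_compose[of "T k" "V k"] T[of k] mult_left_le[of "norm (T k)" "norm (V k)"]
      by (simp add: mult.commute)
    then have s: "summable (\<lambda>k. c V k *\<^sub>R (T k o\<^sub>L V k))" by (rule sm)
    define S where "S = (\<Sum>k. c V k *\<^sub>R (T k o\<^sub>L V k))"
    have S [simp]: "S \<in> ops" unfolding S_def using s by (rule ops_suminf) auto
    have "n (T j o\<^sub>L R) \<le> (inverse (c V j) * n (U j) + 1) * n S" for j
    proof -
      have "(\<lambda>k. (c V k *\<^sub>R (T k o\<^sub>L V k)) o\<^sub>L U j) sums (S o\<^sub>L U j)"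
        unfolding S_def
        by (rule bounded_linear.sums[OF bounded_bilinear.bounded_linear_left[OF bounded_bilinear_blinfun_compose] summable_sums[OF s]])
      also have "(\<lambda>k. (c V k *\<^sub>R (T k o\<^sub>L V k)) o\<^sub>L U j) = (\<lambda>k. if k = j then c V j *\<^sub>R (T j o\<^sub>L R) else 0)"
        by (rule ext) (auto simp: compose_scaleR_left VU compose_assoc)
      finally have "S o\<^sub>L U j = c V j *\<^sub>R (T j o\<^sub>L R)"
        by (rule sums_unique2[OF _ sums_single[of j "\<lambda>_. c V j *\<^sub>R (T j o\<^sub>L R)"]])
      then have "T j o\<^sub>L R = inverse (c V j) *\<^sub>R (S o\<^sub>L U j)" using c(1)[of V j] by simp
      then have "n (T j o\<^sub>L R) = inverse (c V j) * n (S o\<^sub>L U j)" using c(1)[of V j]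
        by (simp add: scaleR)
      also have "\<dots> \<le> inverse (c V j) * (n S * n (U j))" using c(1)[of V j]
        by (intro mult_left_mono submult) auto
      finally show ?thesis using nonneg[OF S] by (simp add: algebra_simps)
    qed
    then show "\<exists>K. \<forall>j. n (T j o\<^sub>L R) \<le> (inverse (c V j) * n (U j) + 1) * K" by blast
  next
    show "0 < inverse (c V j) * n (U j) + 1" for j
      using c(1)[of V j] nonneg[of "U j"] by (intro add_nonneg_pos mult_nonneg_nonneg) auto
  qed (auto simp: compose_scaleR_left)
  ultimately show ?thesis by (simp add: tame_def)
qed

end

section \<open>Order types of half-open intervals\<close>

text \<open>
  The order type of the interval \<open>(b, x)\<close>, represented inside the given well-order: \<open>col b\<close> is the
  Mostowski collapse of the final segment above \<open>b\<close>. It replaces ordinal arithmetic, since it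
  allows comparing intervals at different places as elements of one type.
\<close>

function col :: "'a::wellorder \<Rightarrow> 'a \<Rightarrow> 'a" where
  "col b x = (LEAST z. \<forall>y\<in>{b<..<x}. col b y < z)"
  by auto
termination
  by (relation "inv_image {(x, y). x < y} snd") (auto intro: wf_inv_image wf)

declare col.simps [simp del]

lemma col_le: "col b x \<le> x"
proof (induction x rule: less_induct)
  case (less x)
  have "\<forall>y\<in>{b<..<x}. col b y < x" using less by (meson greaterThanLessThan_iff le_less_trans)
  then show ?case by (subst col.simps) (rule Least_le)
qed

lemma col_less:
  assumes "b < y" "y < x"
  shows "col b y < col b x"
proof -
  have "\<forall>y\<in>{b<..<x}. col b y < x" using col_le by (meson greaterThanLessThan_iff le_less_trans)
  then have "\<forall>y\<in>{b<..<x}. col b y < (LEAST z. \<forall>y\<in>{b<..<x}. col b y < z)" by (rule LeastI)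
  then show ?thesis using assms by (subst (2) col.simps) auto
qed

lemma col_less_iff: "b < x \<Longrightarrow> b < y \<Longrightarrow> col b x < col b y \<longleftrightarrow> x < y"
  by (metis col_less less_asym' linorder_cases)

lemma col_inj: "b < x \<Longrightarrow> b < y \<Longrightarrow> col b x = col b y \<Longrightarrow> x = y"
  by (metis col_less less_irrefl linorder_cases)

text \<open>
  Minimality in the definition of \<open>col\<close>: no smaller value is an upper bound.
\<close>

lemma col_cofinal:
  assumes "c < col b x"
  obtains y where "b < y" "y < x" "c \<le> col b y"
proof -
  have "c < (LEAST z. \<forall>y\<in>{b<..<x}. col b y < z)" using assms by (subst (asm) col.simps)
  then have "\<not> (\<forall>y\<in>{b<..<x}. col b y < c)" by (rule not_less_Least)
  then show thesis using that by (auto simp: not_less)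
qed

text \<open>
  The image of a collapse has no holes, by minimality.
\<close>

lemma col_initial:
  assumes "c < col b x"
  obtains y where "b < y" "y < x" "col b y = c"
proof -
  let ?P = "\<lambda>y. b < y \<and> y < x \<and> c \<le> col b y"
  have ex: "\<exists>y. ?P y" using col_cofinal[OF assms] by blast
  define y where "y = (LEAST y. ?P y)"
  have y: "?P y" unfolding y_def using ex by (rule LeastI_ex)
  have "\<not> c < col b y"
  proof
    assume "c < col b y"
    then obtain y' where y': "b < y'" "y' < y" "c \<le> col b y'" by (rule col_cofinal)
    then have "?P y'" using y by auto
    then show False using not_less_Least[of y' ?P] y'(2) unfolding y_def by blast
  qed
  with y show thesis using that by (auto simp: not_less)
qed

lemma col_antimono: "b \<le> b' \<Longrightarrow> col b' x \<le> col b x"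
proof (induction x rule: less_induct)
  case (less x)
  have "col b' y < col b x" if "y \<in> {b'<..<x}" for y
    using less(1)[of y] less(2) col_less[of b y x] that le_less_trans[of b b' y] by simp
  then have "\<forall>y\<in>{b'<..<x}. col b' y < col b x" by blast
  then show ?case by (subst col.simps) (rule Least_le)
qed

text \<open>
  The order isomorphism between half-open intervals of equal order type that start at \<open>b\<close> and \<open>b'\<close>:
  corresponding points have the same collapse.
\<close>

definition transfer_pt :: "'a::wellorder \<Rightarrow> 'a \<Rightarrow> 'a \<Rightarrow> 'a" where
  "transfer_pt b b' x = (SOME z. b' < z \<and> col b' z = col b x)"

context
  fixes b t b' t' :: "'a::wellorder"
  assumes bt: "b < t" "b' < t'" "col b t = col b' t'"
begin

lemma transfer_pt:
  assumes "x \<in> {b<..t}"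
  shows "transfer_pt b b' x \<in> {b'<..t'}" "col b' (transfer_pt b b' x) = col b x"
proof -
  have "\<exists>z. b' < z \<and> col b' z = col b x"
  proof (cases "x = t")
    case False
    then have "col b x < col b' t'" using assms bt col_less[of b x t] by auto
    then show ?thesis by (metis col_initial)
  qed (use bt in auto)
  then have z: "b' < transfer_pt b b' x \<and> col b' (transfer_pt b b' x) = col b x"
    unfolding transfer_pt_def by (rule someI_ex)
  have "\<not> t' < transfer_pt b b' x"
    using z bt assms col_less_iff[of b' t' "transfer_pt b b' x"] col_less_iff[of b t x] by auto
  with z show "transfer_pt b b' x \<in> {b'<..t'}" "col b' (transfer_pt b b' x) = col b x" by auto
qed

lemma transfer_pt_less:
  assumes "x \<in> {b<..t}" "y \<in> {b<..t}"
  shows "transfer_pt b b' x < transfer_pt b b' y \<longleftrightarrow> x < y"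
  using transfer_pt[OF assms(1)] transfer_pt[OF assms(2)] assms
  by (metis col_less_iff greaterThanAtMost_iff)

lemma transfer_pt_unique:
  assumes "x \<in> {b<..t}" "b' < z" "col b' z = col b x"
  shows "transfer_pt b b' x = z"
  using transfer_pt[OF assms(1)] assms(2,3) by (auto intro: col_inj)

lemma transfer_pt_top: "transfer_pt b b' t = t'"
  using bt by (intro transfer_pt_unique) auto

end

lemma transfer_pt_inverse:
  assumes "b < t" "b' < t'" "col b t = col b' t'" "x \<in> {b<..t}"
  shows "transfer_pt b' b (transfer_pt b b' x) = x"
  using transfer_pt[OF assms] assms
  by (intro transfer_pt_unique[of b' t' b t]) auto

lemma isCont_transfer_pt:
  fixes b t b' t' :: "'a::{wellorder, linorder_topology}"
  assumes bt: "b < t" "b' < t'" "col b t = col b' t'" and x: "x \<in> {b<..t}"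
  shows "isCont (transfer_pt b b') x"
proof (rule isCont_monotoneI[where v = b])
  show "b < x" using x by simp
  show "transfer_pt b b' x' \<le> transfer_pt b b' x" if "b < x'" "x' \<le> x" for x'
    using transfer_pt_less[OF bt x, of x'] x that by (meson greaterThanAtMost_iff not_less order_trans)
  fix u assume u: "u < transfer_pt b b' x"
  show "\<exists>w<x. \<forall>x'. w < x' \<longrightarrow> x' \<le> x \<longrightarrow> u < transfer_pt b b' x'"
  proof (cases "u \<le> b'")
    case True
    have "u < transfer_pt b b' x'" if "b < x'" "x' \<le> x" for x'
    proof -
      have "transfer_pt b b' x' \<in> {b'<..t'}" using x that by (intro transfer_pt(1)[OF bt]) auto
      then show ?thesis using True by auto
    qed
    then show ?thesis using x by auto
  next
    case False
    have u': "u \<in> {b'<..t'}" using False u transfer_pt(1)[OF bt x] by auto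
    let ?w = "transfer_pt b' b u"
    have w: "?w \<in> {b<..t}" "transfer_pt b b' ?w = u"
      using transfer_pt(1)[OF bt(2,1) bt(3)[symmetric] u']
        transfer_pt_inverse[OF bt(2,1) bt(3)[symmetric] u'] by auto
    then have "?w < x" using u transfer_pt_less[OF bt w(1) x] by simp
    moreover have "u < transfer_pt b b' x'" if "?w < x'" "x' \<le> x" for x'
    proof -
      have "x' \<in> {b<..t}" using w(1) x that by auto
      then show ?thesis using transfer_pt_less[OF bt w(1)] w(2) that(1) by simp
    qed
    ultimately show ?thesis by blast
  qed
qed

lemma continuous_on_transfer_pt:
  fixes b t b' t' :: "'a::{wellorder, linorder_topology}"
  assumes "b < t" "b' < t'" "col b t = col b' t'"
  shows "continuous_on {b<..t} (transfer_pt b b')"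
  by (rule continuous_on_clopen_isCont) (auto intro!: isCont_transfer_pt[OF assms])

text \<open>
  Shortening \<open>(b, t)\<close> from the left does not lower its order type. Such an order type is additively
  indecomposable, a power of \<open>\<omega>\<close> (or zero, if \<open>t\<close> is the successor of \<open>b\<close>).
\<close>

definition indecomposable :: "'a::wellorder \<Rightarrow> 'a \<Rightarrow> bool" where
  "indecomposable b t \<longleftrightarrow> b < t \<and> (\<forall>y. b \<le> y \<longrightarrow> y < t \<longrightarrow> col y t = col b t)"

text \<open>
  Take \<open>b\<close> such that the order type of \<open>(b, t)\<close> is least; moving \<open>b\<close> to the right never raises it.
\<close>

lemma indecomposable_exists:
  fixes t :: "'a::wellorder"
  assumes "y < t"
  obtains b where "indecomposable b t"
proof -
  define c where "c = (LEAST c. \<exists>b<t. c = col b t)"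
  have "\<exists>b<t. c = col b t" unfolding c_def by (rule LeastI) (use assms in blast)
  then obtain b where b: "b < t" "c = col b t" by blast
  have "col y t = col b t" if "b \<le> y" "y < t" for y
  proof (rule antisym)
    show "col y t \<le> col b t" using that by (rule_tac col_antimono)
    show "col b t \<le> col y t" unfolding b(2)[symmetric] c_def by (rule Least_le) (use that in blast)
  qed
  then show thesis using b that unfolding indecomposable_def by blast
qed

text \<open>
  An interval shorter than an indecomposable one can be copied inside it, to the right of any
  given point, because the tail beyond that point still has the full order type.
\<close>

lemma indecomposable_copy:
  fixes b t b' t' y :: "'a::{wellorder, linorder_topology}"
  assumes ind: "indecomposable b' t'" and y: "b' \<le> y" "y < t'" and bt: "b < t" "col b t < col b' t'"
  defines "z \<equiv> transfer_pt b y t"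
  shows "y < z" "z < t'" "col y z = col b t"
proof -
  have "col y t' = col b' t'" using ind y unfolding indecomposable_def by blast
  then have "col b t < col y t'" using bt(2) by simp
  then obtain z' where z': "y < z'" "z' < t'" "col y z' = col b t" by (rule col_initial)
  have "z = z'" unfolding z_def by (rule transfer_pt_top) (use z' bt in auto)
  with z' show "y < z" "z < t'" "col y z = col b t" by auto
qed

lemma id_compose [simp]: "id_blinfun o\<^sub>L T = T" "T o\<^sub>L id_blinfun = T"
  by (rule blinfun_eqI, simp)+

section \<open>Tame operators from disjoint copies\<close>

text \<open>
  Up to the rank-one operator \<open>g \<mapsto> g(t) 1\<close>, this is the projection onto the functions
  on \<open>(b, t]\<close>. Subtracting the value at \<open>t\<close> leaves the functions that vanish at \<open>t\<close>, which can be
  moved around without control at the limit \<open>t\<close>.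
\<close>

definition shift_op :: "'a::{wellorder, linorder_topology} \<Rightarrow> 'a \<Rightarrow> ('a \<Rightarrow>\<^sub>C 'k::real_normed_field) \<Rightarrow>\<^sub>L ('a \<Rightarrow>\<^sub>C 'k)" where
  "shift_op b t = proj {b<..t} - comp_op {b<..t} (\<lambda>_. t)"

lemma shift_op_apply [simp]:
  "apply_bcontfun (blinfun_apply (shift_op b t) g) x = (if x \<in> {b<..t} then g x - g t else 0)"
  by (simp add: shift_op_def blinfun.diff_left continuous_on_id)

lemma shift_op_ops [simp]: "shift_op b t \<in> ops"
  by (simp add: shift_op_def continuous_on_id)

context algebra_seminorm
begin

text \<open>
  An operator of rank one that evaluates at \<open>t\<close> can pass its value through any of the disjoint
  sets \<open>G k\<close>.
\<close>

lemma tame_const: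
  fixes t :: 'a
  assumes "infinite (UNIV :: 'a set)" and [simp]: "clopen E"
  shows "tame (comp_op E (\<lambda>_. t))"
proof -
  define z where "z = enumerate (UNIV :: 'a set)"
  have z: "z j < z k \<longleftrightarrow> j < k" for j k
    unfolding z_def using assms(1) by (simp add: strict_mono_less strict_mono_enumerate)
  define G where "G k = {z k<..z (Suc k)}" for k
  have G: "clopen (G k)" for k unfolding G_def by simp
  have zG: "z (Suc j) \<in> G k \<longleftrightarrow> j = k" for j k
    unfolding G_def by (auto simp: z not_less[symmetric] less_Suc_eq)
  show ?thesis
  proof (rule tame_if_replicable)
    show "comp_op E (\<lambda>_. z (Suc j)) o\<^sub>L comp_op (G k) (\<lambda>_. t) = (if j = k then comp_op E (\<lambda>_. t) else (0 :: ('a \<Rightarrow>\<^sub>C 'k) \<Rightarrow>\<^sub>L ('a \<Rightarrow>\<^sub>C 'k)))"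
      for j k
      using G by (intro op_eqI) (simp add: zG)
  qed (auto simp: G)
qed

text \<open>
  A corner between two rank-one operators is one-dimensional. This is the only case that occurs for
  finite \<open>K\<close>, where rank-one operators are not replicable.
\<close>

lemma bounded_between_const:
  assumes [simp]: "clopen E" "clopen F"
  shows "bounded_between (comp_op E (\<lambda>_. s)) (comp_op F (\<lambda>_. t))"
  unfolding bounded_between_def
proof (intro exI ballI)
  fix T :: "('a \<Rightarrow>\<^sub>C 'k) \<Rightarrow>\<^sub>L ('a \<Rightarrow>\<^sub>C 'k)"
  assume T: "T \<in> ops"
  let ?W = "comp_op E (\<lambda>_. t) :: ('a \<Rightarrow>\<^sub>C 'k) \<Rightarrow>\<^sub>L ('a \<Rightarrow>\<^sub>C 'k)"
  let ?c = "apply_bcontfun (blinfun_apply T (ind F)) s"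
  have F: "blinfun_apply (comp_op F (\<lambda>_. t)) g = scale_bcontfun (g t) (ind F)" for g :: "'a \<Rightarrow>\<^sub>C 'k"
    by (rule bcontfun_eqI) simp
  have eq: "comp_op E (\<lambda>_. s) o\<^sub>L T o\<^sub>L comp_op F (\<lambda>_. t) = scale_blinfun ?c ?W"
    by (rule op_eqI) (simp add: F opsD[OF T])
  have "norm ?c \<le> norm (blinfun_apply T (ind F))" by (rule norm_bounded)
  also have "\<dots> \<le> norm T * norm (ind F :: 'a \<Rightarrow>\<^sub>C 'k)" by (rule norm_blinfun)
  also have "\<dots> \<le> norm T * 1" by (intro mult_left_mono norm_bound) auto
  finally have "norm ?c * n ?W \<le> norm T * n ?W" by (intro mult_right_mono nonneg) auto
  then show "n (comp_op E (\<lambda>_. s) o\<^sub>L T o\<^sub>L comp_op F (\<lambda>_. t)) \<le> n ?W * norm T"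
    unfolding eq by (simp add: homogeneous mult.commute)
qed

text \<open>
  The points \<open>y k\<close> bound consecutive copies of \<open>(b, t]\<close> inside \<open>(b', t')\<close>; the transfer maps to and
  from these copies give the operators for \<open>tame_if_replicable\<close>.
\<close>

lemma tame_smaller_interval:
  assumes ind: "indecomposable b' t'" and bt: "b < t" "col b t < col b' t'"
  shows "tame (proj {b<..t})"
proof -
  define y where "y = rec_nat b' (\<lambda>_ v. transfer_pt b v t)"
  have y0: "y 0 = b'" and yS: "y (Suc k) = transfer_pt b (y k) t" for k by (simp_all add: y_def)
  have y: "b' \<le> y k \<and> y k < t'" for k
  proof (induction k)
    case 0 then show ?case using ind by (simp add: y0 indecomposable_def)
  next
    case (Suc k)
    then show ?case using indecomposable_copy(1,2)[OF ind _ _ bt, of "y k"]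
      unfolding yS by (meson less_imp_le order_trans)
  qed
  have yk: "y k < y (Suc k)" "col (y k) (y (Suc k)) = col b t" for k
    using indecomposable_copy[OF ind _ _ bt, of "y k"] y[of k] unfolding yS by auto
  have mono: "y j \<le> y k" if "j \<le> k" for j k
    using lift_Suc_mono_le[of y j k] yk(1) that by (simp add: less_imp_le)
  have disj: "x \<notin> {y k<..y (Suc k)}" if "x \<in> {y j<..y (Suc j)}" "j \<noteq> k" for x j k
  proof (cases "j < k")
    case True
    then show ?thesis using that(1) mono[of "Suc j" k] by auto
  next
    case False
    then show ?thesis using that mono[of "Suc k" j] by auto
  qed
  note c1 = continuous_on_transfer_pt[OF yk(1) bt(1) yk(2)]
    and c2 = continuous_on_transfer_pt[OF bt(1) yk(1) yk(2)[symmetric]]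
  show ?thesis
  proof (rule tame_if_replicable)
    show "comp_op {b<..t} (transfer_pt b (y j)) o\<^sub>L comp_op {y k<..y (Suc k)} (transfer_pt (y k) b)
      = (if j = k then proj {b<..t} else (0 :: ('a \<Rightarrow>\<^sub>C 'k) \<Rightarrow>\<^sub>L ('a \<Rightarrow>\<^sub>C 'k)))" for j k
    proof (rule op_eqI)
      fix g :: "'a \<Rightarrow>\<^sub>C 'k" and x
      show "apply_bcontfun (blinfun_apply (comp_op {b<..t} (transfer_pt b (y j))
           o\<^sub>L comp_op {y k<..y (Suc k)} (transfer_pt (y k) b)) g) x
        = apply_bcontfun (blinfun_apply (if j = k then proj {b<..t} else 0) g) x"
      proof (cases "x \<in> {b<..t}")
        case True
        show ?thesis
          using transfer_pt(1)[OF bt(1) yk(1) yk(2)[symmetric] True, of j]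
            transfer_pt_inverse[OF bt(1) yk(1) yk(2)[symmetric] True, of j]
            disj[of "transfer_pt b (y j) x" j k] True
          by (cases "j = k") (simp_all add: c1 c2 continuous_on_id del: greaterThanAtMost_iff)
      next
        case False
        then show ?thesis by (simp add: c1 c2 continuous_on_id del: greaterThanAtMost_iff)
      qed
    qed
  qed (auto simp: c1 c2 continuous_on_id)
qed

lemma tame_shift_op:
  assumes "tame (proj {b<..t})"
  shows "tame (shift_op b t)"
proof -
  have "shift_op b t = id_blinfun o\<^sub>L proj {b<..t} o\<^sub>L (shift_op b t :: ('a \<Rightarrow>\<^sub>C 'k) \<Rightarrow>\<^sub>L ('a \<Rightarrow>\<^sub>C 'k))"
    by (rule op_eqI) (simp add: continuous_on_id)
  then show ?thesis using tame_compose[OF assms, of id_blinfun "shift_op b t"] by simp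
qed

text \<open>
  The transfer maps between the two intervals conjugate one shift operator into the other.
\<close>

lemma bounded_between_same_type:
  assumes bb: "bounded_between (shift_op b t) (shift_op b t)"
    and bt: "b < t" "b' < t'" "col b t = col b' t'"
  shows "bounded_between (shift_op b t) (shift_op b' t')"
proof -
  let ?A = "comp_op {b'<..t'} (transfer_pt b' b) :: ('a \<Rightarrow>\<^sub>C 'k) \<Rightarrow>\<^sub>L ('a \<Rightarrow>\<^sub>C 'k)"
  let ?B = "comp_op {b<..t} (transfer_pt b b') :: ('a \<Rightarrow>\<^sub>C 'k) \<Rightarrow>\<^sub>L ('a \<Rightarrow>\<^sub>C 'k)"
  note bt' = bt(2,1) bt(3)[symmetric]
  note c = continuous_on_transfer_pt[OF bt] continuous_on_transfer_pt[OF bt']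
  have "shift_op b' t' = ?A o\<^sub>L shift_op b t o\<^sub>L ?B"
  proof (rule op_eqI)
    fix g :: "'a \<Rightarrow>\<^sub>C 'k" and x
    show "apply_bcontfun (blinfun_apply (shift_op b' t') g) x
      = apply_bcontfun (blinfun_apply (?A o\<^sub>L shift_op b t o\<^sub>L ?B) g) x"
    proof (cases "x \<in> {b'<..t'}")
      case True
      show ?thesis using transfer_pt(1)[OF bt' True] transfer_pt_inverse[OF bt' True] transfer_pt_top[OF bt] True bt(1)
        by (simp add: c del: greaterThanAtMost_iff) simp
    qed (simp add: c del: greaterThanAtMost_iff)
  qed
  then show ?thesis
    using bounded_between_compose[OF bb, of id_blinfun id_blinfun ?B ?A] by (simp add: c)
qed

end

section \<open>Sets of closure points\<close>

lemma prod_encode_mono_snd: "i \<le> j \<Longrightarrow> prod_encode (k, i) \<le> prod_encode (k, j)"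
  by (auto simp: prod_encode_def triangle_def intro!: div_le_mono mult_le_mono simp del: mult_Suc mult_Suc_right)

lemma isCont_local:
  assumes "clopen S" "x \<in> S" "\<And>x'. x' \<in> S \<Longrightarrow> f x' = g x'" "isCont g x"
  shows "isCont f x"
proof -
  have "\<forall>\<^sub>F x' in nhds x. f x' = g x'"
    using assms(1-3) by (auto simp: eventually_nhds clopen_def)
  then show ?thesis using assms(4) isCont_cong by blast
qed

text \<open>
  The closed set \<open>D\<close> of the points in \<open>(b, t]\<close> that are closed under \<open>h\<close>. The growth condition
  \<open>h_copy\<close> says that \<open>(x, h x]\<close> contains a copy of \<open>(b, x]\<close>, in analogy to
  the inequality \<open>x + x \<le> h x\<close> of ordinal arithmetic. The complement of \<open>D\<close> consists of the gaps
  \<open>(h\<^sup>j e, h\<^sup>j\<^sup>+\<^sup>1 e]\<close>, where \<open>e\<close> is \<open>b\<close> or a point of \<open>D\<close>, and each of these gaps has a copy inside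
  every later gap with the same \<open>e\<close>.
\<close>

locale closure_points =
  fixes b t :: "'a::{wellorder, linorder_topology}" and h :: "'a \<Rightarrow> 'a"
  assumes indec: "indecomposable b t"
    and h_less: "b \<le> x \<Longrightarrow> x < t \<Longrightarrow> x < h x" "b \<le> x \<Longrightarrow> x < t \<Longrightarrow> h x < t"
    and h_mono: "b \<le> x \<Longrightarrow> x \<le> y \<Longrightarrow> y < t \<Longrightarrow> h x \<le> h y"
    and h_copy: "b < x \<Longrightarrow> x < t \<Longrightarrow> transfer_pt b x x \<le> h x"
begin

definition D :: "'a set" where
  "D = {c \<in> {b<..t}. \<forall>y. b \<le> y \<longrightarrow> y < c \<longrightarrow> h y < c}"

definition next_pt :: "'a \<Rightarrow> 'a" where
  "next_pt x = (LEAST c. c \<in> D \<and> x \<le> c)"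

lemma bt: "b < t"
  using indec by (simp add: indecomposable_def)

lemma D_bounds: "c \<in> D \<Longrightarrow> b < c \<and> c \<le> t"
  by (simp add: D_def)

lemma D_closed_under: "c \<in> D \<Longrightarrow> b \<le> y \<Longrightarrow> y < c \<Longrightarrow> h y < c"
  by (simp add: D_def)

lemma top_in_D: "t \<in> D"
  using bt h_less by (auto simp: D_def)

lemma next_pt:
  assumes "x \<le> t"
  shows "next_pt x \<in> D" "x \<le> next_pt x" "\<And>c. c \<in> D \<Longrightarrow> x \<le> c \<Longrightarrow> next_pt x \<le> c"
proof -
  have "\<exists>c. c \<in> D \<and> x \<le> c" using top_in_D assms by blast
  then have "next_pt x \<in> D \<and> x \<le> next_pt x" unfolding next_pt_def by (rule LeastI_ex)
  then show "next_pt x \<in> D" "x \<le> next_pt x" by auto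
  show "next_pt x \<le> c" if "c \<in> D" "x \<le> c" for c unfolding next_pt_def by (rule Least_le) (use that in blast)
qed

lemma next_pt_D: "c \<in> D \<Longrightarrow> next_pt c = c"
  using next_pt[of c] D_bounds[of c] by (auto intro: antisym)

lemma next_pt_bounds: "x \<in> {b<..t} \<Longrightarrow> next_pt x \<in> {b<..t}"
  using next_pt(1)[of x] D_bounds by auto

definition it :: "'a \<Rightarrow> nat \<Rightarrow> 'a" where
  "it e j = (h ^^ j) e"

lemma it_simps [simp]: "it e 0 = e" "it e (Suc j) = h (it e j)"
  by (simp_all add: it_def)

lemma it_bounds:
  assumes "b \<le> e" "e < t"
  shows "e \<le> it e j \<and> it e j < t"
proof (induction j)
  case (Suc j)
  then have "b \<le> it e j" using assms(1) order_trans by blast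
  then show ?case using h_less[of "it e j"] Suc by (auto intro: order_trans less_imp_le)
qed (use assms in simp)

lemma it_less:
  assumes "b \<le> e" "e < t"
  shows "it e j < it e k \<longleftrightarrow> j < k"
proof -
  have "strict_mono (it e)"
    unfolding strict_mono_Suc_iff using it_bounds[OF assms] h_less(1) assms
    by (metis it_simps(2) order_trans)
  then show ?thesis by (rule strict_mono_less)
qed

lemma it_below:
  assumes "c \<in> D" "b \<le> e" "e < c"
  shows "it e j < c"
proof (induction j)
  case (Suc j)
  have "e \<le> it e j" using it_bounds[of e j] assms D_bounds[OF assms(1)] by auto
  then have "b \<le> it e j" using assms(2) order_trans by blast
  then show ?case using D_closed_under[OF assms(1)] Suc by simp
qed (use assms in simp)

text \<open>
  The supremum of the iterates of \<open>h\<close> is closed under \<open>h\<close>, since \<open>h\<close> is monotone.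
\<close>

lemma D_between:
  assumes "b \<le> e" "e < t" "\<And>j. it e j < x" "x \<le> t"
  obtains c where "c \<in> D" "e < c" "c \<le> x"
proof -
  define s where "s = (LEAST u. \<forall>j. it e j \<le> u)"
  have sx: "s \<le> x" unfolding s_def by (rule Least_le) (use assms(3) in \<open>auto intro: less_imp_le\<close>)
  have le: "\<forall>j. it e j \<le> s" unfolding s_def by (rule LeastI) (use assms(3) in \<open>auto intro: less_imp_le\<close>)
  have lt: "it e j < s" for j using le it_less[OF assms(1,2), of j "Suc j"] by (meson lessI less_le_trans)
  have "h y < s" if y: "b \<le> y" "y < s" for y
  proof -
    obtain j where "y < it e j" using not_less_Least[OF y(2)[unfolded s_def]] by (auto simp: not_le)
    then have "h y \<le> h (it e j)" using y it_bounds[OF assms(1,2)] by (intro h_mono) auto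
    also have "\<dots> < s" using lt[of "Suc j"] by simp
    finally show ?thesis .
  qed
  then have "s \<in> D" using lt[of 0] sx assms(1,4) by (auto simp: D_def)
  then show thesis using that sx lt[of 0] by auto
qed

definition root :: "'a \<Rightarrow> bool" where
  "root e \<longleftrightarrow> e < t \<and> (e = b \<or> e \<in> D)"

definition gap :: "'a \<Rightarrow> nat \<Rightarrow> 'a set" where
  "gap e j = {it e j<..it e (Suc j)}"

lemma root_bounds: "root e \<Longrightarrow> b \<le> e \<and> e < t"
  unfolding root_def using D_bounds less_imp_le by blast

lemma clopen_gap [simp]: "clopen (gap e j)"
  by (simp add: gap_def del: it_simps)

lemma gap_subset:
  assumes "root e" "x \<in> gap e j"
  shows "b < x" "x < t" "e < x"
proof -
  have "b \<le> e" "e \<le> it e j" "it e (Suc j) < t" using it_bounds root_bounds[OF assms(1)] by blast+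
  moreover have "it e j < x" "x \<le> it e (Suc j)" using assms(2) unfolding gap_def by auto
  ultimately show "b < x" "x < t" "e < x" by (meson le_less_trans)+
qed

lemma gap_not_D:
  assumes "root e" "x \<in> gap e j"
  shows "x \<notin> D"
proof
  assume "x \<in> D"
  moreover have "b \<le> it e j" using it_bounds[of e j] root_bounds[OF assms(1)] order_trans by blast
  ultimately show False using D_closed_under[of x "it e j"] assms(2) by (auto simp: gap_def)
qed

lemma gap_below:
  assumes "root e" "x \<in> gap e j" "c \<in> D" "e < c"
  shows "x < c"
  using it_below[OF assms(3), of e "Suc j"] assms root_bounds[OF assms(1)] by (auto simp: gap_def)

lemma gap_unique:
  assumes "root e" "x \<in> gap e j" "root e'" "x \<in> gap e' j'"
  shows "e = e'" "j = j'"
proof -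
  have *: "\<not> e < e'" if "root e" "x \<in> gap e j" "root e'" "x \<in> gap e' j'" for e e' j j'
    using gap_below[OF that(1,2), of e'] gap_subset[OF that(3,4)] that root_bounds[OF that(1)]
    by (auto simp: root_def)
  show e: "e = e'" using *[OF assms] *[OF assms(3,4,1,2)] by simp
  have "it e j < it e (Suc j')" "it e j' < it e (Suc j)" using assms unfolding gap_def e by auto
  then show "j = j'" using it_less[of e] root_bounds[OF assms(1)] by (simp del: it_simps)
qed

text \<open>
  For \<open>x\<close> outside \<open>D\<close> let \<open>e\<close> be least such that \<open>(e, x]\<close> does not meet \<open>D\<close>. Then \<open>e\<close> is
  \<open>b\<close> or lies in \<open>D\<close>, because the complement of \<open>D\<close> is open to the left, and the iterates of
  \<open>h\<close> at \<open>e\<close> must pass \<open>x\<close>.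
\<close>

lemma gap_exists:
  assumes "x \<in> {b<..t}" "x \<notin> D"
  obtains e j where "root e" "x \<in> gap e j"
proof -
  let ?P = "\<lambda>e. b \<le> e \<and> e < x \<and> (\<forall>c. e < c \<longrightarrow> c \<le> x \<longrightarrow> c \<notin> D)"
  define e where "e = (LEAST e. ?P e)"
  have free: "\<exists>y. b \<le> y \<and> y < x' \<and> (\<forall>c. y < c \<longrightarrow> c \<le> x' \<longrightarrow> c \<notin> D)"
    if x': "x' \<in> {b<..t}" "x' \<notin> D" for x'
  proof -
    obtain y where y: "b \<le> y" "y < x'" "x' \<le> h y" using x' by (auto simp: D_def not_less)
    then have "c \<notin> D" if "y < c" "c \<le> x'" for c
      using D_closed_under[of c y] that by auto
    then show ?thesis using y by blast
  qed
  have e: "?P e" unfolding e_def using free[OF assms] by (rule LeastI_ex)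
  have root: "root e"
  proof (rule ccontr)
    assume "\<not> root e"
    then have "e \<in> {b<..t}" "e \<notin> D" using e assms by (auto simp: root_def)
    from free[OF this] obtain y where "b \<le> y" "y < e" "\<forall>c. y < c \<longrightarrow> c \<le> e \<longrightarrow> c \<notin> D" by blast
    then have "?P y" using e by (meson leI less_trans)
    then show False using not_less_Least[of y ?P] \<open>y < e\<close> unfolding e_def by blast
  qed
  have "\<exists>j. x \<in> gap e j"
  proof (rule ccontr)
    assume no: "\<not> ?thesis"
    have "it e j < x" for j
    proof (induction j)
      case (Suc j)
      then show ?case using no by (auto simp: gap_def not_le)
    qed (use e in simp)
    then obtain c where "c \<in> D" "e < c" "c \<le> x"
      using D_between[of e x] root_bounds[OF root] assms(1) by auto
    then show False using e by blast
  qed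
  then show thesis using that root by blast
qed

lemma next_pt_gap:
  assumes "root e" "x \<in> gap e j" "x' \<in> gap e j"
  shows "next_pt x = next_pt x'"
proof -
  have "x \<le> c \<longleftrightarrow> x' \<le> c" if "c \<in> D" for c
  proof -
    have "\<not> (y \<le> c \<and> c < y')" if "y \<in> gap e j" "y' \<in> gap e j" for y y'
      using gap_not_D[OF assms(1), of c j] \<open>c \<in> D\<close> that unfolding gap_def
      by (meson greaterThanAtMost_iff less_imp_le less_le_trans order_trans)
    then show ?thesis using assms(2,3) by (meson not_le)
  qed
  then show ?thesis unfolding next_pt_def by metis
qed

text \<open>
  The map \<open>embed k\<close> fixes \<open>D\<close> and moves the gap with index \<open>i\<close> above \<open>e\<close> into the one with index
  \<open>1 + \<langle>k, i\<rangle>\<close> above the same \<open>e\<close>, so that the images for different \<open>k\<close> are disjoint outside \<open>D\<close>. The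
  pairing satisfies \<open>i \<le> \<langle>k, i\<rangle>\<close>, hence the source gap lies below the copy that is used. The map
  \<open>retract k\<close> inverts \<open>embed k\<close> and sends everything else to the next point of \<open>D\<close>.
\<close>

definition embed :: "nat \<Rightarrow> 'a \<Rightarrow> 'a" where
  "embed k x = (if x \<in> D then x else
     (let (e, i) = (SOME p. root (fst p) \<and> x \<in> gap (fst p) (snd p)) in
      transfer_pt b (it e (Suc (prod_encode (k, i)))) x))"

definition retract :: "nat \<Rightarrow> 'a \<Rightarrow> 'a" where
  "retract k z = (if \<exists>x\<in>{b<..t} - D. embed k x = z
     then (SOME x. x \<in> {b<..t} - D \<and> embed k x = z) else next_pt z)"

lemma embed_D: "x \<in> D \<Longrightarrow> embed k x = x"
  by (simp add: embed_def)

lemma embed_gap: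
  assumes "root e" "x \<in> gap e i"
  shows "embed k x = transfer_pt b (it e (Suc (prod_encode (k, i)))) x"
proof -
  have "(SOME p. root (fst p) \<and> x \<in> gap (fst p) (snd p)) = (e, i)"
  proof (rule some_equality)
    fix p assume "root (fst p) \<and> x \<in> gap (fst p) (snd p)"
    then show "p = (e, i)" using gap_unique[OF assms, of "fst p" "snd p"] by (simp add: prod_eq_iff)
  qed (use assms in simp)
  then show ?thesis using gap_not_D[OF assms] by (simp add: embed_def)
qed

lemma copy:
  fixes k i :: nat
  assumes "root e"
  defines "y \<equiv> it e (Suc (prod_encode (k, i)))"
  shows "b < y" "y < transfer_pt b y y" "col y (transfer_pt b y y) = col b y"
    "gap e i \<subseteq> {b<..y}" "{y<..transfer_pt b y y} \<subseteq> gap e (Suc (prod_encode (k, i)))"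
proof -
  note e = root_bounds[OF assms(1)]
  show b: "b < y" unfolding y_def using it_less[of e 0 "Suc (prod_encode (k, i))"] e by auto
  have t: "y < t" unfolding y_def using it_bounds e by blast
  have "col b y < col b t" using b t by (rule col_less)
  from indecomposable_copy[OF indec _ t b this]
  show "y < transfer_pt b y y" "col y (transfer_pt b y y) = col b y" using b by auto
  have "it e (Suc i) \<le> y"
    unfolding y_def using it_less[of e "Suc (prod_encode (k, i))" "Suc i"] e le_prod_encode_2[of i k]
    by (meson Suc_le_mono not_less)
  then show "gap e i \<subseteq> {b<..y}" using gap_subset(1)[OF assms(1)] by (auto simp: gap_def simp del: it_simps)
  show "{y<..transfer_pt b y y} \<subseteq> gap e (Suc (prod_encode (k, i)))"
    using h_copy[OF b t] unfolding gap_def it_simps(2)[of e "Suc (prod_encode (k, i))"] y_def[symmetric] by auto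
qed

lemma embed_in_gap:
  assumes "root e" "x \<in> gap e i"
  shows "embed k x \<in> gap e (Suc (prod_encode (k, i)))" "x < embed k x"
proof -
  note c = copy[OF assms(1), where k = k and i = i]
  have x: "x \<in> {b<..it e (Suc (prod_encode (k, i)))}" using c(4) assms(2) by auto
  from transfer_pt(1)[OF c(1,2) c(3)[symmetric] x] c(5)
  show "embed k x \<in> gap e (Suc (prod_encode (k, i)))" unfolding embed_gap[OF assms] by blast
  show "x < embed k x" using transfer_pt(1)[OF c(1,2) c(3)[symmetric] x] x
    unfolding embed_gap[OF assms] by (meson greaterThanAtMost_iff le_less_trans)
qed

lemma embed_bounds:
  assumes "x \<in> {b<..t}"
  shows "embed k x \<in> {b<..t}" "x \<le> embed k x" "embed k x \<le> next_pt x" "embed k x \<in> D \<longleftrightarrow> x \<in> D"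
proof -
  have "embed k x \<in> {b<..t} \<and> x \<le> embed k x \<and> embed k x \<le> next_pt x \<and> (embed k x \<in> D \<longleftrightarrow> x \<in> D)"
  proof (cases "x \<in> D")
    case True
    then show ?thesis using assms by (simp add: embed_D next_pt_D)
  next
    case False
    then obtain e i where ei: "root e" "x \<in> gap e i" using gap_exists assms by blast
    have "e < next_pt x" using gap_subset(3)[OF ei] next_pt(2)[of x] assms by (auto intro: less_le_trans)
    then have "embed k x < next_pt x"
      using gap_below[OF ei(1) embed_in_gap(1)[OF ei]] next_pt(1)[of x] assms by simp
    then show ?thesis
      using gap_subset[OF ei(1) embed_in_gap(1)[OF ei]] embed_in_gap(2)[OF ei]
        gap_not_D[OF ei(1) embed_in_gap(1)[OF ei]] False by (simp add: less_imp_le)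
  qed
  then show "embed k x \<in> {b<..t}" "x \<le> embed k x" "embed k x \<le> next_pt x" "embed k x \<in> D \<longleftrightarrow> x \<in> D"
    by blast+
qed

lemma embed_inj:
  assumes "x \<in> {b<..t} - D" "x' \<in> {b<..t} - D" "embed k x = embed l x'"
  shows "x = x'" "k = l"
proof -
  obtain e i where ei: "root e" "x \<in> gap e i" using gap_exists assms(1) by blast
  obtain e' i' where ei': "root e'" "x' \<in> gap e' i'" using gap_exists assms(2) by blast
  from gap_unique[OF ei(1) embed_in_gap(1)[OF ei, of k] ei'(1), of "Suc (prod_encode (l, i'))"]
    embed_in_gap(1)[OF ei', of l] assms(3)
  have eq: "e = e'" "i = i'" "k = l" by (auto simp: prod_encode_eq)
  then show "k = l" by simp
  note c = copy[OF ei(1), where k = k and i = i]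
  define y where "y = it e (Suc (prod_encode (k, i)))"
  have x: "x \<in> {b<..y}" and x': "x' \<in> {b<..y}" using c(4) ei(2) ei'(2) unfolding y_def eq by blast+
  have "transfer_pt b y x = transfer_pt b y x'"
    using assms(3) unfolding embed_gap[OF ei] embed_gap[OF ei'] y_def eq .
  then show "x = x'"
    using transfer_pt_inverse[OF c(1,2) c(3)[symmetric], folded y_def, OF x]
      transfer_pt_inverse[OF c(1,2) c(3)[symmetric], folded y_def, OF x'] by argo
qed

lemma retract_embed:
  assumes "x \<in> {b<..t}"
  shows "retract k (embed k x) = x"
proof (cases "x \<in> D")
  case True
  then have "\<not> (\<exists>x'\<in>{b<..t} - D. embed k x' = embed k x)"
    using embed_bounds(4) embed_D by (metis Diff_iff)
  then show ?thesis using True by (simp add: retract_def embed_D next_pt_D)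
next
  case False
  then show ?thesis unfolding retract_def
    using assms embed_inj(1)[where k = k and l = k]
    by (auto intro!: some_equality)
qed

lemma retract_embed_other:
  assumes "x \<in> {b<..t}" "j \<noteq> k"
  shows "retract k (embed j x) \<in> D"
proof -
  have "\<not> (\<exists>x'\<in>{b<..t} - D. embed k x' = embed j x)"
    using embed_bounds(4) embed_inj(2) assms by (metis Diff_iff)
  moreover have "next_pt (embed j x) \<in> D" using embed_bounds(1)[OF assms(1)] next_pt(1) by simp
  ultimately show ?thesis by (simp add: retract_def)
qed

lemma retract_cases:
  assumes "z \<in> {b<..t}"
  obtains "retract k z = next_pt z" | x where "x \<in> {b<..t} - D" "embed k x = z" "retract k z = x"
proof (cases "\<exists>x\<in>{b<..t} - D. embed k x = z")
  case True
  then obtain x where x: "x \<in> {b<..t} - D" "embed k x = z" by blast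
  then have "retract k z = x" using retract_embed by auto
  with x show ?thesis using that by blast
qed (use that in \<open>simp add: retract_def\<close>)

lemma retract_bounds:
  assumes "z \<in> {b<..t}"
  shows "retract k z \<in> {b<..t}" "retract k z \<le> next_pt z"
proof -
  have "retract k z \<in> {b<..t} \<and> retract k z \<le> next_pt z"
  proof (rule retract_cases[OF assms, of k])
    assume "retract k z = next_pt z"
    then show ?thesis using next_pt_bounds[OF assms] by simp
  next
    fix x assume x: "x \<in> {b<..t} - D" "embed k x = z" "retract k z = x"
    then have "x \<le> z" using embed_bounds(2)[of x k] by auto
    also have "z \<le> next_pt z" using assms next_pt(2)[of z] by simp
    finally show ?thesis using x by simp
  qed
  then show "retract k z \<in> {b<..t}" "retract k z \<le> next_pt z" by blast+
qed

lemma continuous_on_next_pt: "continuous_on {b<..t} next_pt"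
proof (rule continuous_on_clopen_isCont)
  fix x assume x: "x \<in> {b<..t}"
  show "isCont next_pt x"
  proof (cases "x \<in> D")
    case True
    show ?thesis
    proof (rule isCont_monotoneI[where v = b])
      show "next_pt x' \<le> next_pt x" if "b < x'" "x' \<le> x" for x'
        using next_pt(3)[of x' x] order_trans[of x' x t] that True x by (simp add: next_pt_D)
      show "\<exists>w<x. \<forall>x'>w. x' \<le> x \<longrightarrow> u < next_pt x'" if "u < next_pt x" for u
        using that True next_pt(2) x unfolding next_pt_D[OF True]
        by (metis greaterThanAtMost_iff less_le_trans order_trans)
    qed (use x in simp)
  next
    case False
    then obtain e i where ei: "root e" "x \<in> gap e i" using gap_exists x by blast
    show ?thesis
      by (rule isCont_local[OF clopen_gap ei(2) next_pt_gap[OF ei(1) _ ei(2)]]) simp_all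
  qed
qed simp

lemma continuous_on_embed: "continuous_on {b<..t} (embed k)"
proof (rule continuous_on_clopen_isCont)
  fix x assume x: "x \<in> {b<..t}"
  show "isCont (embed k) x"
  proof (cases "x \<in> D")
    case True
    show ?thesis
    proof (rule isCont_monotoneI[where v = b])
      show "embed k x' \<le> embed k x" if "b < x'" "x' \<le> x" for x'
        using embed_bounds(3)[of x' k] next_pt(3)[of x' x] order_trans[of x' x t]
          order_trans[of "embed k x'" "next_pt x'" x] that True x by (simp add: embed_D)
      show "\<exists>w<x. \<forall>x'>w. x' \<le> x \<longrightarrow> u < embed k x'" if u: "u < embed k x" for u
      proof (intro exI conjI allI impI)
        show "max b u < x" using u x True by (simp add: embed_D)
        fix x' assume "max b u < x'" "x' \<le> x"
        then show "u < embed k x'"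
          using embed_bounds(2)[of x' k] order_trans[of x' x t] less_le_trans[of u x' "embed k x'"] x by simp
      qed
    qed (use x in simp)
  next
    case False
    then obtain e i where ei: "root e" "x \<in> gap e i" using gap_exists x by blast
    note c = copy[OF ei(1), where k = k and i = i]
    show ?thesis
    proof (rule isCont_local)
      show "isCont (transfer_pt b (it e (Suc (prod_encode (k, i))))) x"
        using isCont_transfer_pt[OF c(1,2) c(3)[symmetric]] c(4) ei(2) by blast
      show "embed k x' = transfer_pt b (it e (Suc (prod_encode (k, i)))) x'" if "x' \<in> gap e i" for x'
        using embed_gap[OF ei(1) that] .
    qed (use ei in simp_all)
  qed
qed simp

text \<open>
  Continuity of the retraction at a point of \<open>D\<close>. The critical case is that \<open>u\<close> and \<open>z'\<close> lie in gaps
  above the same \<open>e\<close>: the retraction moves \<open>z'\<close> down, but only the finitely many target gaps whose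
  code is at most that of the gap of \<open>u\<close> are moved to or below \<open>u\<close>.
\<close>

lemma retract_limit:
  assumes z: "z \<in> D" and u: "u < z"
  shows "\<exists>w<z. \<forall>z'>w. z' \<le> z \<longrightarrow> u < retract k z'"
proof -
  note zb = D_bounds[OF z]
  have above_root: "e \<le> retract k z'" "e < retract k z'" if "root e" "e < z'" "z' \<le> z" for e z'
  proof -
    have z': "z' \<in> {b<..t}" using that root_bounds[of e] zb by auto
    show less: "e < retract k z'"
    proof (rule retract_cases[OF z', of k])
      assume "retract k z' = next_pt z'"
      then show ?thesis using next_pt(2)[of z'] z' that(2) by auto
    next
      fix x assume x: "x \<in> {b<..t} - D" "embed k x = z'" "retract k z' = x"
      then obtain e' i where ei: "root e'" "x \<in> gap e' i" using gap_exists by blast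
      have "\<not> e' < e"
        using gap_below[OF ei(1) embed_in_gap(1)[OF ei, of k], of e] x that root_bounds[OF ei(1)]
        by (auto simp: root_def)
      then show ?thesis using gap_subset(3)[OF ei] x by simp
    qed
    then show "e \<le> retract k z'" by simp
  qed
  show ?thesis
  proof (cases "u \<le> b \<or> u \<in> D")
    case True
    let ?e = "if u \<le> b then b else u"
    have "root ?e" "?e < z" "u \<le> ?e" using True u zb bt by (auto simp: root_def)
    then show ?thesis using above_root by (meson le_less_trans)
  next
    case False
    then have ub: "u \<in> {b<..t}" using u zb by auto
    then obtain e0 i0 where ei0: "root e0" "u \<in> gap e0 i0" using gap_exists False by blast
    have nxt: "next_pt u \<in> D" "u \<le> next_pt u" "next_pt u \<le> z" using next_pt[of u] u z zb by auto
    show ?thesis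
    proof (cases "next_pt u < z")
      case True
      then have "root (next_pt u)" using nxt zb by (auto simp: root_def)
      then show ?thesis using above_root True nxt(2) by (meson le_less_trans)
    next
      case False
      then have nz: "next_pt u = z" using nxt by simp
      define w where "w = it e0 (Suc (Suc (prod_encode (k, i0))))"
      note e0 = root_bounds[OF ei0(1)]
      have e0z: "e0 < z" using gap_subset(3)[OF ei0] u by simp
      have wz: "w < z" unfolding w_def using it_below[OF z] e0 e0z by blast
      have "it e0 (Suc i0) < w"
        unfolding w_def using it_less[of e0] e0 le_prod_encode_2[of i0 k] by (simp del: it_simps add: le_imp_less_Suc)
      then have uw: "u < w" using ei0(2) by (auto simp: gap_def simp del: it_simps)
      have "u < retract k z'" if z': "w < z'" "z' \<le> z" for z'
      proof -
        have z'b: "z' \<in> {b<..t}" using z' uw ub zb by auto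
        show ?thesis
        proof (rule retract_cases[OF z'b, of k])
          assume "retract k z' = next_pt z'"
          then show ?thesis using next_pt(2)[of z'] z'b z' uw by auto
        next
          fix x assume x: "x \<in> {b<..t} - D" "embed k x = z'" "retract k z' = x"
          then obtain e i where ei: "root e" "x \<in> gap e i" using gap_exists by blast
          note g = embed_in_gap(1)[OF ei, of k, unfolded x(2)]
          have "e0 < z'" using uw z' gap_subset(3)[OF ei0] by simp
          have "z' \<notin> D" using gap_not_D[OF ei(1) g] .
          then have "z' < z" using z' z by (auto simp: less_le)
          have "\<not> e < e0"
            using gap_below[OF ei(1) g, of e0] \<open>e0 < z'\<close> ei0(1) root_bounds[OF ei(1)] by (auto simp: root_def)
          moreover have "\<not> e0 < e"
          proof
            assume "e0 < e"
            then have "e \<in> D" using ei(1) e0 by (auto simp: root_def)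
            then have "u \<le> e" using gap_below[OF ei0 _ \<open>e0 < e\<close>] by simp
            then have "z \<le> e" using next_pt(3)[of u e] \<open>e \<in> D\<close> ub nz by simp
            then show False using gap_subset(3)[OF ei(1) g] z' by simp
          qed
          ultimately have "e = e0" by simp
          then have "w < it e0 (Suc (Suc (prod_encode (k, i))))" using g z' unfolding gap_def by auto
          then have "prod_encode (k, i0) < prod_encode (k, i)"
            unfolding w_def using it_less[of e0] e0 by (simp del: it_simps)
          then have "i0 < i" using prod_encode_mono_snd[of i i0 k] by (meson not_le)
          then have "it e0 (Suc i0) \<le> it e0 i"
            using it_less[of e0 i "Suc i0"] e0 by (auto simp: not_less[symmetric] simp del: it_simps)
          then show ?thesis using ei(2) ei0(2) x(3) \<open>e = e0\<close> by (auto simp: gap_def simp del: it_simps)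
        qed
      qed
      then show ?thesis using wz by blast
    qed
  qed
qed

lemma retract_D: "z \<in> D \<Longrightarrow> retract k z = z"
  using retract_embed[of z k] embed_D[of z k] D_bounds[of z] by simp

lemma continuous_on_retract: "continuous_on {b<..t} (retract k)"
proof (rule continuous_on_clopen_isCont)
  fix z assume z: "z \<in> {b<..t}"
  show "isCont (retract k) z"
  proof (cases "z \<in> D")
    case True
    show ?thesis
    proof (rule isCont_monotoneI[where v = b])
      show "retract k x' \<le> retract k z" if "b < x'" "x' \<le> z" for x'
        using retract_bounds(2)[of x' k] next_pt(3)[of x' z] order_trans[of x' z t]
          order_trans[of "retract k x'" "next_pt x'" z] that True z by (simp add: retract_D)
      show "\<exists>w<z. \<forall>x'>w. x' \<le> z \<longrightarrow> u < retract k x'" if "u < retract k z" for u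
        using retract_limit[OF True] that by (simp add: retract_D[OF True])
    qed (use z in simp)
  next
    case False
    then obtain e j where ej: "root e" "z \<in> gap e j" using gap_exists z by blast
    show ?thesis
    proof (cases "\<exists>i. j = Suc (prod_encode (k, i))")
      case True
      then obtain i where j: "j = Suc (prod_encode (k, i))" by blast
      define y where "y = it e j"
      note c = copy[OF ej(1), where k = k and i = i, folded j, folded y_def]
      note c' = c(1,2) c(3)[symmetric]
      let ?up = "transfer_pt b y (it e (Suc i))"
      let ?lo = "if it e i = b then y else transfer_pt b y (it e i)"
      let ?I = "{?lo<..?up}"
      have eb: "b \<le> it e i" "it e i < it e (Suc i)"
        using it_bounds[of e i] it_less[of e i "Suc i"] root_bounds[OF ej(1)] by auto
      have up: "it e (Suc i) \<in> {b<..y}" using c(4) eb unfolding gap_def by auto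
      have low: "it e i \<in> {b<..y}" if "it e i \<noteq> b"
        using that eb up by (metis greaterThanAtMost_iff le_neq_trans less_imp_le order_trans)
      have inside: "z' \<in> ?I \<longleftrightarrow> (\<exists>x\<in>gap e i. z' = transfer_pt b y x)" for z'
      proof
        assume z': "z' \<in> ?I"
        have loy: "y \<le> ?lo" using transfer_pt(1)[OF c' low] by auto
        have z'y: "z' \<in> {y<..transfer_pt b y y}"
          using z' transfer_pt(1)[OF c' up] loy by (metis greaterThanAtMost_iff le_less_trans order_trans)
        let ?x = "transfer_pt y b z'"
        have x: "?x \<in> {b<..y}" "transfer_pt b y ?x = z'"
          using transfer_pt(1)[OF c(2,1,3) z'y] transfer_pt_inverse[OF c(2,1,3) z'y] by auto
        have "?x \<le> it e (Suc i)" using transfer_pt_less[OF c' up x(1)] x z' by (auto simp: not_less[symmetric])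
        moreover have "it e i < ?x"
        proof (cases "it e i = b")
          case False
          then have "it e i \<in> {b<..y}" by (rule low)
          then show ?thesis using transfer_pt_less[OF c' _ x(1)] x z' False by auto
        qed (use x in simp)
        ultimately have "?x \<in> gap e i" by (simp add: gap_def)
        then show "\<exists>x\<in>gap e i. z' = transfer_pt b y x" using x(2)[symmetric] by blast
      next
        assume "\<exists>x\<in>gap e i. z' = transfer_pt b y x"
        then obtain x where x: "x \<in> gap e i" "z' = transfer_pt b y x" by blast
        then have xb: "x \<in> {b<..y}" using c(4) by blast
        have "z' \<le> ?up" using transfer_pt_less[OF c' up xb] x by (auto simp: gap_def not_less[symmetric])
        moreover have "?lo < z'"
        proof (cases "it e i = b")
          case True
          then show ?thesis using transfer_pt(1)[OF c' xb] x by simp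
        next
          case False
          then have "it e i \<in> {b<..y}" by (rule low)
          then show ?thesis using transfer_pt_less[OF c' _ xb] x False by (auto simp: gap_def)
        qed
        ultimately show "z' \<in> ?I" by simp
      qed
      have emb: "embed k x = transfer_pt b y x" if "x \<in> gap e i" for x
        using embed_gap[OF ej(1) that] unfolding y_def j .
      have gapD: "x \<in> {b<..t} - D" if "x \<in> gap e i" for x
        using gap_subset[OF ej(1) that] gap_not_D[OF ej(1) that] by simp
      show ?thesis
      proof (cases "z \<in> ?I")
        case True
        have in_y: "z' \<in> {y<..transfer_pt b y y}" if z'I: "z' \<in> ?I" for z'
        proof -
          obtain x where x: "x \<in> gap e i" "z' = transfer_pt b y x" using inside[THEN iffD1, OF z'I] by blast
          then have "x \<in> {b<..y}" using c(4) by blast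
          then show ?thesis unfolding x(2) by (rule transfer_pt(1)[OF c'])
        qed
        show ?thesis
        proof (rule isCont_local)
          show "retract k z' = transfer_pt y b z'" if z'I: "z' \<in> ?I" for z'
          proof -
            obtain x where x: "x \<in> gap e i" "z' = transfer_pt b y x" using inside[THEN iffD1, OF z'I] by blast
            have "retract k z' = x"
              using retract_embed[of x k] gapD[OF x(1)] unfolding x(2) emb[OF x(1), symmetric] by blast
            moreover have "transfer_pt y b z' = x"
              unfolding x(2) by (rule transfer_pt_inverse[OF c']) (use c(4) x(1) in blast)
            ultimately show ?thesis by simp
          qed
          show "isCont (transfer_pt y b) z"
            using isCont_transfer_pt[OF c(2,1,3)] in_y[OF True] by blast
        qed (rule clopen_intervals True)+
      next
        case False
        show ?thesis
        proof (rule isCont_local)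
          show "retract k z' = next_pt z" if z': "z' \<in> gap e j - ?I" for z'
          proof (rule retract_cases)
            show "z' \<in> {b<..t}" using gap_subset(1,2)[OF ej(1), of z' j] z' by (simp add: less_imp_le)
            assume "retract k z' = next_pt z'"
            also have "next_pt z' = next_pt z"
              by (rule next_pt_gap[OF ej(1) _ ej(2)]) (use z' in blast)
            finally show ?thesis .
          next
            fix x assume x: "x \<in> {b<..t} - D" "embed k x = z'" "retract k z' = x"
            then obtain e' i' where ei': "root e'" "x \<in> gap e' i'" using gap_exists by blast
            have "z' \<in> gap e j" using z' by blast
            from gap_unique[OF ej(1) this ei'(1) embed_in_gap(1)[OF ei', of k, unfolded x(2)]]
            have "e = e'" "i = i'" by (auto simp: j prod_encode_eq)
            then have "x \<in> gap e i" using ei' by simp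
            moreover from emb[OF this] have "z' = transfer_pt b y x" using x(2) by simp
            ultimately have "z' \<in> ?I" unfolding inside by blast
            then show ?thesis using z' by blast
          qed
          show "clopen (gap e j - ?I)" by (intro clopen_basic clopen_gap clopen_intervals)
          show "z \<in> gap e j - ?I" using ej False by blast
        qed simp
      qed
    next
      case False
      show ?thesis
      proof (rule isCont_local)
        show "retract k z' = next_pt z" if z': "z' \<in> gap e j" for z'
        proof (rule retract_cases)
          show "z' \<in> {b<..t}" using gap_subset(1,2)[OF ej(1), of z' j] z' by (simp add: less_imp_le)
          assume "retract k z' = next_pt z'"
          also have "next_pt z' = next_pt z"
            by (rule next_pt_gap[OF ej(1) _ ej(2)]) (use z' in blast)
          finally show ?thesis .
        next
          fix x assume x: "x \<in> {b<..t} - D" "embed k x = z'" "retract k z' = x"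
          then obtain e' i' where ei': "root e'" "x \<in> gap e' i'" using gap_exists by blast
          from gap_unique[OF ej(1) z' ei'(1) embed_in_gap(1)[OF ei', of k, unfolded x(2)]]
          show ?thesis using False by blast
        qed
      qed (use ej in simp_all)
    qed
  qed
qed simp

text \<open>
  The projection onto the functions on \<open>(b, t]\<close> that vanish on \<open>D\<close>. It kills \<open>D\<close>, and this is why the
  maps above only have to agree with the identity up to \<open>D\<close>.
\<close>

definition gap_op :: "('a \<Rightarrow>\<^sub>C 'k::real_normed_field) \<Rightarrow>\<^sub>L ('a \<Rightarrow>\<^sub>C 'k)" where
  "gap_op = proj {b<..t} - comp_op {b<..t} next_pt"

lemma gap_op_apply [simp]:
  "apply_bcontfun (blinfun_apply gap_op g) x = (if x \<in> {b<..t} then g x - g (next_pt x) else 0)"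
  by (simp add: gap_op_def blinfun.diff_left continuous_on_id continuous_on_next_pt)

lemma gap_op_ops [simp]: "gap_op \<in> ops"
  by (simp add: gap_op_def continuous_on_id continuous_on_next_pt)

lemma gap_op_D: "c \<in> D \<Longrightarrow> apply_bcontfun (blinfun_apply gap_op g) c = 0"
  by (simp add: next_pt_D)

end

text \<open>
  Compose with \<open>retract k\<close> to copy functions into the images of \<open>embed k\<close>, and with \<open>embed j\<close> to read
  them off; for \<open>j \<noteq> k\<close> the composite map takes values in \<open>D\<close>.
\<close>

lemma (in algebra_seminorm) tame_gap_op:
  assumes "closure_points b t h"
  shows "tame (closure_points.gap_op b t h)"
proof -
  interpret closure_points b t h by fact
  let ?R = "gap_op :: ('a \<Rightarrow>\<^sub>C 'k) \<Rightarrow>\<^sub>L ('a \<Rightarrow>\<^sub>C 'k)"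
  note [simp] = continuous_on_retract continuous_on_embed
  show ?thesis
  proof (rule tame_if_replicable)
    show "(?R o\<^sub>L comp_op {b<..t} (embed j)) o\<^sub>L (comp_op {b<..t} (retract k) o\<^sub>L ?R) = (if j = k then ?R else 0)"
      for j k
    proof (rule op_eqI)
      fix g x
      define f where "f = blinfun_apply (comp_op {b<..t} (embed j)) (blinfun_apply (comp_op {b<..t} (retract k)) (blinfun_apply ?R g))"
      have f: "apply_bcontfun f x = (if j = k then apply_bcontfun (blinfun_apply ?R g) x else 0)"
        if "x \<in> {b<..t}" for x
        unfolding f_def
        using that embed_bounds(1)[OF that] retract_embed[OF that] gap_op_D[OF retract_embed_other[OF that, of j k], of g]
        by (simp del: gap_op_apply greaterThanAtMost_iff)
      have "apply_bcontfun (blinfun_apply ?R f) x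
        = (if j = k then apply_bcontfun (blinfun_apply ?R g) x else 0)"
      proof (cases "x \<in> {b<..t}")
        case True
        have "apply_bcontfun (blinfun_apply ?R g) (next_pt x) = 0"
          using next_pt(1)[of x] True by (intro gap_op_D) simp
        then show ?thesis
          unfolding gap_op_apply[of f] using True by (simp add: f next_pt_bounds del: gap_op_apply greaterThanAtMost_iff)
      next
        case False
        then show ?thesis by (simp del: greaterThanAtMost_iff)
      qed
      then show "apply_bcontfun (blinfun_apply ((?R o\<^sub>L comp_op {b<..t} (embed j)) o\<^sub>L (comp_op {b<..t} (retract k) o\<^sub>L ?R)) g) x
        = apply_bcontfun (blinfun_apply (if j = k then ?R else 0) g) x"
        unfolding f_def by simp
    qed
  qed simp_all
qed

section \<open>Bounded functionals and disjoint supports\<close>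

text \<open>
  Linear over the scalar field, unlike the elements of the type \<open>\<Rightarrow>\<^sub>L\<close>, which matters for the
  choice of phases in \<open>functional_disjoint_sum\<close>.
\<close>

definition functional ::
    "(('a::topological_space \<Rightarrow>\<^sub>C 'k::real_normed_field) \<Rightarrow> 'k) \<Rightarrow> real \<Rightarrow> bool" where
  "functional \<phi> C \<longleftrightarrow> (\<forall>f g. \<phi> (f + g) = \<phi> f + \<phi> g)
     \<and> (\<forall>c f. \<phi> (scale_bcontfun c f) = c * \<phi> f) \<and> (\<forall>f. norm (\<phi> f) \<le> C * norm f)"

lemma functionalD:
  assumes "functional \<phi> C"
  shows "\<phi> (f + g) = \<phi> f + \<phi> g" "\<phi> (scale_bcontfun c f) = c * \<phi> f" "norm (\<phi> f) \<le> C * norm f"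
    "\<phi> 0 = 0" "\<phi> (f - g) = \<phi> f - \<phi> g"
proof -
  show 1: "\<phi> (f + g) = \<phi> f + \<phi> g" "\<phi> (scale_bcontfun c f) = c * \<phi> f" "norm (\<phi> f) \<le> C * norm f" for f g c
    using assms by (auto simp: functional_def)
  show "\<phi> 0 = 0" using 1(2)[of 0 0] by simp
  show "\<phi> (f - g) = \<phi> f - \<phi> g" using 1(1)[of "f - g" g] by simp
qed

lemma functional_eval:
  assumes "T \<in> ops"
  shows "functional (\<lambda>f. apply_bcontfun (blinfun_apply T f) x) (norm T)"
  using norm_bounded order_trans[OF _ norm_blinfun]
  by (fastforce simp: functional_def blinfun.add_right opsD[OF assms])

lemma phase:
  fixes z :: "'k::real_normed_field"
  obtains w where "norm w = 1" "w * z = of_real (norm z)"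
proof (cases "z = 0")
  case False
  then show ?thesis by (intro that[of "of_real (norm z) / z"]) (auto simp: norm_divide)
qed (use that[of 1] in simp)

text \<open>
  Functions with disjoint supports can be rotated so that their values add up without
  cancellation, while the norm of the sum stays at most one. This is additivity of the total
  variation of a measure.
\<close>

lemma functional_disjoint_sum:
  fixes f f' :: "'a::topological_space \<Rightarrow>\<^sub>C 'k::real_normed_field"
  assumes "functional \<phi> C" "norm f \<le> 1" "norm f' \<le> 1" "\<And>x. apply_bcontfun f x = 0 \<or> apply_bcontfun f' x = 0"
  obtains g :: "'a \<Rightarrow>\<^sub>C 'k" where "norm g \<le> 1" "\<And>x. apply_bcontfun f x = 0 \<Longrightarrow> apply_bcontfun f' x = 0 \<Longrightarrow> apply_bcontfun g x = 0"
    "norm (\<phi> g) = norm (\<phi> f) + norm (\<phi> f')"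
proof -
  obtain w where w: "norm w = 1" "w * \<phi> f = of_real (norm (\<phi> f))" by (rule phase)
  obtain w' where w': "norm w' = 1" "w' * \<phi> f' = of_real (norm (\<phi> f'))" by (rule phase)
  let ?g = "scale_bcontfun w f + scale_bcontfun w' f'"
  have "norm (apply_bcontfun ?g x) \<le> 1" for x
    using assms(4)[of x] w(1) w'(1) order_trans[OF norm_bounded assms(2)] order_trans[OF norm_bounded assms(3)]
    by (auto simp: norm_mult)
  then have "norm ?g \<le> 1" by (rule norm_bound)
  moreover have "\<phi> ?g = of_real (norm (\<phi> f) + norm (\<phi> f'))"
    by (simp add: functionalD[OF assms(1)] w w')
  then have "norm (\<phi> ?g) = norm (\<phi> f) + norm (\<phi> f')"
    by (metis abs_of_nonneg add_nonneg_nonneg norm_ge_zero norm_of_real)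
  ultimately show thesis by (intro that[of ?g]) auto
qed

text \<open>
  In terms of the measure that represents \<open>\<phi>\<close>: its total variation on \<open>G\<close> exceeds \<open>\<eta>\<close>.
\<close>

definition sees ::
    "(('a::topological_space \<Rightarrow>\<^sub>C 'k::real_normed_field) \<Rightarrow> 'k) \<Rightarrow> 'a set \<Rightarrow> real \<Rightarrow> bool" where
  "sees \<phi> G \<eta> \<longleftrightarrow> (\<exists>f :: 'a \<Rightarrow>\<^sub>C 'k. norm f \<le> 1 \<and> (\<forall>x. x \<notin> G \<longrightarrow> apply_bcontfun f x = 0) \<and> \<eta> < norm (\<phi> f))"

text \<open>
  If the claim fails, then it fails repeatedly, and one finds as many disjoint intervals
  below \<open>t\<close> as desired that are all seen at level \<open>\<eta>\<close> by infinitely many \<open>\<mu> n\<close>. By additivity of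
  variations this contradicts the common bound \<open>C\<close>.
\<close>

lemma unseen_intervals:
  fixes t :: "'a::{wellorder, linorder_topology}"
    and \<mu> :: "nat \<Rightarrow> ('a \<Rightarrow>\<^sub>C 'k::real_normed_field) \<Rightarrow> 'k"
  assumes \<mu>: "\<And>n. functional (\<mu> n) C" and M: "infinite M" and \<eta>: "0 < \<eta>" and y: "y < t"
  obtains b M' where "b < t" "M' \<subseteq> M" "infinite M'"
    "\<forall>c<t. finite {n \<in> M'. sees (\<mu> n) {b<..c} \<eta>}"
proof -
  have "\<exists>b M'. b < t \<and> M' \<subseteq> M \<and> infinite M' \<and> (\<forall>c<t. finite {n \<in> M'. sees (\<mu> n) {b<..c} \<eta>})"
  proof (rule ccontr)
    assume "\<not> ?thesis"
    then have neg: "\<And>b M'. b < t \<Longrightarrow> M' \<subseteq> M \<Longrightarrow> infinite M' \<Longrightarrow>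
        \<exists>c<t. infinite {n \<in> M'. sees (\<mu> n) {b<..c} \<eta>}" by blast
    have grow: "\<exists>b M'. b < t \<and> M' \<subseteq> M \<and> infinite M' \<and> (\<forall>n\<in>M'. \<exists>f :: 'a \<Rightarrow>\<^sub>C 'k. norm f \<le> 1 \<and>
        (\<forall>x. b < x \<longrightarrow> apply_bcontfun f x = 0) \<and> real N * \<eta> \<le> norm (\<mu> n f))" for N
    proof (induction N)
      case 0
      show ?case by (rule exI[of _ y], rule exI[of _ M]) (use y M in \<open>auto intro!: exI[of _ 0]\<close>)
    next
      case (Suc N)
      then obtain b M' where b: "b < t" "M' \<subseteq> M" "infinite M'"
        "\<forall>n\<in>M'. \<exists>f :: 'a \<Rightarrow>\<^sub>C 'k. norm f \<le> 1 \<and> (\<forall>x. b < x \<longrightarrow> apply_bcontfun f x = 0) \<and> real N * \<eta> \<le> norm (\<mu> n f)" by blast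
      from neg[OF b(1-3)] obtain c where c: "c < t" "infinite {n \<in> M'. sees (\<mu> n) {b<..c} \<eta>}" by blast
      show ?case
      proof (rule exI[of _ "max b c"], rule exI[of _ "{n \<in> M'. sees (\<mu> n) {b<..c} \<eta>}"], intro conjI ballI)
        fix n assume "n \<in> {n \<in> M'. sees (\<mu> n) {b<..c} \<eta>}"
        then have n: "n \<in> M'" "sees (\<mu> n) {b<..c} \<eta>" by auto
        obtain f :: "'a \<Rightarrow>\<^sub>C 'k" where f: "norm f \<le> 1" "\<forall>x. b < x \<longrightarrow> apply_bcontfun f x = 0" "real N * \<eta> \<le> norm (\<mu> n f)"
          using b(4) n(1) by blast
        obtain f' :: "'a \<Rightarrow>\<^sub>C 'k" where f': "norm f' \<le> 1" "\<forall>x. x \<notin> {b<..c} \<longrightarrow> apply_bcontfun f' x = 0" "\<eta> < norm (\<mu> n f')"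
          using n(2) unfolding sees_def by blast
        have "apply_bcontfun f x = 0 \<or> apply_bcontfun f' x = 0" for x using f(2) f'(2) by (meson greaterThanAtMost_iff)
        from functional_disjoint_sum[OF \<mu>[of n] f(1) f'(1) this] obtain g :: "'a \<Rightarrow>\<^sub>C 'k" where g: "norm g \<le> 1"
          "\<And>x. apply_bcontfun f x = 0 \<Longrightarrow> apply_bcontfun f' x = 0 \<Longrightarrow> apply_bcontfun g x = 0" "norm (\<mu> n g) = norm (\<mu> n f) + norm (\<mu> n f')" by metis
        have "\<forall>x. max b c < x \<longrightarrow> apply_bcontfun g x = 0" using g(2) f(2) f'(2) by (auto simp: not_le)
        moreover have "real (Suc N) * \<eta> \<le> norm (\<mu> n g)" using g(3) f(3) f'(3) by (simp add: algebra_simps)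
        ultimately show "\<exists>f :: 'a \<Rightarrow>\<^sub>C 'k. norm f \<le> 1 \<and> (\<forall>x. max b c < x \<longrightarrow> apply_bcontfun f x = 0) \<and> real (Suc N) * \<eta> \<le> norm (\<mu> n f)"
          using g(1) by blast
      qed (use b c in auto)
    qed
    obtain N where N: "max 0 C < real N * \<eta>" using reals_Archimedean3[OF \<eta>] by blast
    from grow[of N] obtain b M' where M': "infinite M'" "\<forall>n\<in>M'. \<exists>f :: 'a \<Rightarrow>\<^sub>C 'k. norm f \<le> 1 \<and>
        (\<forall>x. b < x \<longrightarrow> apply_bcontfun f x = 0) \<and> real N * \<eta> \<le> norm (\<mu> n f)"
      by (elim exE conjE) (rule that)
    from M'(1) obtain n where "n \<in> M'" using infinite_imp_nonempty by blast
    from M'(2)[rule_format, OF this] obtain f :: "'a \<Rightarrow>\<^sub>C 'k" where f: "norm f \<le> 1" "real N * \<eta> \<le> norm (\<mu> n f)"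
      by (elim exE conjE) (rule that)
    have "C * norm f \<le> max 0 C" using f(1) mult_left_le[of "norm f" C] mult_nonpos_nonneg[of C "norm f"]
      by (cases "0 \<le> C") auto
    then show False using functionalD(3)[OF \<mu>[of n], of f] f N by linarith
  qed
  then show thesis using that by blast
qed

text \<open>
  A continuous function on \<open>(b, y]\<close> is a uniform limit of linear combinations of indicators of
  \<open>(b, x]\<close>, by induction on \<open>y\<close>; so the values of \<open>\<phi>\<close> at these indicators determine \<open>\<phi>\<close>.
\<close>

lemma functional_on_steps:
  fixes b c :: "'a::{wellorder, linorder_topology}" and f :: "'a \<Rightarrow>\<^sub>C 'k::real_normed_field"
  assumes \<phi>: "functional \<phi> C" and bc: "b < c" and z: "\<And>x. b \<le> x \<Longrightarrow> x < c \<Longrightarrow> \<phi> (ind {b<..x}) = 0"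
  shows "\<phi> (blinfun_apply (proj {b<..c}) f) = f c * \<phi> (ind {b<..c})"
proof -
  have approx: "\<exists>g :: 'a \<Rightarrow>\<^sub>C 'k. \<phi> g = 0 \<and> (\<forall>x. x \<notin> {b<..y} \<longrightarrow> apply_bcontfun g x = 0) \<and> (\<forall>x\<in>{b<..y}. norm (apply_bcontfun f x - apply_bcontfun g x) \<le> e)"
    if "0 < e" "b \<le> y" "y < c" for e y
    using that(2,3)
  proof (induction y rule: less_induct)
    case (less y)
    show ?case
    proof (cases "y = b")
      case True
      then show ?thesis by (intro exI[of _ 0]) (auto simp: functionalD[OF \<phi>])
    next
      case False
      then have yb: "b < y" using less.prems by simp
      have "isCont (apply_bcontfun f) y"
        using continuous_on_eq_continuous_at[of UNIV] by auto
      then obtain w where w: "b \<le> w" "w < y" "\<And>x. w < x \<Longrightarrow> x \<le> y \<Longrightarrow> norm (f x - f y) < e"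
        using continuous_near[OF _ yb \<open>0 < e\<close>] by metis
      obtain g :: "'a \<Rightarrow>\<^sub>C 'k" where g: "\<phi> g = 0" "\<forall>x. x \<notin> {b<..w} \<longrightarrow> apply_bcontfun g x = 0" "\<forall>x\<in>{b<..w}. norm (apply_bcontfun f x - apply_bcontfun g x) \<le> e"
        using less.IH[OF w(2,1)] w(2) less.prems by (auto dest: less_trans)
      let ?g = "g + scale_bcontfun (f y) (ind {w<..y})"
      have "ind {w<..y} = (ind {b<..y} - ind {b<..w} :: 'a \<Rightarrow>\<^sub>C 'k)"
        using w by (intro bcontfun_eqI) auto
      then have "\<phi> (ind {w<..y}) = 0"
        using z[of y] z[of w] less.prems w by (auto simp: functionalD[OF \<phi>] dest: less_trans)
      then have "\<phi> ?g = 0" using g(1) by (simp add: functionalD[OF \<phi>])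
      moreover have "norm (apply_bcontfun f x - apply_bcontfun ?g x) \<le> e" if "x \<in> {b<..y}" for x
      proof (cases "x \<le> w")
        case True
        then show ?thesis using g(3) that by auto
      next
        case False
        then show ?thesis using g(2) w(3)[of x] that by (simp add: less_imp_le)
      qed
      moreover have "apply_bcontfun ?g x = 0" if "x \<notin> {b<..y}" for x
      proof -
        have "x \<notin> {b<..w}" "x \<notin> {w<..y}" using that w(1,2) by auto
        then show ?thesis using g(2) by (simp del: greaterThanAtMost_iff)
      qed
      ultimately show ?thesis by blast
    qed
  qed
  let ?d = "blinfun_apply (proj {b<..c}) f - scale_bcontfun (f c) (ind {b<..c})"
  have "norm (\<phi> ?d) \<le> 0"
  proof (rule field_le_epsilon)
    fix e' :: real assume "0 < e'"
    define e where "e = e' / (\<bar>C\<bar> + 1)"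
    have e: "0 < e" "\<bar>C\<bar> * e \<le> e'" using \<open>0 < e'\<close>
      by (auto simp: e_def field_simps add_nonneg_pos)
    have "isCont (apply_bcontfun f) c" using continuous_on_eq_continuous_at[of UNIV] by auto
    then obtain w where w: "b \<le> w" "w < c" "\<And>x. w < x \<Longrightarrow> x \<le> c \<Longrightarrow> norm (f x - f c) < e"
      using continuous_near[OF _ bc e(1)] by metis
    obtain g :: "'a \<Rightarrow>\<^sub>C 'k" where g: "\<phi> g = 0" "\<forall>x. x \<notin> {b<..w} \<longrightarrow> apply_bcontfun g x = 0" "\<forall>x\<in>{b<..w}. norm (apply_bcontfun f x - apply_bcontfun g x) \<le> e"
      using approx[OF e(1) w(1,2)] by blast
    let ?g = "g - scale_bcontfun (f c) (ind {b<..w})"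
    have "\<phi> ?g = 0" using g(1) z[OF w(1,2)] by (simp add: functionalD[OF \<phi>])
    then have "\<phi> ?d = \<phi> (?d - ?g)" by (simp only: functionalD(5)[OF \<phi>] diff_0_right)
    moreover have "norm (?d - ?g) \<le> e"
    proof (rule norm_bound)
      fix x
      consider "x \<notin> {b<..c}" | "x \<in> {b<..w}" | "x \<in> {w<..c}" by fastforce
      then show "norm (apply_bcontfun (?d - ?g) x) \<le> e"
      proof cases
        case 1
        then have "x \<notin> {b<..w}" using w(2) by auto
        then show ?thesis using 1 g(2) e by (simp add: continuous_on_id del: greaterThanAtMost_iff)
      next
        case 2
        then have "x \<in> {b<..c}" using w(2) by auto
        then show ?thesis using 2 g(3) by (simp add: continuous_on_id del: greaterThanAtMost_iff)
      next
        case 3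
        then have "x \<in> {b<..c}" "x \<notin> {b<..w}" using w(1) by auto
        then show ?thesis using 3 g(2) w(3)[of x] by (simp add: continuous_on_id less_imp_le)
      qed
    qed
    ultimately have "norm (\<phi> ?d) \<le> \<bar>C\<bar> * e"
      using functionalD(3)[OF \<phi>, of "?d - ?g"] by (smt (verit) mult_mono norm_ge_zero)
    then show "norm (\<phi> ?d) \<le> 0 + e'" using e by simp
  qed
  then show ?thesis by (simp add: functionalD[OF \<phi>])
qed

section \<open>Cofinality\<close>

text \<open>
  The right end of the copy of \<open>(b, u]\<close> that starts at \<open>u\<close>.
\<close>

definition copy_pt :: "'a::wellorder \<Rightarrow> 'a \<Rightarrow> 'a" where
  "copy_pt b u = (if b < u then transfer_pt b u u else u)"

lemma copy_pt_bounds: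
  fixes b t :: "'a::{wellorder, linorder_topology}"
  assumes ind: "indecomposable b t" and u: "b \<le> u" "u < t"
  shows "u \<le> copy_pt b u" "copy_pt b u < t" "b < u \<Longrightarrow> u < copy_pt b u \<and> col u (copy_pt b u) = col b u"
proof -
  have *: "u < copy_pt b u \<and> copy_pt b u < t \<and> col u (copy_pt b u) = col b u" if "b < u"
    using indecomposable_copy[OF ind u that col_less[OF that u(2)]] that by (simp add: copy_pt_def)
  show "u \<le> copy_pt b u" "copy_pt b u < t"
    using * u by (cases "b < u"; simp add: copy_pt_def less_imp_le)+
  show "b < u \<Longrightarrow> u < copy_pt b u \<and> col u (copy_pt b u) = col b u" using * by blast
qed

lemma copy_pt_mono:
  fixes b t :: "'a::{wellorder, linorder_topology}"
  assumes ind: "indecomposable b t" and uv: "b \<le> u" "u \<le> v" "v < t"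
  shows "copy_pt b u \<le> copy_pt b v"
proof (cases "copy_pt b u \<le> v")
  case True
  then show ?thesis using copy_pt_bounds(1)[OF ind order_trans[OF uv(1,2)] uv(3)] by (rule order_trans)
next
  case False
  have bu: "b < u" using False uv by (cases "b < u") (auto simp: copy_pt_def)
  have bv: "b < v" using bu uv by simp
  note u = copy_pt_bounds(3)[OF ind uv(1) le_less_trans[OF uv(2,3)] bu]
  note v = copy_pt_bounds(3)[OF ind less_imp_le[OF bv] uv(3) bv]
  show ?thesis
  proof (cases "u = v")
    case False
    have "col v (copy_pt b u) \<le> col u (copy_pt b u)" using uv(2) by (rule col_antimono)
    also have "\<dots> = col b u" using u by simp
    also have "\<dots> < col b v" using False uv(2) bu by (intro col_less) auto
    also have "\<dots> = col v (copy_pt b v)" using v by simp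
    finally have "copy_pt b u < copy_pt b v"
      using col_less_iff[of v "copy_pt b u" "copy_pt b v"] v \<open>\<not> copy_pt b u \<le> v\<close> by (simp add: not_le)
    then show ?thesis by simp
  qed simp
qed

lemma closure_points_max:
  fixes b t :: "'a::{wellorder, linorder_topology}"
  assumes ind: "indecomposable b t"
    and h: "\<And>x. b \<le> x \<Longrightarrow> x < t \<Longrightarrow> x < h x \<and> h x < t"
      "\<And>x y. b \<le> x \<Longrightarrow> x \<le> y \<Longrightarrow> y < t \<Longrightarrow> h x \<le> h y"
  shows "closure_points b t (\<lambda>x. max (h x) (copy_pt b x))"
proof
  show "indecomposable b t" by fact
  show "x < max (h x) (copy_pt b x)" "max (h x) (copy_pt b x) < t" if "b \<le> x" "x < t" for x
    using h(1)[OF that] copy_pt_bounds(2)[OF ind that] by (auto simp: less_max_iff_disj)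
  show "max (h x) (copy_pt b x) \<le> max (h y) (copy_pt b y)" if "b \<le> x" "x \<le> y" "y < t" for x y
    using h(2)[OF that] copy_pt_mono[OF ind that] by (rule max.mono)
  show "transfer_pt b x x \<le> max (h x) (copy_pt b x)" if "b < x" "x < t" for x
    using that by (simp add: copy_pt_def)
qed

text \<open>
  For a suitable \<open>h\<close> that runs through a cofinal sequence, \<open>t\<close> is the only closure point. Then
  \<open>gap_op\<close> is the whole shift operator.
\<close>

lemma (in algebra_seminorm) tame_shift_countable_cofinality:
  fixes s :: "nat \<Rightarrow> 'a"
  assumes ind: "indecomposable b t"
    and s: "\<And>n. s n < t" "\<And>u. u < t \<Longrightarrow> \<exists>n. u < s n"
  shows "tame (shift_op b t)"
proof -
  define m where "m u = (LEAST n. u < s n)" for u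
  define S where "S n = Max (s ` {..n})" for n
  have m: "u < s (m u)" if "u < t" for u unfolding m_def using s(2)[OF that] by (rule LeastI_ex)
  have m_mono: "m u \<le> m v" if "u \<le> v" "v < t" for u v
    unfolding m_def[of u] by (rule Least_le) (use m[OF that(2)] that in auto)
  have S: "s k \<le> S n" if "k \<le> n" for k n unfolding S_def using that by auto
  have S_mono: "S k \<le> S n" if "k \<le> n" for k n unfolding S_def using that by (intro Max_mono) auto
  have S_less: "S n < t" for n
  proof -
    have "S n \<in> s ` {..n}" unfolding S_def by (rule Max_in) auto
    then show ?thesis using s(1) by auto
  qed
  define h where "h x = max (S (m x)) (copy_pt b x)" for x
  have less: "x < S (m x)" if "x < t" for x using m[OF that] S[of "m x" "m x"] by simp
  interpret closure_points b t h
    unfolding h_def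
    by (rule closure_points_max[OF ind]) (use less S_less S_mono m_mono in auto)
  have D: "D = {t}"
  proof -
    have "c = t" if c: "c \<in> D" for c
    proof (rule ccontr)
      assume "c \<noteq> t"
      then have ct: "c < t" "b < c" using D_bounds[OF c] by auto
      \<comment> \<open>No term of the sequence before the first one above \<open>c\<close> lies strictly between \<open>u\<close> and \<open>c\<close>.\<close>
      define u where "u = Max (insert b {s k |k. k < m c \<and> s k < c})"
      have fin: "finite (insert b {s k |k. k < m c \<and> s k < c})" by simp
      have u: "u < c" "b \<le> u" "\<And>k. k < m c \<Longrightarrow> s k < c \<Longrightarrow> s k \<le> u"
        unfolding u_def using fin ct by (auto simp: Max_less_iff intro!: Max_ge)
      have "S (m u) < c" using D_closed_under[OF c u(2,1)] by (simp add: h_def)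
      then have k: "s (m u) < c" using S[of "m u" "m u"] by simp
      have "m u \<le> m c" using m_mono[of u c] u ct by simp
      moreover have "m u \<noteq> m c" using k m[OF ct(1)] by auto
      ultimately have "s (m u) \<le> u" using u(3)[of "m u"] k by simp
      moreover have "u < s (m u)" by (rule m) (use u ct in simp)
      ultimately show False by simp
    qed
    then show ?thesis using top_in_D by blast
  qed
  have "gap_op = (shift_op b t :: ('a \<Rightarrow>\<^sub>C 'k) \<Rightarrow>\<^sub>L ('a \<Rightarrow>\<^sub>C 'k))"
  proof (rule op_eqI)
    fix g :: "'a \<Rightarrow>\<^sub>C 'k" and x
    have "next_pt x = t" if "x \<in> {b<..t}" using next_pt(1)[of x] that by (simp add: D)
    then show "apply_bcontfun (blinfun_apply gap_op g) x = apply_bcontfun (blinfun_apply (shift_op b t) g) x" by simp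
  qed
  then show ?thesis using tame_gap_op[OF closure_points_axioms] by simp
qed

text \<open>
  The closed cofinal set \<open>D\<close> is made thin enough to be regular: a function on an initial part of \<open>D\<close>
  with values below \<open>t\<close> is bounded below \<open>t\<close>, see \<open>D_regular\<close>. For this, \<open>h\<close> jumps along a cofinal
  function whose domain \<open>cf\<close> is the cofinality of \<open>t\<close>, so that distinct points of \<open>D\<close> have distinct
  indices below \<open>cf\<close>.
\<close>

locale uncountable_cofinality =
  fixes b t :: "'a::{wellorder, linorder_topology}"
  assumes indec: "indecomposable b t"
    and limit: "u < t \<Longrightarrow> \<exists>v. u < v \<and> v < t"
    and sequence_bounded: "(\<And>n::nat. s n < t) \<Longrightarrow> \<exists>u<t. \<forall>n. s n \<le> u"
begin

lemma bt: "b < t"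
  using indec by (simp add: indecomposable_def)

definition cofinal :: "('a \<Rightarrow> 'a) \<Rightarrow> 'a \<Rightarrow> bool" where
  "cofinal f x \<longleftrightarrow> (\<forall>y<x. f y < t) \<and> (\<forall>u<t. \<exists>y<x. u \<le> f y)"

definition cf :: 'a where "cf = (LEAST x. \<exists>f. cofinal f x)"
definition path :: "'a \<Rightarrow> 'a" where "path = (SOME f. cofinal f cf)"

lemma cofinal_path: "cofinal path cf"
proof -
  have "\<exists>f. cofinal f t" unfolding cofinal_def by (rule exI[of _ "\<lambda>x. x"]) auto
  then have "\<exists>f. cofinal f cf" unfolding cf_def by (rule LeastI)
  then show ?thesis unfolding path_def by (rule someI_ex)
qed

lemma bounded_below_cf:
  assumes "x < cf" "\<And>y. y \<le> x \<Longrightarrow> g y < t"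
  shows "\<exists>u<t. \<forall>y\<le>x. g y \<le> u"
proof -
  have "\<not> cofinal g x" using not_less_Least[OF assms(1)[unfolded cf_def]] by blast
  then obtain u where u: "u < t" "\<forall>y<x. g y < u"
    using assms(2) by (auto simp: cofinal_def not_le)
  have "g y \<le> max u (g x)" if "y \<le> x" for y
    using u(2) that by (cases "y = x") (auto simp: le_max_iff_disj less_imp_le)
  then show ?thesis using u(1) assms(2)[of x] by (intro exI[of _ "max u (g x)"]) simp
qed

definition sup_path :: "'a \<Rightarrow> 'a" where
  "sup_path x = (LEAST u. \<forall>y\<le>x. path y \<le> u)"

lemma sup_path:
  assumes "x < cf"
  shows "sup_path x < t" "\<And>y. y \<le> x \<Longrightarrow> path y \<le> sup_path x"
    "\<And>y. y \<le> x \<Longrightarrow> sup_path y \<le> sup_path x"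
proof -
  obtain u where u: "u < t" "\<forall>y\<le>x. path y \<le> u"
    using bounded_below_cf[OF assms, of path] cofinal_path assms by (auto simp: cofinal_def)
  show "sup_path x < t" using u Least_le[of "\<lambda>u. \<forall>y\<le>x. path y \<le> u" u]
    unfolding sup_path_def by (simp add: le_less_trans)
  have all: "\<forall>y\<le>x. path y \<le> sup_path x" unfolding sup_path_def using u(2) by (rule LeastI)
  then show "\<And>y. y \<le> x \<Longrightarrow> path y \<le> sup_path x" by blast
  show "sup_path y \<le> sup_path x" if "y \<le> x" for y
    unfolding sup_path_def[of y] by (rule Least_le) (use all that in auto)
qed

definition idx :: "'a \<Rightarrow> 'a" where
  "idx u = (LEAST x. x < cf \<and> u < sup_path x)"

lemma idx:
  assumes "u < t"
  shows "idx u < cf" "u < sup_path (idx u)" "\<And>x. x < cf \<Longrightarrow> u < sup_path x \<Longrightarrow> idx u \<le> x"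
proof -
  obtain v where v: "u < v" "v < t" using limit assms by blast
  then obtain y where "y < cf" "v \<le> path y" using cofinal_path by (auto simp: cofinal_def)
  then have "\<exists>x. x < cf \<and> u < sup_path x" using sup_path(2)[of y y] v(1)
    by (meson less_le_trans order_refl)
  then have "idx u < cf \<and> u < sup_path (idx u)" unfolding idx_def by (rule LeastI_ex)
  then show "idx u < cf" "u < sup_path (idx u)" by auto
  show "\<And>x. x < cf \<Longrightarrow> u < sup_path x \<Longrightarrow> idx u \<le> x" unfolding idx_def by (rule Least_le) simp
qed

lemma idx_mono:
  assumes "u \<le> v" "v < t"
  shows "idx u \<le> idx v"
  using idx(1,2)[OF assms(2)] assms by (intro idx(3)) auto

definition hop :: "'a \<Rightarrow> 'a" where
  "hop x = max (sup_path (idx x)) (copy_pt b x)"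

sublocale closure_points b t hop
  unfolding hop_def
proof (rule closure_points_max[OF indec])
  show "x < sup_path (idx x) \<and> sup_path (idx x) < t" if "b \<le> x" "x < t" for x
    using idx(1,2)[OF that(2)] sup_path(1) by blast
  show "sup_path (idx x) \<le> sup_path (idx y)" if "b \<le> x" "x \<le> y" "y < t" for x y
    using idx(1)[OF that(3)] idx_mono[OF that(2,3)] by (rule sup_path(3))
qed

lemma idx_strict:
  assumes "c \<in> D" "c' \<in> D" "c < c'" "c' < t"
  shows "idx c < idx c'"
proof (rule ccontr)
  assume "\<not> ?thesis"
  then have "sup_path (idx c') \<le> sup_path (idx c)"
    using assms idx(1)[of c] by (intro sup_path(3)) auto
  moreover have "sup_path (idx c) < c'"
    using D_closed_under[OF assms(2), of c] D_bounds[OF assms(1)] assms(3) by (simp add: hop_def less_imp_le)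
  moreover have "c' < sup_path (idx c')" using idx(2) assms(4) by blast
  ultimately show False by simp
qed

lemma D_regular:
  assumes g: "\<And>d. d \<in> D \<Longrightarrow> d < t \<Longrightarrow> g d < t" and v: "v < t"
  shows "\<exists>u<t. \<forall>d\<in>D. d \<le> v \<longrightarrow> g d \<le> u"
proof -
  \<comment> \<open>Transport \<open>g\<close> along the index map, which is injective on the points of \<open>D\<close> below \<open>t\<close>.\<close>
  define G where "G x = (if \<exists>d\<in>D. d < t \<and> idx d = x then g (SOME d. d \<in> D \<and> d < t \<and> idx d = x) else b)" for x
  have G: "G (idx d) = g d" if "d \<in> D" "d < t" for d
  proof -
    have "(SOME d'. d' \<in> D \<and> d' < t \<and> idx d' = idx d) = d"
      using that idx_strict by (intro some_equality) (auto, metis less_irrefl linorder_cases)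
    then show ?thesis using that by (auto simp: G_def)
  qed
  have "G x < t" for x
  proof (cases "\<exists>d\<in>D. d < t \<and> idx d = x")
    case True
    then obtain d where "d \<in> D" "d < t" "idx d = x" by blast
    then show ?thesis using G[of d] g[of d] by auto
  next
    case False
    then show ?thesis using bt unfolding G_def by auto
  qed
  then obtain u where u: "u < t" "\<forall>y\<le>idx v. G y \<le> u"
    using bounded_below_cf[OF idx(1)[OF v], of G] by blast
  have "g d \<le> u" if "d \<in> D" "d \<le> v" for d
    using u(2) idx_mono[OF that(2) v] G[OF that(1)] that v by (metis le_less_trans)
  then show ?thesis using u(1) by blast
qed

text \<open>
  The projection onto the functions that are constant on the gaps of \<open>D\<close> and vanish at \<open>t\<close>.
\<close>

definition coarse_op :: "('a \<Rightarrow>\<^sub>C 'k::real_normed_field) \<Rightarrow>\<^sub>L ('a \<Rightarrow>\<^sub>C 'k)" where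
  "coarse_op = comp_op {b<..t} next_pt - comp_op {b<..t} (\<lambda>_. t)"

lemma coarse_op_apply [simp]:
  "apply_bcontfun (blinfun_apply coarse_op g) x = (if x \<in> {b<..t} then g (next_pt x) - g t else 0)"
  by (simp add: coarse_op_def blinfun.diff_left continuous_on_next_pt)

lemma coarse_op_ops [simp]: "coarse_op \<in> ops"
  by (simp add: coarse_op_def continuous_on_next_pt)

lemma norm_coarse_op: "norm (coarse_op :: ('a \<Rightarrow>\<^sub>C 'k::real_normed_field) \<Rightarrow>\<^sub>L ('a \<Rightarrow>\<^sub>C 'k)) \<le> 2"
proof -
  have "norm (coarse_op :: ('a \<Rightarrow>\<^sub>C 'k) \<Rightarrow>\<^sub>L ('a \<Rightarrow>\<^sub>C 'k)) \<le> norm (comp_op {b<..t} next_pt :: ('a \<Rightarrow>\<^sub>C 'k) \<Rightarrow>\<^sub>L _)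
      + norm (comp_op {b<..t} (\<lambda>_. t) :: ('a \<Rightarrow>\<^sub>C 'k) \<Rightarrow>\<^sub>L _)"
    unfolding coarse_op_def by (rule norm_triangle_ineq4)
  also have "\<dots> \<le> 1 + 1" by (intro add_mono norm_comp_op) (auto simp: continuous_on_next_pt)
  finally show ?thesis by simp
qed

lemma coarse_op_idem:
  "coarse_op o\<^sub>L coarse_op = (coarse_op :: ('a \<Rightarrow>\<^sub>C 'k::real_normed_field) \<Rightarrow>\<^sub>L ('a \<Rightarrow>\<^sub>C 'k))"
proof (rule op_eqI)
  fix g :: "'a \<Rightarrow>\<^sub>C 'k" and x
  show "apply_bcontfun (blinfun_apply (coarse_op o\<^sub>L coarse_op) g) x = apply_bcontfun (blinfun_apply coarse_op g) x"
  proof (cases "x \<in> {b<..t}")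
    case True
    have "next_pt x \<in> {b<..t}" "next_pt (next_pt x) = next_pt x" "next_pt t = t" "t \<in> {b<..t}"
      using True next_pt(1)[of x] next_pt_bounds[OF True] bt by (auto simp: next_pt_D top_in_D)
    with True show ?thesis by (simp del: greaterThanAtMost_iff)
  qed (simp del: greaterThanAtMost_iff)
qed

lemma shift_op_eq: "shift_op b t = gap_op + coarse_op"
  by (rule op_eqI) (simp add: blinfun.add_left)

lemma coarse_op_ind:
  assumes "b \<le> x" "x < t"
  obtains d where "d \<le> x" "d = b \<or> d \<in> D" "d < t"
    "blinfun_apply coarse_op (ind {b<..x}) = (blinfun_apply coarse_op (ind {b<..d}) :: 'a \<Rightarrow>\<^sub>C 'k::real_normed_field)"
proof (cases "x = b \<or> x \<in> D")
  case True
  then show ?thesis using that[of x] assms by auto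
next
  case False
  then have "x \<in> {b<..t}" using assms by auto
  then obtain e j where ej: "root e" "x \<in> gap e j" using gap_exists False by blast
  have ex: "e < x" using gap_subset[OF ej] by simp
  have "next_pt y \<le> x \<longleftrightarrow> next_pt y \<le> e" if "y \<in> {b<..t}" for y
    using gap_below[OF ej, of "next_pt y"] next_pt(1)[of y] that ex
    by (metis greaterThanAtMost_iff less_imp_le not_le order_trans)
  note same = this
  have "blinfun_apply coarse_op (ind {b<..x}) = (blinfun_apply coarse_op (ind {b<..e}) :: 'a \<Rightarrow>\<^sub>C 'k)"
  proof (rule bcontfun_eqI)
    fix y
    show "apply_bcontfun (blinfun_apply coarse_op (ind {b<..x})) y
      = apply_bcontfun (blinfun_apply coarse_op (ind {b<..e}) :: 'a \<Rightarrow>\<^sub>C 'k) y"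
    proof (cases "y \<in> {b<..t}")
      case True
      then have "b < next_pt y" using next_pt_bounds by auto
      then show ?thesis using True same[OF True] ex assms(2) less_trans[OF ex assms(2)] by (simp add: not_le)
    qed (simp del: greaterThanAtMost_iff)
  qed
  then show ?thesis using that[of e] ex ej(1) by (auto simp: root_def)
qed

text \<open>
  Countably many properties that hold eventually below \<open>t\<close> hold eventually together.
\<close>

lemma sequence_bounded_pred:
  assumes "\<And>n::nat. \<exists>u<t. \<forall>v. u \<le> v \<longrightarrow> v < t \<longrightarrow> P n v"
  shows "\<exists>u<t. \<forall>v. u \<le> v \<longrightarrow> v < t \<longrightarrow> (\<forall>n. P n v)"
proof -
  obtain s where s: "\<And>n. s n < t \<and> (\<forall>v. s n \<le> v \<longrightarrow> v < t \<longrightarrow> P n v)" using assms by metis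
  obtain u where "u < t" "\<forall>n. s n \<le> u" using sequence_bounded[of s] s by blast
  then show ?thesis using s by (meson order_trans)
qed

lemma eventually_constant:
  fixes g :: "'a \<Rightarrow>\<^sub>C 'k::real_normed_field"
  shows "\<exists>u<t. \<forall>v. u \<le> v \<longrightarrow> v < t \<longrightarrow> g v = g t"
proof -
  have c: "isCont (apply_bcontfun g) t" using continuous_on_eq_continuous_at[of UNIV] by auto
  have "\<exists>u<t. \<forall>v. u \<le> v \<longrightarrow> v < t \<longrightarrow> norm (g v - g t) < 1 / real (Suc n)" for n
  proof -
    obtain w where w: "w < t" "\<And>x'. w < x' \<Longrightarrow> x' \<le> t \<Longrightarrow> norm (g x' - g t) < 1 / real (Suc n)"
      using continuous_near[OF c bt, of "1 / real (Suc n)"] by (metis of_nat_0_less_iff zero_less_Suc zero_less_divide_1_iff)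
    obtain u where "w < u" "u < t" using limit w(1) by blast
    then show ?thesis using w(2) by (intro exI[of _ u]) auto
  qed
  from sequence_bounded_pred[where P = "\<lambda>n v. norm (g v - g t) < 1 / real (Suc n)", OF this]
  obtain u where u: "u < t"
    "\<And>v n. u \<le> v \<Longrightarrow> v < t \<Longrightarrow> norm (g v - g t) < 1 / real (Suc n)" by blast
  have "g v = g t" if "u \<le> v" "v < t" for v
  proof (rule ccontr)
    assume "g v \<noteq> g t"
    then obtain n where "1 / real (Suc n) < norm (g v - g t)"
      using nat_approx_posE[of "norm (g v - g t)"] by auto
    then show False using u(2)[OF that, of n] by simp
  qed
  then show ?thesis using u(1) by blast
qed

text \<open>
  The representing measure has countable support, so below a limit of uncountable cofinality
  it is carried by an initial segment. For each level \<open>1/(n+1)\<close> some segment leaves no interval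
  beyond it that is seen at that level; countably many such segments are bounded.
\<close>

lemma functional_support:
  fixes \<phi> :: "('a \<Rightarrow>\<^sub>C 'k::real_normed_field) \<Rightarrow> 'k"
  assumes \<phi>: "functional \<phi> C"
  shows "\<exists>u<t. \<forall>v. u \<le> v \<longrightarrow> v < t \<longrightarrow>
    (\<forall>f. (\<forall>x. \<not> (v < x \<and> x < t) \<longrightarrow> apply_bcontfun f x = 0) \<longrightarrow> \<phi> f = 0)"
proof -
  have "\<exists>u<t. \<forall>v. u \<le> v \<longrightarrow> v < t \<longrightarrow> (\<forall>f. norm f \<le> 1 \<longrightarrow>
    (\<forall>x. \<not> (v < x \<and> x < t) \<longrightarrow> apply_bcontfun f x = 0) \<longrightarrow> norm (\<phi> f) \<le> 1 / real (Suc n))" for n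
  proof -
    obtain u M' where u: "u < t" "infinite (M' :: nat set)"
      "\<forall>c<t. finite {n' \<in> M'. sees \<phi> {u<..c} (1 / real (Suc n))}"
      using unseen_intervals[of "\<lambda>_. \<phi>" C UNIV "1 / real (Suc n)" b t] \<phi> bt by auto
    have "norm (\<phi> f) \<le> 1 / real (Suc n)"
      if v: "u \<le> v" and f: "norm f \<le> 1" "\<forall>x. \<not> (v < x \<and> x < t) \<longrightarrow> apply_bcontfun f x = 0" for v f
    proof -
      obtain c where c: "c < t" "\<And>x. c \<le> x \<Longrightarrow> x < t \<Longrightarrow> f x = f t"
        using eventually_constant[of f] by blast
      have "f t = 0" using f(2) by simp
      have out: "apply_bcontfun f x = 0" if "x \<notin> {u<..c}" for x
      proof (cases "v < x \<and> x < t")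
        case True
        then have "c \<le> x" using that v by auto
        then show ?thesis using c(2)[of x] True \<open>f t = 0\<close> by simp
      qed (use f(2) in blast)
      have "\<not> sees \<phi> {u<..c} (1 / real (Suc n))"
      proof
        assume "sees \<phi> {u<..c} (1 / real (Suc n))"
        then show False using u(2) u(3)[rule_format, OF c(1)] by simp
      qed
      then show ?thesis using f(1) out unfolding sees_def by (meson not_less)
    qed
    then show ?thesis using u(1) by blast
  qed
  from sequence_bounded_pred[where P = "\<lambda>n v. \<forall>f. norm f \<le> 1 \<longrightarrow>
    (\<forall>x. \<not> (v < x \<and> x < t) \<longrightarrow> apply_bcontfun f x = 0) \<longrightarrow> norm (\<phi> f) \<le> 1 / real (Suc n)", OF this]
  obtain u where u: "u < t"
    "\<And>v n f. u \<le> v \<Longrightarrow> v < t \<Longrightarrow> norm f \<le> 1 \<Longrightarrow> (\<forall>x. \<not> (v < x \<and> x < t) \<longrightarrow> apply_bcontfun f x = 0) \<Longrightarrow>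
      norm (\<phi> f) \<le> 1 / real (Suc n)" by blast
  have "\<phi> f = 0" if v: "u \<le> v" "v < t" and f: "\<forall>x. \<not> (v < x \<and> x < t) \<longrightarrow> apply_bcontfun f x = 0" for v f
  proof (rule ccontr)
    assume nz: "\<phi> f \<noteq> 0"
    then have "f \<noteq> 0" using functionalD(4)[OF \<phi>] by auto
    \<comment> \<open>Normalize, because the bounds are for the unit ball.\<close>
    define f' where "f' = scale_bcontfun (of_real (inverse (norm f))) f"
    have f': "norm f' \<le> 1" "\<forall>x. \<not> (v < x \<and> x < t) \<longrightarrow> apply_bcontfun f' x = 0"
      using f \<open>f \<noteq> 0\<close> by (auto simp: f'_def norm_inverse)
    have "\<phi> f' \<noteq> 0" using nz \<open>f \<noteq> 0\<close> by (simp add: f'_def functionalD(2)[OF \<phi>])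
    then obtain n where "1 / real (Suc n) < norm (\<phi> f')"
      using nat_approx_posE[of "norm (\<phi> f')"] by auto
    then show False using u(2)[OF v f', of n] by simp
  qed
  then show ?thesis using u(1) by blast
qed

end

context uncountable_cofinality
begin

text \<open>
  Iterates of \<open>h\<close> from \<open>v\<close> form a sequence, so they are bounded below \<open>t\<close> and have a closure point
  as their supremum.
\<close>

lemma D_unbounded:
  assumes "closure_points b t h" "b \<le> v" "v < t"
  obtains c where "c \<in> closure_points.D b t h" "v < c" "c < t"
proof -
  interpret C: closure_points b t h by fact
  obtain u where u: "u < t" "\<And>j. C.it v j \<le> u"
    using sequence_bounded[of "C.it v"] C.it_bounds[OF assms(2,3)] by blast
  have lt: "C.it v j < u" for j
    using u(2)[of "Suc j"] C.it_less[OF assms(2,3), of j "Suc j"] by (meson lessI less_le_trans)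
  obtain c where "c \<in> C.D" "v < c" "c \<le> u"
    by (rule C.D_between[OF assms(2,3) lt less_imp_le[OF u(1)]])
  then show thesis using that u(1) by auto
qed

lemma continuous_zero:
  fixes g :: "'a \<Rightarrow>\<^sub>C 'k::real_normed_field"
  assumes "b < c" "\<And>w. b \<le> w \<Longrightarrow> w < c \<Longrightarrow> \<exists>d. w < d \<and> d < c \<and> apply_bcontfun g d = 0"
  shows "g c = 0"
proof (rule ccontr)
  assume "g c \<noteq> 0"
  moreover have "isCont (apply_bcontfun g) c" using continuous_on_eq_continuous_at[of UNIV] by auto
  ultimately obtain w where w: "b \<le> w" "w < c" "\<And>x. w < x \<Longrightarrow> x \<le> c \<Longrightarrow> norm (g x - g c) < norm (g c)"
    using continuous_near[OF _ assms(1), of _ "norm (g c)"] by (metis zero_less_norm_iff)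
  obtain d where "w < d" "d < c" "apply_bcontfun g d = 0" using assms(2)[OF w(1,2)] by blast
  then show False using w(3)[of d] by (simp add: less_imp_le)
qed

text \<open>
  The closing-off argument. The operators \<open>A m\<close> act on the functions that are constant on the gaps of
  \<open>D\<close> and vanish at \<open>t\<close>. For \<open>d\<close> in \<open>D\<close>, the value of \<open>A m f\<close> at \<open>d\<close> depends only on an initial part
  of \<open>f\<close>, and \<open>A m\<close> maps the indicator of \<open>(b, d]\<close> to a function that vanishes eventually;
  \<open>horizon_pt d\<close> is a point beyond which both are true for all \<open>m\<close>. At a point \<open>c\<close> that is closed
  under this horizon, \<open>A m f\<close> therefore depends on \<open>f c\<close> only.
\<close>

context
  fixes A :: "nat \<Rightarrow> ('a \<Rightarrow>\<^sub>C 'k::real_normed_field) \<Rightarrow>\<^sub>L ('a \<Rightarrow>\<^sub>C 'k)"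
  assumes A: "\<And>m. A m \<in> ops"
    and A_outside: "\<And>m f x. \<not> (b < x \<and> x < t) \<Longrightarrow> apply_bcontfun (blinfun_apply (A m) f) x = 0"
    and A_coarse: "\<And>m f. blinfun_apply (A m) (blinfun_apply coarse_op f) = blinfun_apply (A m) f"
begin

lemma horizon:
  "\<exists>u<t. \<forall>v. u \<le> v \<longrightarrow> v < t \<longrightarrow> (\<forall>m. (\<forall>f. (\<forall>x. \<not> (v < x \<and> x < t) \<longrightarrow> apply_bcontfun f x = 0) \<longrightarrow>
      apply_bcontfun (blinfun_apply (A m) f) d = 0) \<and> apply_bcontfun (blinfun_apply (A m) (ind {b<..d})) v = 0)"
proof (rule sequence_bounded_pred)
  fix m
  obtain u where u: "u < t" "\<And>v f. u \<le> v \<Longrightarrow> v < t \<Longrightarrow> (\<forall>x. \<not> (v < x \<and> x < t) \<longrightarrow> apply_bcontfun f x = 0) \<Longrightarrow>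
      apply_bcontfun (blinfun_apply (A m) f) d = 0"
    using functional_support[OF functional_eval[OF A[of m], of d]] by blast
  obtain u' where u': "u' < t" "\<And>v. u' \<le> v \<Longrightarrow> v < t \<Longrightarrow> apply_bcontfun (blinfun_apply (A m) (ind {b<..d})) v = 0"
    using eventually_constant[of "blinfun_apply (A m) (ind {b<..d})"] A_outside[of t m] by auto
  show "\<exists>u<t. \<forall>v. u \<le> v \<longrightarrow> v < t \<longrightarrow> (\<forall>f. (\<forall>x. \<not> (v < x \<and> x < t) \<longrightarrow> apply_bcontfun f x = 0) \<longrightarrow>
      apply_bcontfun (blinfun_apply (A m) f) d = 0) \<and> apply_bcontfun (blinfun_apply (A m) (ind {b<..d})) v = 0"
    by (rule exI[of _ "max u u'"]) (use u u' in auto)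
qed

definition horizon_pt :: "'a \<Rightarrow> 'a" where
  "horizon_pt d = (SOME u. u < t \<and> (\<forall>v. u \<le> v \<longrightarrow> v < t \<longrightarrow>
     (\<forall>m. (\<forall>f. (\<forall>x. \<not> (v < x \<and> x < t) \<longrightarrow> apply_bcontfun f x = 0) \<longrightarrow>
      apply_bcontfun (blinfun_apply (A m) f) d = 0) \<and> apply_bcontfun (blinfun_apply (A m) (ind {b<..d})) v = 0)))"

lemma horizon_pt:
  "horizon_pt d < t"
  "horizon_pt d \<le> v \<Longrightarrow> v < t \<Longrightarrow> \<forall>x. \<not> (v < x \<and> x < t) \<longrightarrow> apply_bcontfun f x = 0 \<Longrightarrow>
     apply_bcontfun (blinfun_apply (A m) f) d = 0"
  "horizon_pt d \<le> v \<Longrightarrow> v < t \<Longrightarrow> apply_bcontfun (blinfun_apply (A m) (ind {b<..d})) v = 0"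
proof -
  have *: "horizon_pt d < t \<and> (\<forall>v. horizon_pt d \<le> v \<longrightarrow> v < t \<longrightarrow>
     (\<forall>m. (\<forall>f. (\<forall>x. \<not> (v < x \<and> x < t) \<longrightarrow> apply_bcontfun f x = 0) \<longrightarrow>
      apply_bcontfun (blinfun_apply (A m) f) d = 0) \<and> apply_bcontfun (blinfun_apply (A m) (ind {b<..d})) v = 0))"
    unfolding horizon_pt_def using horizon[of d] by (rule someI_ex)
  show "horizon_pt d < t" using * by (rule conjunct1)
  show "horizon_pt d \<le> v \<Longrightarrow> v < t \<Longrightarrow> \<forall>x. \<not> (v < x \<and> x < t) \<longrightarrow> apply_bcontfun f x = 0 \<Longrightarrow>
     apply_bcontfun (blinfun_apply (A m) f) d = 0" 
    using * by blast
  show "horizon_pt d \<le> v \<Longrightarrow> v < t \<Longrightarrow> apply_bcontfun (blinfun_apply (A m) (ind {b<..d})) v = 0"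
    using * by blast
qed

definition sup_horizon :: "'a \<Rightarrow> 'a" where
  "sup_horizon v = (LEAST u. \<forall>d\<in>D. d \<le> v \<longrightarrow> horizon_pt d \<le> u)"

lemma sup_horizon:
  assumes "v < t"
  shows "sup_horizon v < t" "\<And>d. d \<in> D \<Longrightarrow> d \<le> v \<Longrightarrow> horizon_pt d \<le> sup_horizon v"
    "\<And>w. w \<le> v \<Longrightarrow> sup_horizon w \<le> sup_horizon v"
proof -
  obtain u where u: "u < t" "\<forall>d\<in>D. d \<le> v \<longrightarrow> horizon_pt d \<le> u"
    using D_regular[OF _ assms, of horizon_pt] horizon_pt(1) by blast
  show "sup_horizon v < t" using u Least_le[of "\<lambda>u. \<forall>d\<in>D. d \<le> v \<longrightarrow> horizon_pt d \<le> u" u]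
    unfolding sup_horizon_def by (simp add: le_less_trans)
  have all: "\<forall>d\<in>D. d \<le> v \<longrightarrow> horizon_pt d \<le> sup_horizon v"
    unfolding sup_horizon_def using u(2) by (rule LeastI)
  then show "\<And>d. d \<in> D \<Longrightarrow> d \<le> v \<Longrightarrow> horizon_pt d \<le> sup_horizon v" by blast
  show "sup_horizon w \<le> sup_horizon v" if "w \<le> v" for w
    unfolding sup_horizon_def[of w] by (rule Least_le) (use all that in \<open>auto dest: order_trans\<close>)
qed

definition above :: "'a \<Rightarrow> 'a" where
  "above v = (LEAST d. d \<in> D \<and> v < d)"

lemma above:
  assumes "b \<le> v" "v < t"
  shows "above v \<in> D" "v < above v" "above v < t" "\<And>w. w \<le> v \<Longrightarrow> above w \<le> above v"
proof -
  obtain c where c: "c \<in> D" "v < c" "c < t" using D_unbounded[OF closure_points_axioms assms] .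
  have *: "above v \<in> D \<and> v < above v" unfolding above_def by (rule LeastI[of _ c]) (use c in blast)
  then show "above v \<in> D" "v < above v" by auto
  have "above v \<le> c" unfolding above_def by (rule Least_le) (use c in blast)
  then show "above v < t" using c(3) by simp
  show "above w \<le> above v" if "w \<le> v" for w
    unfolding above_def[of w] by (rule Least_le) (use * that in auto)
qed

definition hop1 :: "'a \<Rightarrow> 'a" where
  "hop1 x = max (max (hop x) (max (sup_horizon x) (above x))) (copy_pt b x)"

interpretation C1: closure_points b t hop1
  unfolding hop1_def
proof (rule closure_points_max[OF indec])
  show "x < max (hop x) (max (sup_horizon x) (above x)) \<and> max (hop x) (max (sup_horizon x) (above x)) < t"
    if "b \<le> x" "x < t" for x
    using h_less[OF that] sup_horizon(1)[OF that(2)] above(3)[OF that] by (simp add: less_max_iff_disj)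
  show "max (hop x) (max (sup_horizon x) (above x)) \<le> max (hop y) (max (sup_horizon y) (above y))"
    if "b \<le> x" "x \<le> y" "y < t" for x y
    using h_mono[OF that] sup_horizon(3)[OF that(3,2)] above(4)[OF order_trans[OF that(1,2)] that(3,2)]
    by (intro max.mono)
qed

lemma C1_D_subset: "C1.D \<subseteq> D"
  unfolding C1.D_def D_def by (auto simp: hop1_def)

text \<open>
  Split \<open>f\<close> at \<open>c\<close>. The part beyond \<open>c\<close> is invisible at all points of \<open>D\<close> below \<open>c\<close>, which
  accumulate at \<open>c\<close>. The part up to \<open>c\<close> is approximated by indicators of \<open>(b, x]\<close>, and for \<open>x\<close>
  below \<open>c\<close> their images vanish at \<open>c\<close>.
\<close>

lemma diagonal:
  fixes f :: "'a \<Rightarrow>\<^sub>C 'k"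
  assumes c: "c \<in> C1.D" "c < t"
  shows "apply_bcontfun (blinfun_apply (A m) f) c
    = (f c - f t) * apply_bcontfun (blinfun_apply (A m) (ind {b<..c})) c"
proof -
  have cD: "c \<in> D" and bc: "b < c" using C1_D_subset c C1.D_bounds by auto
  have under: "hop1 y < c" if "b \<le> y" "y < c" for y using C1.D_closed_under[OF c(1) that] .
  have hor: "horizon_pt d < c" if "d \<in> D" "d < c" for d
  proof -
    have "b \<le> d" using D_bounds[OF that(1)] by (simp add: less_imp_le)
    then have "sup_horizon d < c" using under[of d] that by (simp add: hop1_def)
    then show ?thesis using sup_horizon(2)[of d d] that c(2) by (meson le_less_trans less_trans order_refl)
  qed
  define f' where "f' = blinfun_apply coarse_op f"
  have f't: "f' t = 0" and f'c: "f' c = f c - f t"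
    using next_pt_D top_in_D cD bc bt c(2) by (auto simp: f'_def)
  define f1 where "f1 = blinfun_apply (proj {b<..c}) f'"
  define f2 where "f2 = blinfun_apply (proj {c<..t}) f'"
  have f': "f' = f1 + f2"
    by (rule bcontfun_eqI) (use bc c(2) in \<open>auto simp: f1_def f2_def f'_def continuous_on_id\<close>)
  have "apply_bcontfun (blinfun_apply (A m) f2) c = 0"
  proof (rule continuous_zero[OF bc])
    fix w assume w: "b \<le> w" "w < c"
    have "above w < c" using under[OF w] by (simp add: hop1_def)
    moreover have "w < above w" "above w \<in> D" using above[OF w(1)] w(2) c(2) by auto
    moreover have "apply_bcontfun (blinfun_apply (A m) f2) (above w) = 0"
    proof (rule horizon_pt(2)[OF _ c(2)])
      show "horizon_pt (above w) \<le> c" using hor[OF \<open>above w \<in> D\<close> \<open>above w < c\<close>] by simp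
      show "\<forall>x. \<not> (c < x \<and> x < t) \<longrightarrow> apply_bcontfun f2 x = 0"
        using f't by (auto simp: f2_def continuous_on_id less_le)
    qed
    ultimately show "\<exists>d. w < d \<and> d < c \<and> apply_bcontfun (blinfun_apply (A m) f2) d = 0" by blast
  qed
  moreover have "apply_bcontfun (blinfun_apply (A m) f1) c
      = f' c * apply_bcontfun (blinfun_apply (A m) (ind {b<..c})) c"
    unfolding f1_def
  proof (rule functional_on_steps[OF functional_eval[OF A] bc])
    fix x assume x: "b \<le> x" "x < c"
    obtain d where d: "d \<le> x" "d = b \<or> d \<in> D" "d < t"
      "blinfun_apply coarse_op (ind {b<..x}) = (blinfun_apply coarse_op (ind {b<..d}) :: 'a \<Rightarrow>\<^sub>C 'k)"
      using coarse_op_ind[OF x(1) less_trans[OF x(2) c(2)]] by metis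
    have "blinfun_apply (A m) (ind {b<..x}) = blinfun_apply (A m) (ind {b<..d})"
      using d(4) A_coarse by metis
    moreover have "apply_bcontfun (blinfun_apply (A m) (ind {b<..d})) c = 0"
    proof (cases "d = b")
      case True
      have "ind {b<..d} = (0 :: 'a \<Rightarrow>\<^sub>C 'k)" by (rule bcontfun_eqI) (simp add: True)
      then show ?thesis by (simp add: blinfun.zero_right)
    next
      case False
      then have "d \<in> D" "d < c" using d x by auto
      then show ?thesis using hor[of d] c(2) by (intro horizon_pt(3)) auto
    qed
    ultimately show "apply_bcontfun (blinfun_apply (A m) (ind {b<..x})) c = 0" by simp
  qed
  ultimately have "apply_bcontfun (blinfun_apply (A m) f') c
      = f' c * apply_bcontfun (blinfun_apply (A m) (ind {b<..c})) c"
    by (simp add: f' blinfun.add_right)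
  then show ?thesis unfolding f'c by (simp add: f'_def A_coarse)
qed

definition \<gamma> :: "nat \<Rightarrow> 'a \<Rightarrow> 'k" where
  "\<gamma> m c = apply_bcontfun (blinfun_apply (A m) (ind {b<..c})) c"

text \<open>
  If the scalars kept oscillating, one could close off under the witnesses and obtain a closure
  point \<open>z\<close> at which they accumulate. But the image of the indicator of \<open>(b, z]\<close> is continuous at
  \<open>z\<close>, and its values at earlier closure points are these scalars.
\<close>

lemma diagonal_oscillation:
  assumes e: "0 < e"
  shows "\<exists>u<t. \<forall>v. u \<le> v \<longrightarrow> v < t \<longrightarrow>
    (\<forall>c c'. c \<in> C1.D \<longrightarrow> c' \<in> C1.D \<longrightarrow> v < c \<longrightarrow> c < t \<longrightarrow> v < c' \<longrightarrow> c' < t \<longrightarrow> norm (\<gamma> m c - \<gamma> m c') \<le> e)"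
proof (rule ccontr)
  \<comment> \<open>A pair of closure points beyond \<open>v\<close> whose scalars differ by more than \<open>e\<close>.\<close>
  define Q where "Q v c c' \<longleftrightarrow> c \<in> C1.D \<and> c' \<in> C1.D \<and> v < c \<and> c < t \<and> v < c' \<and> c' < t
    \<and> e < norm (\<gamma> m c - \<gamma> m c')" for v c c'
  assume "\<not> ?thesis"
  then have neg: "\<not> (\<exists>u<t. \<forall>v. u \<le> v \<longrightarrow> v < t \<longrightarrow> (\<forall>c c'. \<not> Q v c c'))"
    unfolding Q_def de_Morgan_conj not_less imp_conv_disj by simp
  have "\<exists>w<t. \<exists>c c'. c \<in> C1.D \<and> c' \<in> C1.D \<and> v < c \<and> c \<le> w \<and> v < c' \<and> c' \<le> w \<and> e < norm (\<gamma> m c - \<gamma> m c')"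
    if vt: "v < t" for v
  proof -
    obtain v' c c' where "v \<le> v'" "Q v' c c'" using neg vt by blast
    then show ?thesis unfolding Q_def
      by (intro exI[of _ "max c c'"] conjI exI[of _ c] exI[of _ c']) (auto dest: le_less_trans)
  qed
  then obtain w where w: "\<And>v. v < t \<Longrightarrow> w v < t \<and> (\<exists>c c'. c \<in> C1.D \<and> c' \<in> C1.D \<and> v < c \<and> c \<le> w v
      \<and> v < c' \<and> c' \<le> w v \<and> e < norm (\<gamma> m c - \<gamma> m c'))"
    by metis
  define q where "q = rec_nat b (\<lambda>_ v. max (hop1 v) (w v))"
  have q0: "q 0 = b" and qS: "q (Suc j) = max (hop1 (q j)) (w (q j))" for j by (simp_all add: q_def)
  have q: "b \<le> q j \<and> q j < t" for j
  proof (induction j)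
    case (Suc j)
    then show ?case using C1.h_less[of "q j"] w[of "q j"] by (auto simp: qS le_max_iff_disj)
  qed (simp add: q0 bt)
  have q_less: "q j < q (Suc j)" for j using C1.h_less(1)[of "q j"] q[of j] by (simp add: qS less_max_iff_disj)
  define z where "z = (LEAST u. \<forall>j. q j \<le> u)"
  obtain u where u: "u < t" "\<forall>j. q j \<le> u" using sequence_bounded[of q] q by blast
  have qz: "\<forall>j. q j \<le> z" unfolding z_def using u(2) by (rule LeastI)
  have zt: "z < t" using Least_le[of "\<lambda>u. \<forall>j. q j \<le> u" u] u unfolding z_def by simp
  have qz': "q j < z" for j using qz q_less[of j] by (meson less_le_trans)
  have below: "\<exists>j. y < q j" if "y < z" for y
    using not_less_Least[OF that[unfolded z_def]] by (auto simp: not_le)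
  have "hop1 y < z" if y: "b \<le> y" "y < z" for y
  proof -
    obtain j where "y < q j" using below[OF y(2)] by blast
    then have "hop1 y \<le> hop1 (q j)" using y(1) q[of j] by (intro C1.h_mono) auto
    also have "\<dots> \<le> q (Suc j)" by (simp add: qS)
    also have "\<dots> < z" by (rule qz')
    finally show ?thesis .
  qed
  moreover have bz: "b < z" using qz'[of 0] by (simp add: q0)
  ultimately have zD: "z \<in> C1.D" using zt by (auto simp: C1.D_def)
  have val: "apply_bcontfun (blinfun_apply (A m) (ind {b<..z})) c = \<gamma> m c" if "c \<in> C1.D" "c \<le> z" for c
  proof -
    have "b < c" "c < t" using C1.D_bounds[OF that(1)] that(2) zt by auto
    then show ?thesis using diagonal[OF that(1), of m "ind {b<..z}"] that(2) zt[folded not_le] by (simp add: \<gamma>_def)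
  qed
  have "isCont (apply_bcontfun (blinfun_apply (A m) (ind {b<..z}))) z"
    using continuous_on_eq_continuous_at[of UNIV] by auto
  then obtain y where y: "y < z" "\<And>x. y < x \<Longrightarrow> x \<le> z \<Longrightarrow>
      norm (apply_bcontfun (blinfun_apply (A m) (ind {b<..z})) x - apply_bcontfun (blinfun_apply (A m) (ind {b<..z})) z) < e / 2"
    using continuous_near[OF _ bz, of _ "e / 2"] e by (metis half_gt_zero)
  obtain j where j: "y < q j" using below[OF y(1)] by blast
  obtain c c' where c: "c \<in> C1.D" "c' \<in> C1.D" "q j < c" "c \<le> w (q j)" "q j < c'" "c' \<le> w (q j)"
    "e < norm (\<gamma> m c - \<gamma> m c')" using w[of "q j"] q[of j] by blast
  have "w (q j) \<le> q (Suc j)" by (simp add: qS)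
  then have wz: "w (q j) < z" using qz'[of "Suc j"] by simp
  have "norm (\<gamma> m c - \<gamma> m z) < e / 2" "norm (\<gamma> m c' - \<gamma> m z) < e / 2"
    using y(2)[of c] y(2)[of c'] val[of c] val[of c'] val[of z] c wz j zD by auto
  then have "norm (\<gamma> m c - \<gamma> m c') < e"
    using norm_triangle_ineq4[of "\<gamma> m c - \<gamma> m z" "\<gamma> m c' - \<gamma> m z"] by simp
  then show False using c(7) by simp
qed

lemma diagonal_constant:
  "\<exists>u<t. \<forall>m c c'. c \<in> C1.D \<longrightarrow> c' \<in> C1.D \<longrightarrow> u < c \<longrightarrow> c < t \<longrightarrow> u < c' \<longrightarrow> c' < t \<longrightarrow> \<gamma> m c = \<gamma> m c'"
proof -
  let ?P = "\<lambda>p v. \<forall>c c'. c \<in> C1.D \<longrightarrow> c' \<in> C1.D \<longrightarrow> v < c \<longrightarrow> c < t \<longrightarrow> v < c' \<longrightarrow> c' < t \<longrightarrow>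
    norm (\<gamma> (fst (prod_decode p)) c - \<gamma> (fst (prod_decode p)) c') \<le> 1 / real (Suc (snd (prod_decode p)))"
  have "\<exists>u<t. \<forall>v. u \<le> v \<longrightarrow> v < t \<longrightarrow> ?P p v" for p
    using diagonal_oscillation[of "1 / real (Suc (snd (prod_decode p)))" "fst (prod_decode p)"] by simp
  from sequence_bounded_pred[where P = ?P, OF this]
  obtain u where u: "u < t" "\<forall>p. ?P p u" by (meson order_refl)
  have "\<gamma> m c = \<gamma> m c'" if "c \<in> C1.D" "c' \<in> C1.D" "u < c" "c < t" "u < c'" "c' < t" for m c c'
  proof (rule ccontr)
    assume "\<gamma> m c \<noteq> \<gamma> m c'"
    then obtain n where "1 / real (Suc n) < norm (\<gamma> m c - \<gamma> m c')"
      using nat_approx_posE[of "norm (\<gamma> m c - \<gamma> m c')"] by auto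
    then show False using u(2)[rule_format, OF that, of "prod_encode (m, n)"] by simp
  qed
  then show ?thesis using u(1) by blast
qed

text \<open>
  Adding the bound beyond which the scalars are constant to the function \<open>h\<close> removes the closure
  points below it.
\<close>

lemma closing_off:
  assumes norm_A: "\<And>m. norm (A m) \<le> K"
  obtains h' g where "closure_points b t h'" "\<And>m. norm (g m) \<le> K"
    "\<And>m f c. c \<in> closure_points.D b t h' \<Longrightarrow>
      apply_bcontfun (blinfun_apply (A m) f) c = g m * apply_bcontfun (blinfun_apply coarse_op f) c"
proof -
  obtain u where u: "u < t" "\<And>m c c'. c \<in> C1.D \<Longrightarrow> c' \<in> C1.D \<Longrightarrow> u < c \<Longrightarrow> c < t \<Longrightarrow> u < c' \<Longrightarrow> c' < t \<Longrightarrow> \<gamma> m c = \<gamma> m c'"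
    using diagonal_constant by blast
  define h' where "h' x = max (max (hop1 x) u) (copy_pt b x)" for x
  interpret C2: closure_points b t h'
    unfolding h'_def
  proof (rule closure_points_max[OF indec])
    show "x < max (hop1 x) u \<and> max (hop1 x) u < t" if "b \<le> x" "x < t" for x
      using C1.h_less[OF that] u(1) by (simp add: less_max_iff_disj)
    show "max (hop1 x) u \<le> max (hop1 y) u" if "b \<le> x" "x \<le> y" "y < t" for x y
      using C1.h_mono[OF that] by (intro max.mono) auto
  qed
  have D2: "c \<in> C1.D" "u < c" if "c \<in> C2.D" for c
  proof -
    show "c \<in> C1.D" using that unfolding C1.D_def C2.D_def by (auto simp: h'_def)
    show "u < c" using C2.D_closed_under[OF that order_refl] C2.D_bounds[OF that] by (simp add: h'_def)
  qed
  obtain c0 where c0: "c0 \<in> C2.D" "c0 < t" using D_unbounded[OF C2.closure_points_axioms order_refl bt] by blast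
  define g where "g m = \<gamma> m c0" for m
  have "norm (g m) \<le> K" for m
  proof -
    have "norm (g m) \<le> norm (blinfun_apply (A m) (ind {b<..c0}))" unfolding g_def \<gamma>_def by (rule norm_bounded)
    also have "\<dots> \<le> norm (A m) * norm (ind {b<..c0} :: 'a \<Rightarrow>\<^sub>C 'k)" by (rule norm_blinfun)
    also have "\<dots> \<le> norm (A m) * 1" by (intro mult_left_mono norm_bound) auto
    finally show ?thesis using norm_A[of m] by simp
  qed
  moreover have "apply_bcontfun (blinfun_apply (A m) f) c = g m * apply_bcontfun (blinfun_apply coarse_op f) c"
    if c: "c \<in> C2.D" for m f c
  proof -
    have cD: "c \<in> D" "b < c" "c \<le> t" using D2(1)[OF c] C1_D_subset C2.D_bounds[OF c] by auto
    show ?thesis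
    proof (cases "c = t")
      case True
      then show ?thesis using A_outside[of t m f] cD by (simp add: next_pt_D)
    next
      case False
      then have ct: "c < t" using cD by simp
      have "\<gamma> m c = g m" unfolding g_def using D2 c c0 ct u(2) by blast
      then show ?thesis using diagonal[OF D2(1)[OF c] ct, of m f] cD by (simp add: \<gamma>_def next_pt_D mult.commute)
    qed
  qed
  ultimately show thesis using that[OF C2.closure_points_axioms] by blast
qed

end

end

context algebra_seminorm
begin

text \<open>
  For a sequence in the unit ball, closing off gives scalars \<open>g m\<close> such that \<open>A m - g m P\<close> takes
  values in the functions that vanish on one closed cofinal set, which depends on the sequence
  but not on \<open>m\<close>. The gap operator of this set fixes these differences and is tame.
\<close>

lemma bounded_between_coarse:
  fixes b t :: 'a
  assumes "uncountable_cofinality b t"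
  defines "P \<equiv> uncountable_cofinality.coarse_op b t"
  shows "bounded_between P P"
  unfolding bounded_between_def
proof (rule bounded_if_bounded_on_sequences[where w = "\<lambda>_. 1"])
  interpret uncountable_cofinality b t by fact
  have P [simp]: "P \<in> ops" "P o\<^sub>L P = P" by (simp_all add: P_def coarse_op_idem)
  show "P o\<^sub>L (r *\<^sub>R T) o\<^sub>L P = r *\<^sub>R (P o\<^sub>L T o\<^sub>L P)" for r T
    by (simp add: compose_scaleR_left compose_scaleR_right)
  show "P o\<^sub>L T o\<^sub>L P \<in> ops" if "T \<in> ops" for T using that by simp
  fix T :: "nat \<Rightarrow> ('a \<Rightarrow>\<^sub>C 'k) \<Rightarrow>\<^sub>L ('a \<Rightarrow>\<^sub>C 'k)"
  assume T: "\<And>k. T k \<in> ops \<and> norm (T k) \<le> 1"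
  define A where "A m = P o\<^sub>L T m o\<^sub>L P" for m
  have A [simp]: "A m \<in> ops" for m using T by (simp add: A_def)
  have nP: "norm P \<le> 2" unfolding P_def by (rule norm_coarse_op)
  have norm_A: "norm (A m) \<le> 4" for m
  proof -
    have "norm (A m) \<le> norm (P o\<^sub>L T m) * norm P" unfolding A_def by (rule norm_blinfun_compose)
    also have "\<dots> \<le> (norm P * norm (T m)) * norm P" by (intro mult_right_mono norm_blinfun_compose) simp
    also have "\<dots> \<le> (2 * 1) * 2" using nP T[of m] by (intro mult_mono) auto
    finally show ?thesis by simp
  qed
  have out: "apply_bcontfun (blinfun_apply (A m) f) x = 0" if "\<not> (b < x \<and> x < t)" for m f x
  proof (cases "x = t")
    case True
    then show ?thesis by (simp add: A_def P_def next_pt_D top_in_D)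
  next
    case False
    then show ?thesis using that by (auto simp: A_def P_def)
  qed
  have coarse: "blinfun_apply (A m) (blinfun_apply coarse_op f) = blinfun_apply (A m) f" for m f
    using arg_cong[OF P(2), of "\<lambda>S. blinfun_apply (P o\<^sub>L T m) (blinfun_apply S f)"] by (simp add: A_def P_def)
  obtain h' g where h': "closure_points b t h'" and g: "\<And>m. norm (g m) \<le> 4"
    and Ag: "\<And>m f c. c \<in> closure_points.D b t h' \<Longrightarrow>
      apply_bcontfun (blinfun_apply (A m) f) c = g m * apply_bcontfun (blinfun_apply coarse_op f) c"
    using closing_off[of A 4] A out coarse norm_A by metis
  interpret C: closure_points b t h' by fact
  let ?R = "C.gap_op :: ('a \<Rightarrow>\<^sub>C 'k) \<Rightarrow>\<^sub>L ('a \<Rightarrow>\<^sub>C 'k)"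
  obtain K where K: "0 \<le> K" "\<forall>T\<in>ops. n (?R o\<^sub>L T) \<le> K * norm T"
    using tame_gap_op[OF h'] by (rule tameE)
  have "n (A m) \<le> K * 12 + 4 * n P" for m
  proof -
    let ?B = "A m - scale_blinfun (g m) P"
    have B [simp]: "?B \<in> ops" by simp
    have RB: "?R o\<^sub>L ?B = ?B"
    proof (rule op_eqI)
      fix f x
      show "apply_bcontfun (blinfun_apply (?R o\<^sub>L ?B) f) x = apply_bcontfun (blinfun_apply ?B f) x"
      proof (cases "x \<in> {b<..t}")
        case True
        then have "C.next_pt x \<in> C.D" using C.next_pt(1) by simp
        then have "apply_bcontfun (blinfun_apply ?B f) (C.next_pt x) = 0"
          using Ag[of "C.next_pt x" m f] by (simp add: blinfun.diff_left P_def del: coarse_op_apply)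
        then show ?thesis using True by (simp only: blinfun_apply_blinfun_compose C.gap_op_apply if_True diff_zero)
      next
        case False
        then have "\<not> (b < x \<and> x < t)" by auto
        then have "apply_bcontfun (blinfun_apply ?B f) x = 0"
          using out[of x m f] False by (simp add: blinfun.diff_left P_def del: greaterThanAtMost_iff)
        then show ?thesis using False by (simp only: blinfun_apply_blinfun_compose C.gap_op_apply if_False)
      qed
    qed
    have "norm (scale_blinfun (g m) P) \<le> norm (g m) * norm P"
      by (rule norm_blinfun_bound) (auto simp: mult.assoc intro!: mult_left_mono norm_blinfun)
    also have "\<dots> \<le> 4 * 2" using g[of m] nP by (intro mult_mono) auto
    finally have "norm ?B \<le> 12" using norm_triangle_ineq4[of "A m" "scale_blinfun (g m) P"] norm_A[of m] by simp
    then have "K * norm ?B \<le> K * 12" using K(1) by (intro mult_left_mono)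
    then have "n ?B \<le> K * 12" using K(2)[rule_format, OF B] unfolding RB by simp
    moreover have "n (scale_blinfun (g m) P) \<le> 4 * n P"
      using g[of m] nonneg[OF P(1)] by (simp add: homogeneous mult_right_mono)
    moreover have "n (A m) \<le> n ?B + n (scale_blinfun (g m) P)"
      using triangle[of ?B "scale_blinfun (g m) P"] by simp
    ultimately show ?thesis by simp
  qed
  then show "\<exists>K. \<forall>j. n (P o\<^sub>L T j o\<^sub>L P) \<le> 1 * K" unfolding A_def by auto
qed simp

lemma bounded_between_shift_op_self:
  fixes b t :: 'a
  assumes ind: "indecomposable b t" and limit: "\<And>u. u < t \<Longrightarrow> \<exists>v. u < v \<and> v < t"
  shows "bounded_between (shift_op b t) (shift_op b t)"
proof (cases "\<exists>s :: nat \<Rightarrow> 'a. (\<forall>n. s n < t) \<and> (\<forall>u<t. \<exists>n. u < s n)")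
  case True
  then show ?thesis
    using tame_shift_countable_cofinality[OF ind] tame_bounded_between(1)[OF _ shift_op_ops] by blast
next
  case False
  have "\<exists>u<t. \<forall>n. s n \<le> u" if "\<And>n. s n < t" for s :: "nat \<Rightarrow> 'a"
    using False that by (meson not_less)
  with ind limit have uc: "uncountable_cofinality b t" by (rule uncountable_cofinality.intro)
  then interpret uncountable_cofinality b t .
  let ?G = "gap_op :: ('a \<Rightarrow>\<^sub>C 'k) \<Rightarrow>\<^sub>L ('a \<Rightarrow>\<^sub>C 'k)" and ?C = "coarse_op :: ('a \<Rightarrow>\<^sub>C 'k) \<Rightarrow>\<^sub>L ('a \<Rightarrow>\<^sub>C 'k)"
  have G: "tame ?G" by (rule tame_gap_op[OF closure_points_axioms])
  have "bounded_between (?G + ?C) (?G + ?C)"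
    by (intro bounded_between_add bounded_between_add_right tame_bounded_between[OF G]
        bounded_between_coarse[OF uc]) auto
  then show ?thesis by (simp add: shift_op_eq)
qed

lemma bounded_between_shift_op:
  fixes b t b' t' :: 'a
  assumes ind: "indecomposable b t" "indecomposable b' t'"
    and limit: "\<And>u. u < t \<Longrightarrow> \<exists>v. u < v \<and> v < t" "\<And>u. u < t' \<Longrightarrow> \<exists>v. u < v \<and> v < t'"
  shows "bounded_between (shift_op b t) (shift_op b' t')"
proof -
  have bt: "b < t" "b' < t'" using ind by (auto simp: indecomposable_def)
  consider "col b t < col b' t'" | "col b t = col b' t'" | "col b' t' < col b t" by fastforce
  then show ?thesis
  proof cases
    case 1
    show ?thesis
      by (rule tame_bounded_between(1)[OF tame_shift_op[OF tame_smaller_interval[OF ind(2) bt(1) 1]] shift_op_ops])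
  next
    case 2
    show ?thesis
      by (rule bounded_between_same_type[OF bounded_between_shift_op_self[OF ind(1) limit(1)] bt 2])
  next
    case 3
    show ?thesis
      by (rule tame_bounded_between(2)[OF tame_shift_op[OF tame_smaller_interval[OF ind(1) bt(2) 3]] shift_op_ops])
  qed
qed

end

section \<open>Algebra seminorms are bounded by the operator norm\<close>

text \<open>
  Finite sums of the building blocks of the identity operator. Between any two blocks the
  seminorm is bounded, and this property is additive in both arguments.
\<close>

inductive_set pieces :: "(('a::{wellorder, linorder_topology} \<Rightarrow>\<^sub>C 'k::real_normed_field) \<Rightarrow>\<^sub>L ('a \<Rightarrow>\<^sub>C 'k)) set" where
  const: "clopen E \<Longrightarrow> comp_op E (\<lambda>_. t) \<in> pieces"
| shift: "indecomposable b t \<Longrightarrow> (\<And>u. u < t \<Longrightarrow> \<exists>v. u < v \<and> v < t) \<Longrightarrow> shift_op b t \<in> pieces"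
| add: "R \<in> pieces \<Longrightarrow> S \<in> pieces \<Longrightarrow> R + S \<in> pieces"

lemma pieces_ops: "R \<in> pieces \<Longrightarrow> R \<in> ops"
  by (induction rule: pieces.induct) auto

text \<open>
  By induction on \<open>t\<close>: cut off an indecomposable interval \<open>(b, t]\<close>, or the isolated point \<open>t\<close>.
\<close>

lemma proj_atMost_pieces:
  fixes t :: "'a::{wellorder, linorder_topology}"
  shows "proj {..t} \<in> (pieces :: (('a \<Rightarrow>\<^sub>C 'k::real_normed_field) \<Rightarrow>\<^sub>L ('a \<Rightarrow>\<^sub>C 'k)) set)"
proof (induction t rule: less_induct)
  case (less t)
  have id: "continuous_on S (\<lambda>x. x)" for S :: "'a set" by (rule continuous_on_id)
  show ?case
  proof (cases "\<exists>y. y < t")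
    case False
    then have t: "{..t} = {t}" by (auto simp: not_less intro: antisym)
    then have cl: "clopen {t}" using clopen_intervals(1)[of t] by simp
    have "proj {..t} = (comp_op {t} (\<lambda>_. t) :: ('a \<Rightarrow>\<^sub>C 'k) \<Rightarrow>\<^sub>L ('a \<Rightarrow>\<^sub>C 'k))"
      by (rule op_eqI) (simp add: t cl id)
    then show ?thesis using cl by (simp add: pieces.const)
  next
    case True
    then obtain b where b: "indecomposable b t" using indecomposable_exists by blast
    then have bt: "b < t" by (simp add: indecomposable_def)
    show ?thesis
    proof (cases "\<forall>u<t. \<exists>v. u < v \<and> v < t")
      case True
      have "proj {..t} = (proj {..b} + (shift_op b t + comp_op {b<..t} (\<lambda>_. t)) :: ('a \<Rightarrow>\<^sub>C 'k) \<Rightarrow>\<^sub>L ('a \<Rightarrow>\<^sub>C 'k))"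
        by (rule op_eqI) (use bt in \<open>auto simp: id blinfun.add_left\<close>)
      then show ?thesis
        using pieces.add[OF less.IH[OF bt] pieces.add[OF pieces.shift[OF b] pieces.const]] True by simp
    next
      case False
      then obtain p where p: "p < t" "\<And>v. p < v \<Longrightarrow> \<not> v < t" by blast
      then have set: "{p<..t} = {t}" by (auto simp: not_less intro: antisym)
      then have cl: "clopen {t}" using clopen_intervals(3)[of p t] by simp
      have *: "x \<le> t \<longleftrightarrow> x \<le> p \<or> x = t" for x using p by (metis leI le_less order_trans)
      have "proj {..t} = (proj {..p} + comp_op {t} (\<lambda>_. t) :: ('a \<Rightarrow>\<^sub>C 'k) \<Rightarrow>\<^sub>L ('a \<Rightarrow>\<^sub>C 'k))"
        by (rule op_eqI) (use p(1) in \<open>auto simp: id cl * blinfun.add_left\<close>)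
      then show ?thesis using pieces.add[OF less.IH[OF p(1)] pieces.const[OF cl]] by simp
    qed
  qed
qed

lemma infinite_if_limit:
  fixes t :: "'a::{wellorder, linorder_topology}"
  assumes "y < t" "\<And>u. u < t \<Longrightarrow> \<exists>v. u < v \<and> v < t"
  shows "infinite (UNIV :: 'a set)"
proof
  assume fin: "finite (UNIV :: 'a set)"
  then have f: "finite {..<t}" by (rule finite_subset[rotated]) simp
  have "Max {..<t} \<in> {..<t}" by (rule Max_in[OF f]) (use assms(1) in auto)
  then obtain v where "Max {..<t} < v" "v < t" using assms(2) by auto
  then show False using Max_ge[OF f, of v] by simp
qed

context algebra_seminorm
begin

lemma tame_const_if_limit:
  fixes b t :: 'a
  assumes "indecomposable b t" "\<And>u. u < t \<Longrightarrow> \<exists>v. u < v \<and> v < t" "clopen E"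
  shows "tame (comp_op E (\<lambda>_. s))"
proof -
  have "b < t" using assms(1) by (simp add: indecomposable_def)
  from infinite_if_limit[OF this assms(2)] show ?thesis by (rule tame_const[OF _ assms(3)])
qed

lemma bounded_between_pieces:
  assumes "R \<in> pieces" "S \<in> pieces"
  shows "bounded_between R S"
  using assms
proof (induction arbitrary: S rule: pieces.induct)
  case (const E s)
  have const_ops: "(comp_op E (\<lambda>_. s) :: ('a \<Rightarrow>\<^sub>C 'k) \<Rightarrow>\<^sub>L ('a \<Rightarrow>\<^sub>C 'k)) \<in> ops" using const(1) by simp
  from const(2) show ?case
  proof (induction rule: pieces.induct)
    case (const F t)
    show ?case by (rule bounded_between_const[OF \<open>clopen E\<close> const])
  next
    case (shift b t)
    show ?case
      by (rule tame_bounded_between(1)[OF tame_const_if_limit[OF shift \<open>clopen E\<close>] shift_op_ops])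
  next
    case (add R' S')
    show ?case
      by (rule bounded_between_add_right[OF add.IH pieces_ops[OF add.hyps(1)] pieces_ops[OF add.hyps(2)] const_ops])
  qed
next
  case (shift b t)
  note t = shift(1,2)
  from shift(3) show ?case
  proof (induction rule: pieces.induct)
    case (const F s)
    show ?case by (rule tame_bounded_between(2)[OF tame_const_if_limit[OF t const] shift_op_ops])
  next
    case (shift b' t')
    show ?case by (rule bounded_between_shift_op[OF t(1) shift(1) t(2) shift(2)])
  next
    case (add R' S')
    show ?case
      by (rule bounded_between_add_right[OF add.IH pieces_ops[OF add.hyps(1)] pieces_ops[OF add.hyps(2)] shift_op_ops])
  qed
next
  case (add R' R'')
  show ?case
    by (rule bounded_between_add[OF add.IH(1)[OF add.prems] add.IH(2)[OF add.prems]
          pieces_ops[OF add.hyps(1)] pieces_ops[OF add.hyps(2)] pieces_ops[OF add.prems]])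
qed

theorem bounded_by_operator_norm:
  assumes "(UNIV :: 'a set) = {..\<alpha>}"
  obtains C where "0 \<le> C" "\<And>T. T \<in> ops \<Longrightarrow> n T \<le> C * norm T"
proof -
  have "proj {..\<alpha>} = (id_blinfun :: ('a \<Rightarrow>\<^sub>C 'k) \<Rightarrow>\<^sub>L ('a \<Rightarrow>\<^sub>C 'k))"
    unfolding assms[symmetric] by (rule op_eqI) (simp add: continuous_on_id)
  then have "bounded_between id_blinfun id_blinfun"
    using bounded_between_pieces[OF proj_atMost_pieces[of \<alpha>] proj_atMost_pieces[of \<alpha>]] by simp
  then obtain C where "0 \<le> C" "\<forall>T\<in>ops. n (id_blinfun o\<^sub>L T o\<^sub>L id_blinfun) \<le> C * norm T"
    by (rule bounded_betweenE)
  then show thesis using that by simp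
qed

end

section \<open>Compact operators\<close>

lemma compact_closure_subset:
  fixes K :: "'a::metric_space set"
  assumes "compact K" "S \<subseteq> K"
  shows "compact (closure S)"
  using assms closure_minimal[OF assms(2) compact_imp_closed[OF assms(1)]]
  by (metis compact_Int_closed closed_closure inf.absorb_iff2)

lemma compact_operatorsI:
  assumes "T \<in> ops" "compact K" "blinfun_apply T ` cball 0 1 \<subseteq> K"
  shows "T \<in> compact_operators"
  using assms compact_closure_subset by (auto simp: compact_operators_def)

lemma compact_operatorsD:
  assumes "T \<in> compact_operators"
  shows "T \<in> ops" "compact (closure (blinfun_apply T ` cball 0 1))"
  using assms by (auto simp: compact_operators_def)

lemma compact_operators_add:
  assumes "S \<in> compact_operators" "T \<in> compact_operators"
  shows "S + T \<in> compact_operators"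
proof (rule compact_operatorsI)
  show "S + T \<in> ops" using assms compact_operatorsD(1) by blast
  show "compact {x + y |x y. x \<in> closure (blinfun_apply S ` cball 0 1) \<and> y \<in> closure (blinfun_apply T ` cball 0 1)}"
    using assms compact_operatorsD(2) by (intro compact_sums) auto
  show "blinfun_apply (S + T) ` cball 0 1
    \<subseteq> {x + y |x y. x \<in> closure (blinfun_apply S ` cball 0 1) \<and> y \<in> closure (blinfun_apply T ` cball 0 1)}"
  proof
    fix z assume "z \<in> blinfun_apply (S + T) ` cball 0 1"
    then obtain f where "f \<in> cball 0 1" "z = blinfun_apply S f + blinfun_apply T f" by (auto simp: blinfun.add_left)
    then show "z \<in> {x + y |x y. x \<in> closure (blinfun_apply S ` cball 0 1) \<and> y \<in> closure (blinfun_apply T ` cball 0 1)}"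
      using closure_subset by blast
  qed
qed

lemma compact_operators_compose_left:
  assumes "S \<in> ops" "T \<in> compact_operators"
  shows "S o\<^sub>L T \<in> compact_operators"
proof (rule compact_operatorsI)
  show "S o\<^sub>L T \<in> ops" using assms compact_operatorsD(1) by blast
  show "compact (blinfun_apply S ` closure (blinfun_apply T ` cball 0 1))"
    using compact_operatorsD(2)[OF assms(2)]
    by (intro compact_continuous_image linear_continuous_on blinfun.bounded_linear_right)
  show "blinfun_apply (S o\<^sub>L T) ` cball 0 1 \<subseteq> blinfun_apply S ` closure (blinfun_apply T ` cball 0 1)"
    using closure_subset by fastforce
qed

lemma compact_operators_compose_right:
  assumes "S \<in> ops" "T \<in> compact_operators"
  shows "T o\<^sub>L S \<in> compact_operators"
proof (rule compact_operatorsI)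
  show "T o\<^sub>L S \<in> ops" using assms compact_operatorsD(1) by blast
  let ?m = "norm S + 1"
  have m: "0 < ?m" by (simp add: add_nonneg_pos)
  show "compact ((\<lambda>y. ?m *\<^sub>R y) ` closure (blinfun_apply T ` cball 0 1))"
    using compact_operatorsD(2)[OF assms(2)] by (rule compact_scaling)
  show "blinfun_apply (T o\<^sub>L S) ` cball 0 1 \<subseteq> (\<lambda>y. ?m *\<^sub>R y) ` closure (blinfun_apply T ` cball 0 1)"
  proof
    fix z assume "z \<in> blinfun_apply (T o\<^sub>L S) ` cball 0 1"
    then obtain f where f: "norm f \<le> 1" "z = blinfun_apply T (blinfun_apply S f)" by auto
    let ?g = "inverse ?m *\<^sub>R blinfun_apply S f"
    have "norm (blinfun_apply S f) \<le> norm S * 1"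
      by (rule order_trans[OF norm_blinfun]) (use f in \<open>intro mult_left_mono; simp\<close>)
    then have "norm ?g \<le> 1" using m by (simp add: field_simps)
    then have "blinfun_apply T ?g \<in> closure (blinfun_apply T ` cball 0 1)" using closure_subset by fastforce
    moreover have "z = ?m *\<^sub>R blinfun_apply T ?g" using f m by (simp add: blinfun.scaleR_right)
    ultimately show "z \<in> (\<lambda>y. ?m *\<^sub>R y) ` closure (blinfun_apply T ` cball 0 1)" by blast
  qed
qed

lemma compact_operators_scale:
  assumes "T \<in> compact_operators"
  shows "scale_blinfun c T \<in> compact_operators"
proof -
  have "scale_blinfun c T = scale_blinfun c id_blinfun o\<^sub>L T" by (rule blinfun_eqI) simp
  then show ?thesis using compact_operators_compose_left[OF _ assms, of "scale_blinfun c id_blinfun"] by simp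
qed

lemma compact_operators_const:
  fixes t :: "'a::topological_space"
  assumes E: "clopen E"
  shows "comp_op E (\<lambda>_. t) \<in> (compact_operators :: (('a \<Rightarrow>\<^sub>C 'k::{real_normed_field, heine_borel}) \<Rightarrow>\<^sub>L _) set)"
proof (rule compact_operatorsI)
  have "bounded_linear (\<lambda>c. scale_bcontfun c (ind E :: 'a \<Rightarrow>\<^sub>C 'k))"
    by (rule bounded_linear_intro[where K = "norm (ind E :: 'a \<Rightarrow>\<^sub>C 'k)"])
      (auto intro!: bcontfun_eqI simp: algebra_simps)
  then show "compact ((\<lambda>c. scale_bcontfun c (ind E :: 'a \<Rightarrow>\<^sub>C 'k)) ` cball 0 1)"
    by (intro compact_continuous_image linear_continuous_on) auto
  show "blinfun_apply (comp_op E (\<lambda>_. t)) ` cball 0 1 \<subseteq> (\<lambda>c. scale_bcontfun c (ind E :: 'a \<Rightarrow>\<^sub>C 'k)) ` cball 0 1"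
  proof
    fix z :: "'a \<Rightarrow>\<^sub>C 'k" assume "z \<in> blinfun_apply (comp_op E (\<lambda>_. t)) ` cball 0 1"
    then obtain f :: "'a \<Rightarrow>\<^sub>C 'k" where f: "norm f \<le> 1" "z = blinfun_apply (comp_op E (\<lambda>_. t)) f" by auto
    have "z = scale_bcontfun (f t) (ind E)" unfolding f(2) using E by (intro bcontfun_eqI) simp
    moreover have "norm (f t) \<le> 1" using norm_bounded[of f t] f(1) by simp
    ultimately show "z \<in> (\<lambda>c. scale_bcontfun c (ind E :: 'a \<Rightarrow>\<^sub>C 'k)) ` cball 0 1" by auto
  qed
qed (use E in simp)

lemma compact_operators_zero: "0 \<in> compact_operators"
  by (rule compact_operatorsI[of _ "{0}"]) auto

text \<open>
  By induction on \<open>t\<close>, the interval up to \<open>t\<close> splits into finitely many pieces \<open>(b, s]\<close> on which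
  each \<open>T f\<close> varies by at most \<open>r\<close>. Replacing \<open>T f\<close> by its value at the right end of each piece
  gives an operator of finite rank.
\<close>

lemma near_compact_if_small_oscillation:
  fixes T :: "('a::{wellorder, linorder_topology} \<Rightarrow>\<^sub>C 'k::{real_normed_field, heine_borel}) \<Rightarrow>\<^sub>L ('a \<Rightarrow>\<^sub>C 'k)"
  assumes top: "(UNIV :: 'a set) = {..\<alpha>}" and T: "T \<in> ops" and r: "0 < r"
    and osc: "\<And>s y. y < s \<Longrightarrow> \<exists>b<s. \<forall>x f. b < x \<longrightarrow> x < s \<longrightarrow> norm f \<le> 1 \<longrightarrow>
      norm (apply_bcontfun (blinfun_apply T f) x - apply_bcontfun (blinfun_apply T f) s) \<le> r"
  obtains J where "J \<in> compact_operators" "norm (T - J) \<le> r"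
proof -
  have "\<exists>J\<in>compact_operators. \<forall>f. norm f \<le> 1 \<longrightarrow> (\<forall>x. if x \<le> t
      then norm (apply_bcontfun (blinfun_apply T f) x - apply_bcontfun (blinfun_apply J f) x) \<le> r
      else apply_bcontfun (blinfun_apply J f) x = 0)" for t
  proof (induction t rule: less_induct)
    case (less t)
    show ?case
    proof (cases "\<exists>y. y < t")
      case False
      then have t: "x \<le> t \<longleftrightarrow> x = t" for x by (auto simp: not_less intro: antisym)
      show ?thesis
      proof (rule bexI[of _ "comp_op {..t} (\<lambda>_. t) o\<^sub>L T"])
        show "comp_op {..t} (\<lambda>_. t) o\<^sub>L T \<in> compact_operators"
          by (intro compact_operators_compose_right compact_operators_const T clopen_intervals)
      qed (use r in \<open>auto simp: t\<close>)
    next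
      case True
      then obtain b where b: "b < t" "\<And>x f. b < x \<Longrightarrow> x < t \<Longrightarrow> norm f \<le> 1 \<Longrightarrow>
        norm (apply_bcontfun (blinfun_apply T f) x - apply_bcontfun (blinfun_apply T f) t) \<le> r"
        using osc by meson
      obtain J where J: "J \<in> compact_operators" "\<And>f x. norm f \<le> 1 \<Longrightarrow> (if x \<le> b
        then norm (apply_bcontfun (blinfun_apply T f) x - apply_bcontfun (blinfun_apply J f) x) \<le> r
        else apply_bcontfun (blinfun_apply J f) x = 0)" using less.IH[OF b(1)] by meson
      show ?thesis
      proof (rule bexI[of _ "J + (comp_op {b<..t} (\<lambda>_. t) o\<^sub>L T)"])
        show "J + (comp_op {b<..t} (\<lambda>_. t) o\<^sub>L T) \<in> compact_operators"
          by (intro compact_operators_add J compact_operators_compose_right compact_operators_const T clopen_intervals)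
        show "\<forall>f. norm f \<le> 1 \<longrightarrow> (\<forall>x. if x \<le> t
          then norm (apply_bcontfun (blinfun_apply T f) x
            - apply_bcontfun (blinfun_apply (J + (comp_op {b<..t} (\<lambda>_. t) o\<^sub>L T)) f) x) \<le> r
          else apply_bcontfun (blinfun_apply (J + (comp_op {b<..t} (\<lambda>_. t) o\<^sub>L T)) f) x = 0)"
        proof (intro allI impI)
          fix f :: "'a \<Rightarrow>\<^sub>C 'k" and x assume f: "norm f \<le> 1"
          consider "x \<le> b" | "b < x" "x < t" | "x = t" | "t < x" by fastforce
          then show "if x \<le> t
            then norm (apply_bcontfun (blinfun_apply T f) x
              - apply_bcontfun (blinfun_apply (J + (comp_op {b<..t} (\<lambda>_. t) o\<^sub>L T)) f) x) \<le> r
            else apply_bcontfun (blinfun_apply (J + (comp_op {b<..t} (\<lambda>_. t) o\<^sub>L T)) f) x = 0"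
            by cases (use J(2)[OF f, of x] b f r in \<open>auto simp: blinfun.add_left\<close>)
        qed
      qed
    qed
  qed
  then obtain J where J: "J \<in> compact_operators" "\<And>f x. norm f \<le> 1 \<Longrightarrow> (if x \<le> \<alpha>
      then norm (apply_bcontfun (blinfun_apply T f) x - apply_bcontfun (blinfun_apply J f) x) \<le> r
      else apply_bcontfun (blinfun_apply J f) x = 0)" by meson
  have "norm (blinfun_apply (T - J) f) \<le> r" if "norm f \<le> 1" for f
  proof (rule norm_bound)
    fix x
    have "x \<le> \<alpha>" using top by auto
    then show "norm (apply_bcontfun (blinfun_apply (T - J) f) x) \<le> r"
      using J(2)[OF that, of x] by (simp add: blinfun.diff_left)
  qed
  note unit = this
  have "norm (blinfun_apply (T - J) f) \<le> r * norm f" for f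
  proof (cases "f = 0")
    case False
    have "norm (blinfun_apply (T - J) (inverse (norm f) *\<^sub>R f)) \<le> r" using False by (intro unit) simp
    then show ?thesis using False by (simp add: blinfun.scaleR_right field_simps)
  qed (simp add: blinfun.zero_right)
  then have "norm (T - J) \<le> r" using r by (intro norm_blinfun_bound) auto
  with J(1) show thesis by (rule that)
qed

section \<open>Gliding humps\<close>

text \<open>
  Along a subsequence, the variations of the \<open>\<mu> n\<close> can only concentrate near a finite set \<open>F\<close>, up to
  \<open>\<eta>\<close>. By induction on \<open>t\<close>: put \<open>t\<close> into \<open>F\<close> and choose an interval below \<open>t\<close> that is
  asymptotically unseen at level \<open>\<eta>/2\<close>; the rest is shorter and gets the other half of \<open>\<eta>\<close>.
\<close>

lemma unseen_off_finite_set: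
  fixes t :: "'a::{wellorder, linorder_topology}"
    and \<mu> :: "nat \<Rightarrow> ('a \<Rightarrow>\<^sub>C 'k::real_normed_field) \<Rightarrow> 'k"
  assumes \<mu>: "\<And>n. functional (\<mu> n) C" and M: "infinite M" and \<eta>: "0 < \<eta>"
  shows "\<exists>M' F. M' \<subseteq> M \<and> infinite M' \<and> finite F \<and>
    (\<forall>G. clopen G \<longrightarrow> G \<subseteq> {..t} \<longrightarrow> G \<inter> F = {} \<longrightarrow> finite {n \<in> M'. sees (\<mu> n) G \<eta>})"
  using M \<eta>
proof (induction t arbitrary: M \<eta> rule: less_induct)
  case (less t)
  show ?case
  proof (cases "\<exists>y. y < t")
    case False
    have "\<not> sees (\<mu> n) {} \<eta>" for n
    proof
      assume "sees (\<mu> n) {} \<eta>"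
      then obtain f :: "'a \<Rightarrow>\<^sub>C 'k" where f: "\<forall>x. apply_bcontfun f x = 0" "\<eta> < norm (\<mu> n f)" by (auto simp: sees_def)
      then have "f = 0" by (intro bcontfun_eqI) simp
      then show False using f(2) less.prems functionalD(4)[OF \<mu>[of n]] by simp
    qed
    note unseen_empty = this
    have "finite {n \<in> M. sees (\<mu> n) G \<eta>}" if G: "G \<subseteq> {..t}" "G \<inter> {t} = {}" for G
    proof -
      have "G = {}" using G False by (auto simp: not_less dest: antisym)
      then show ?thesis using unseen_empty by simp
    qed
    then show ?thesis using less.prems(1) by (intro exI[of _ M] exI[of _ "{t}"]) auto
  next
    case True
    then obtain y where y: "y < t" by blast
    have \<eta>2: "0 < \<eta> / 2" using less.prems by simp
    obtain b M1 where b: "b < t" "M1 \<subseteq> M" "infinite M1"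
      "\<forall>c<t. finite {n \<in> M1. sees (\<mu> n) {b<..c} (\<eta> / 2)}"
      using unseen_intervals[where \<mu> = \<mu>, OF \<mu> less.prems(1) \<eta>2 y] .
    obtain M2 F where F: "M2 \<subseteq> M1" "infinite M2" "finite F"
      "\<And>G. clopen G \<Longrightarrow> G \<subseteq> {..b} \<Longrightarrow> G \<inter> F = {} \<Longrightarrow> finite {n \<in> M2. sees (\<mu> n) G (\<eta> / 2)}"
      using less.IH[OF b(1,3) \<eta>2] by blast
    have "finite {n \<in> M2. sees (\<mu> n) G \<eta>}" if G: "clopen G" "G \<subseteq> {..t}" "G \<inter> insert t F = {}" for G
    proof -
      have "open (- G)" "t \<in> - G" using G by (auto simp: clopen_def)
      then obtain c where c: "b \<le> c" "c < t" "{c<..t} \<subseteq> - G" using b(1) by (metis left_neighbourhood)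
      have "sees (\<mu> n) (G \<inter> {..b}) (\<eta> / 2) \<or> sees (\<mu> n) {b<..c} (\<eta> / 2)" if n: "sees (\<mu> n) G \<eta>" for n
      proof -
        obtain f :: "'a \<Rightarrow>\<^sub>C 'k" where f: "norm f \<le> 1" "\<forall>x. x \<notin> G \<longrightarrow> apply_bcontfun f x = 0" "\<eta> < norm (\<mu> n f)"
          using n by (auto simp: sees_def)
        let ?f1 = "blinfun_apply (proj {..b}) f" and ?f2 = "blinfun_apply (proj {b<..c}) f"
        have f0: "apply_bcontfun f x = 0" if "c < x" for x
        proof -
          have "x \<notin> G" using c(3) G(2) that by (cases "x \<le> t") auto
          then show ?thesis using f(2) by blast
        qed
        have "f = ?f1 + ?f2"
        proof (rule bcontfun_eqI)
          fix x
          show "apply_bcontfun f x = apply_bcontfun (?f1 + ?f2) x"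
            using f0[of x] c(1) by (cases "x \<le> b"; cases "x \<le> c") (auto simp: continuous_on_id not_le)
        qed
        then have "\<mu> n f = \<mu> n ?f1 + \<mu> n ?f2" using functionalD(1)[OF \<mu>, of n ?f1 ?f2] by simp
        then have "\<eta> < norm (\<mu> n ?f1) + norm (\<mu> n ?f2)" using f(3) norm_triangle_ineq by (metis less_le_trans)
        then have "\<eta> / 2 < norm (\<mu> n ?f1) \<or> \<eta> / 2 < norm (\<mu> n ?f2)" by argo
        moreover have "norm ?f1 \<le> 1" "norm ?f2 \<le> 1"
          using order_trans[OF norm_bounded f(1)] by (auto intro!: norm_bound simp: continuous_on_id)
        moreover have "\<forall>x. x \<notin> G \<inter> {..b} \<longrightarrow> apply_bcontfun ?f1 x = 0" using f(2) by (simp add: continuous_on_id)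
        moreover have "\<forall>x. x \<notin> {b<..c} \<longrightarrow> apply_bcontfun ?f2 x = 0" by (simp add: continuous_on_id)
        ultimately show ?thesis unfolding sees_def by blast
      qed
      then have "{n \<in> M2. sees (\<mu> n) G \<eta>} \<subseteq> {n \<in> M2. sees (\<mu> n) (G \<inter> {..b}) (\<eta> / 2)} \<union> {n \<in> M1. sees (\<mu> n) {b<..c} (\<eta> / 2)}"
        using F(1) by blast
      moreover have "finite {n \<in> M2. sees (\<mu> n) (G \<inter> {..b}) (\<eta> / 2)}"
        by (rule F(4)) (use G in auto)
      ultimately show ?thesis using b(4)[rule_format, OF c(2)] by (meson finite_UnI finite_subset)
    qed
    then show ?thesis
      using F b by (intro exI[of _ M2] exI[of _ "insert t F"]) auto
  qed
qed

text \<open>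
  Write \<open>f n\<close> as the sum of its restriction off a neighbourhood \<open>EE\<close> of \<open>F\<close>, a locally constant
  function \<open>h\<close> that has the same values on \<open>F\<close>, and a rest \<open>g0\<close> that vanishes on \<open>F\<close>. For large \<open>n\<close>
  the first part is unseen and \<open>\<mu> n h\<close> is small, as the \<open>\<mu> n\<close> tend to zero at the finitely many
  indicators involved. So \<open>\<mu> n g0\<close> is large, and \<open>g0\<close> may be cut off near \<open>F\<close>. The neighbourhood
  \<open>EE\<close> avoids the set \<open>G\<close> that previous humps occupy.
\<close>

lemma hump_step:
  fixes \<mu> :: "nat \<Rightarrow> ('a::{wellorder, linorder_topology} \<Rightarrow>\<^sub>C 'k::real_normed_field) \<Rightarrow> 'k"
  assumes \<mu>: "\<And>n. functional (\<mu> n) C" and null: "\<And>f. (\<lambda>n. \<mu> n f) \<longlonglongrightarrow> 0"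
    and f: "\<And>n. norm (f n) \<le> 1" "\<And>n. r < norm (\<mu> n (f n))" and r: "0 < r"
    and M: "infinite M" and F: "finite F"
    and unseen: "\<And>G. clopen G \<Longrightarrow> G \<inter> F = {} \<Longrightarrow> finite {n \<in> M. sees (\<mu> n) G (r / 4)}"
    and G: "clopen G" "G \<inter> F = {}"
  obtains n G' g where "N < n" "clopen G'" "G' \<inter> F = {}" "G' \<inter> G = {}" "norm g \<le> 2"
    "\<forall>x. x \<notin> G' \<longrightarrow> apply_bcontfun g x = 0" "r / 4 \<le> norm (\<mu> n g)"
proof -
  \<comment> \<open>Cutting at the points of \<open>F\<close> makes these neighbourhoods of the points \<open>p\<close> disjoint.\<close>
  define E where "E p = {..p} - (\<Union>q\<in>{q \<in> F. q < p}. {..q}) - G" for p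
  have E: "clopen (E p)" for p unfolding E_def using F G(1) by (intro clopen_basic clopen_UN clopen_intervals) auto
  have E_disj: "p = q" if "x \<in> E p" "x \<in> E q" "p \<in> F" "q \<in> F" for p q x
    using that unfolding E_def by (cases p q rule: linorder_cases) auto
  have pE: "p \<in> E p" if "p \<in> F" for p using that G(2) unfolding E_def by (auto simp: not_le[symmetric])
  define EE where "EE = (\<Union>p\<in>F. E p)"
  have EE: "clopen EE" unfolding EE_def using F E by blast
  have FE: "F \<subseteq> EE" unfolding EE_def using pE by blast
  have "(\<lambda>n. \<Sum>p\<in>F. norm (\<mu> n (ind (E p)))) \<longlonglongrightarrow> (\<Sum>p\<in>F. norm (0 :: 'k))"
    by (intro tendsto_sum tendsto_norm null)
  then have "eventually (\<lambda>n. (\<Sum>p\<in>F. norm (\<mu> n (ind (E p)))) < r / 4) sequentially"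
    using r by (intro order_tendstoD(2)) auto
  then obtain N1 where N1: "\<And>n. N1 \<le> n \<Longrightarrow> (\<Sum>p\<in>F. norm (\<mu> n (ind (E p)))) < r / 4"
    by (auto simp: eventually_sequentially)
  have "finite {n \<in> M. sees (\<mu> n) (- EE) (r / 4)}" using EE FE by (intro unseen) auto
  then have "infinite (M - {n \<in> M. sees (\<mu> n) (- EE) (r / 4)} - {..max N N1})"
    using M by (intro Diff_infinite_finite) auto
  then obtain n where "n \<in> M - {n \<in> M. sees (\<mu> n) (- EE) (r / 4)} - {..max N N1}"
    using infinite_imp_nonempty by blast
  then have n: "N < n" "N1 < n" "\<not> sees (\<mu> n) (- EE) (r / 4)" by auto
  note fD = functionalD[OF \<mu>[of n]]
  define h where "h = (\<Sum>p\<in>F. scale_bcontfun (f n p) (ind (E p)))"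
  have h_apply: "apply_bcontfun h x = (\<Sum>p\<in>F. f n p * (if x \<in> E p then 1 else 0))" for x
  proof -
    have "apply_bcontfun (\<Sum>p\<in>S. scale_bcontfun (f n p) (ind (E p))) x
      = (\<Sum>p\<in>S. f n p * (if x \<in> E p then 1 else 0))" for S
      by (induction S rule: infinite_finite_induct) (auto simp: E)
    then show ?thesis by (simp add: h_def)
  qed
  have h: "apply_bcontfun h x = (if x \<in> EE then f n (THE p. p \<in> F \<and> x \<in> E p) else 0)" for x
  proof (cases "x \<in> EE")
    case True
    then obtain p where p: "p \<in> F" "x \<in> E p" unfolding EE_def by blast
    have "(THE p. p \<in> F \<and> x \<in> E p) = p" using p E_disj by blast
    moreover have "apply_bcontfun h x = (\<Sum>q\<in>F. if q = p then f n p else 0)"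
      unfolding h_apply using p E_disj by (intro sum.cong) auto
    ultimately show ?thesis using True p(1) F by simp
  next
    case False
    then show ?thesis unfolding h_apply EE_def by (auto intro!: sum.neutral)
  qed
  define g0 where "g0 = blinfun_apply (proj EE) (f n) - h"
  have g0: "apply_bcontfun g0 x = (if x \<in> EE then f n x - f n (THE p. p \<in> F \<and> x \<in> E p) else 0)" for x
    by (simp add: g0_def h EE continuous_on_id)
  have g0F: "apply_bcontfun g0 p = 0" if "p \<in> F" for p
  proof -
    have "(THE q. q \<in> F \<and> p \<in> E q) = p" using that E_disj pE by blast
    then show ?thesis by (simp add: g0)
  qed
  have g0_norm: "norm (apply_bcontfun g0 x) \<le> 2" for x
    unfolding g0 using norm_triangle_ineq4[of "f n x"] order_trans[OF norm_bounded f(1)]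
    by (smt (verit) norm_zero)
  have "\<mu> n h = (\<Sum>p\<in>F. f n p * \<mu> n (ind (E p)))"
  proof -
    have "\<mu> n (\<Sum>p\<in>S. scale_bcontfun (f n p) (ind (E p))) = (\<Sum>p\<in>S. f n p * \<mu> n (ind (E p)))" for S
      by (induction S rule: infinite_finite_induct) (auto simp: fD)
    then show ?thesis by (simp add: h_def)
  qed
  also have "norm \<dots> \<le> (\<Sum>p\<in>F. 1 * norm (\<mu> n (ind (E p))))"
    by (rule sum_norm_le)
      (auto simp: norm_mult intro!: mult_left_le_one_le order_trans[OF norm_bounded f(1)])
  also have "\<dots> < r / 4" using N1[of n] n by simp
  finally have \<mu>h: "norm (\<mu> n h) < r / 4" .
  have \<mu>off: "norm (\<mu> n (blinfun_apply (proj (- EE)) (f n))) \<le> r / 4"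
  proof (rule ccontr)
    assume "\<not> ?thesis"
    then have "sees (\<mu> n) (- EE) (r / 4)" unfolding sees_def
      using EE order_trans[OF norm_bounded f(1)]
      by (intro exI[of _ "blinfun_apply (proj (- EE)) (f n)"]) (auto intro!: norm_bound simp: continuous_on_id)
    then show False using n by simp
  qed
  have "f n = (blinfun_apply (proj (- EE)) (f n) + h) + g0"
    by (rule bcontfun_eqI) (use EE in \<open>auto simp: g0_def continuous_on_id\<close>)
  then have "\<mu> n (f n) = (\<mu> n (blinfun_apply (proj (- EE)) (f n)) + \<mu> n h) + \<mu> n g0"
    by (metis fD(1))
  then have "norm (\<mu> n (f n)) \<le> norm (\<mu> n (blinfun_apply (proj (- EE)) (f n))) + norm (\<mu> n h) + norm (\<mu> n g0)"
    by (metis norm_triangle_le norm_triangle_ineq add_right_mono)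
  then have \<mu>g0: "r / 2 < norm (\<mu> n g0)" using f(2)[of n] \<mu>off \<mu>h by argo
  define \<eta> where "\<eta> = r / (4 * (\<bar>C\<bar> + 1))"
  have \<eta>: "0 < \<eta>" "\<bar>C\<bar> * \<eta> \<le> r / 4"
    using r by (auto simp: \<eta>_def field_simps add_nonneg_pos)
  have "\<exists>W. clopen W \<and> p \<in> W \<and> (\<forall>x\<in>W. norm (apply_bcontfun g0 x) \<le> \<eta>)" if "p \<in> F" for p
  proof -
    have "open (apply_bcontfun g0 -` ball 0 \<eta>)" by (rule open_vimage) auto
    moreover have "p \<in> apply_bcontfun g0 -` ball 0 \<eta>" using g0F[OF that] \<eta> by simp
    ultimately obtain W where "clopen W" "p \<in> W" "W \<subseteq> apply_bcontfun g0 -` ball 0 \<eta>" by (rule clopen_base)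
    then show ?thesis by (intro exI[of _ W]) (auto simp: subset_iff less_imp_le)
  qed
  then obtain W where W: "\<And>p. p \<in> F \<Longrightarrow> clopen (W p) \<and> p \<in> W p \<and> (\<forall>x\<in>W p. norm (apply_bcontfun g0 x) \<le> \<eta>)"
    by metis
  define G' where "G' = EE - (\<Union>p\<in>F. W p)"
  have G': "clopen G'" unfolding G'_def using F W EE by (intro clopen_basic clopen_UN) auto
  define g where "g = blinfun_apply (proj G') g0"
  have "norm (g0 - g) \<le> \<eta>"
  proof (rule norm_bound)
    fix x
    show "norm (apply_bcontfun (g0 - g) x) \<le> \<eta>"
    proof (cases "x \<in> EE \<and> x \<notin> G'")
      case True
      then obtain p where "p \<in> F" "x \<in> W p" unfolding G'_def by blast
      then show ?thesis using W True by (simp add: g_def G' continuous_on_id)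
    next
      case False
      then have "apply_bcontfun (g0 - g) x = 0" by (auto simp: g_def g0 G' continuous_on_id)
      then show ?thesis using \<eta> by simp
    qed
  qed
  then have "norm (\<mu> n (g0 - g)) \<le> \<bar>C\<bar> * \<eta>"
    using fD(3)[of "g0 - g"] by (smt (verit) mult_mono norm_ge_zero)
  then have "norm (\<mu> n g0 - \<mu> n g) \<le> r / 4" using \<eta>(2) by (simp add: fD)
  then have "r / 4 \<le> norm (\<mu> n g)" using \<mu>g0 norm_triangle_ineq2[of "\<mu> n g0" "\<mu> n g"] by simp
  moreover have "norm g \<le> 2" using g0_norm by (intro norm_bound) (auto simp: g_def G' continuous_on_id)
  moreover have "\<forall>x. x \<notin> G' \<longrightarrow> apply_bcontfun g x = 0" by (simp add: g_def G' continuous_on_id)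
  moreover have "G' \<inter> F = {}" unfolding G'_def using W by blast
  moreover have "G' \<inter> G = {}" unfolding G'_def EE_def E_def by blast
  ultimately show thesis using that n(1) G' by blast
qed

text \<open>
  Iterate \<open>hump_step\<close>; the set \<open>G\<close> collects the supports of the humps chosen so far.
\<close>

lemma gliding_hump:
  fixes \<mu> :: "nat \<Rightarrow> ('a::{wellorder, linorder_topology} \<Rightarrow>\<^sub>C 'k::real_normed_field) \<Rightarrow> 'k"
  assumes top: "(UNIV :: 'a set) = {..\<alpha>}"
    and \<mu>: "\<And>n. functional (\<mu> n) C" and null: "\<And>f. (\<lambda>n. \<mu> n f) \<longlonglongrightarrow> 0"
    and f: "\<And>n. norm (f n) \<le> 1" "\<And>n. r < norm (\<mu> n (f n))" and r: "0 < r"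
  obtains g :: "nat \<Rightarrow> 'a \<Rightarrow>\<^sub>C 'k" and \<nu> :: "nat \<Rightarrow> nat" where "strict_mono \<nu>" "\<forall>k. norm (g k) \<le> 2"
    "\<forall>j k x. j \<noteq> k \<longrightarrow> apply_bcontfun (g j) x = 0 \<or> apply_bcontfun (g k) x = 0"
    "\<forall>k. r / 4 \<le> norm (\<mu> (\<nu> k) (g k))"
proof -
  obtain M F where M: "infinite (M :: nat set)" and F: "finite F"
    and uns: "\<And>G. clopen G \<Longrightarrow> G \<subseteq> {..\<alpha>} \<Longrightarrow> G \<inter> F = {} \<Longrightarrow> finite {n \<in> M. sees (\<mu> n) G (r / 4)}"
  proof -
    have "\<exists>M F. M \<subseteq> UNIV \<and> infinite M \<and> finite F \<and> (\<forall>G. clopen G \<longrightarrow> G \<subseteq> {..\<alpha>} \<longrightarrow> G \<inter> F = {} \<longrightarrow>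
        finite {n \<in> M. sees (\<mu> n) G (r / 4)})"
      by (rule unseen_off_finite_set[OF \<mu>]) (use r in auto)
    then show thesis using that by blast
  qed
  have unseen: "finite {n \<in> M. sees (\<mu> n) G (r / 4)}" if "clopen G" "G \<inter> F = {}" for G
    using uns[OF that(1) _ that(2)] top by blast
  define P where "P = (\<lambda>(n :: nat, G, h :: 'a \<Rightarrow>\<^sub>C 'k). clopen G \<and> G \<inter> F = {} \<and> norm h \<le> 2
    \<and> (\<forall>x. x \<notin> G \<longrightarrow> apply_bcontfun h x = 0) \<and> r / 4 \<le> norm (\<mu> n h))"
  define Q where "Q = (\<lambda>(n :: nat, G, h :: 'a \<Rightarrow>\<^sub>C 'k) (n', G', h' :: 'a \<Rightarrow>\<^sub>C 'k). n < n' \<and> G \<subseteq> G' \<and> (\<forall>x\<in>G. apply_bcontfun h' x = 0))"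
  have step: "\<exists>n' G' h'. P (n', G', h') \<and> N < n' \<and> G \<subseteq> G' \<and> (\<forall>x\<in>G. apply_bcontfun h' x = 0)"
    if G: "clopen G" "G \<inter> F = {}" for N G
  proof -
    obtain n G' g where "N < n" "clopen G'" "G' \<inter> F = {}" "G' \<inter> G = {}" "norm g \<le> 2"
      "\<forall>x. x \<notin> G' \<longrightarrow> apply_bcontfun g x = 0" "r / 4 \<le> norm (\<mu> n g)"
      using hump_step[where \<mu> = \<mu> and f = f and N = N, OF \<mu> null f r M F unseen G] .
    then show ?thesis using G unfolding P_def
      by (intro exI[of _ n] exI[of _ "G \<union> G'"] exI[of _ g]) auto
  qed
  have "\<exists>S. \<forall>k. P (S k) \<and> Q (S k) (S (Suc k))"
  proof (rule dependent_nat_choice)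
    show "\<exists>x. P x" using step[of "{}" 0] by auto
    fix x and k :: nat assume "P x"
    then show "\<exists>y. P y \<and> Q x y" using step[of "fst (snd x)" "fst x"] by (auto simp: P_def Q_def split: prod.splits)
  qed
  then obtain S where S: "\<And>k. P (S k)" "\<And>k. Q (S k) (S (Suc k))" by blast
  define \<nu> where "\<nu> k = fst (S k)" for k
  define G where "G k = fst (snd (S k))" for k
  define g where "g k = snd (snd (S k))" for k
  have P: "norm (g k) \<le> 2" "x \<notin> G k \<Longrightarrow> apply_bcontfun (g k) x = 0" "r / 4 \<le> norm (\<mu> (\<nu> k) (g k))" for k x
    using S(1)[of k] by (auto simp: P_def \<nu>_def G_def g_def split: prod.splits)
  have Q: "\<nu> k < \<nu> (Suc k)" "G k \<subseteq> G (Suc k)" "x \<in> G k \<Longrightarrow> apply_bcontfun (g (Suc k)) x = 0" for k x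
    using S(2)[of k] by (auto simp: Q_def \<nu>_def G_def g_def split: prod.splits)
  have G_mono: "G j \<subseteq> G k" if "j \<le> k" for j k using lift_Suc_mono_le[of G j k] Q(2) that by blast
  have disj: "apply_bcontfun (g j) x = 0 \<or> apply_bcontfun (g k) x = 0" if "j < k" for j k x
  proof (cases "x \<in> G j")
    case True
    obtain k' where k': "k = Suc k'" "j \<le> k'" using \<open>j < k\<close> by (cases k) (auto simp: less_Suc_eq_le)
    then show ?thesis using True G_mono[of j k'] Q(3)[of x k'] by blast
  qed (use P(2) in blast)
  show thesis
  proof (rule that)
    show "strict_mono \<nu>" using Q(1) by (simp add: strict_mono_Suc_iff)
    show "\<forall>j k x. j \<noteq> k \<longrightarrow> apply_bcontfun (g j) x = 0 \<or> apply_bcontfun (g k) x = 0"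
      using disj by (meson linorder_neqE_nat)
  qed (use P in auto)
qed

section \<open>Factoring idempotents through non-compact operators\<close>

text \<open>
  Choose the next index so far out that the columns already used are small there, and that the row
  just chosen has a small tail from there on.
\<close>

lemma almost_diagonal_subsequence:
  fixes a :: "nat \<Rightarrow> nat \<Rightarrow> real"
  assumes nonneg: "\<And>k m. 0 \<le> a k m" and col: "\<And>m. (\<lambda>k. a k m) \<longlonglongrightarrow> 0" and row: "\<And>k. summable (a k)"
    and \<delta>: "0 < \<delta>"
  obtains \<rho> :: "nat \<Rightarrow> nat" where "strict_mono \<rho>"
    "\<forall>k S. finite S \<longrightarrow> k \<notin> S \<longrightarrow> (\<Sum>m\<in>S. a (\<rho> k) (\<rho> m)) \<le> \<delta>"
proof -
  have "\<exists>N>k. (\<forall>k'\<ge>N. (\<Sum>m\<le>k. a k' m) \<le> \<delta> / 2)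
      \<and> (\<forall>S. finite S \<longrightarrow> S \<subseteq> {N..} \<longrightarrow> (\<Sum>m\<in>S. a k m) \<le> \<delta> / 2)" for k
  proof -
    have "(\<lambda>k'. \<Sum>m\<le>k. a k' m) \<longlonglongrightarrow> (\<Sum>m\<le>k. 0)" by (intro tendsto_sum col)
    then have "eventually (\<lambda>k'. (\<Sum>m\<le>k. a k' m) < \<delta> / 2) sequentially"
      using \<delta> by (intro order_tendstoD(2)) auto
    then obtain N1 where N1: "\<And>k'. N1 \<le> k' \<Longrightarrow> (\<Sum>m\<le>k. a k' m) < \<delta> / 2"
      by (auto simp: eventually_sequentially)
    obtain N2 where N2: "\<And>m n. N2 \<le> m \<Longrightarrow> norm (sum (a k) {m..<n}) < \<delta> / 2"
      using row[of k] \<delta> unfolding summable_Cauchy by (meson half_gt_zero)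
    define N where "N = max (Suc k) (max N1 N2)"
    have "(\<Sum>m\<in>S. a k m) \<le> \<delta> / 2" if S: "finite S" "S \<subseteq> {N..}" for S
    proof -
      have "S \<subseteq> {N..<Suc (Max S)}" using S by (auto simp: less_Suc_eq_le)
      then have "(\<Sum>m\<in>S. a k m) \<le> (\<Sum>m\<in>{N..<Suc (Max S)}. a k m)"
        using nonneg by (intro sum_mono2) auto
      moreover have "norm (sum (a k) {N..<Suc (Max S)}) < \<delta> / 2" by (rule N2) (simp add: N_def)
      ultimately show ?thesis unfolding real_norm_def by linarith
    qed
    moreover have "\<forall>k'\<ge>N. (\<Sum>m\<le>k. a k' m) \<le> \<delta> / 2"
      using N1 by (auto simp: N_def intro: less_imp_le)
    moreover have "k < N" by (simp add: N_def)
    ultimately show ?thesis by blast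
  qed
  then obtain N where N: "\<And>k. k < N k" "\<And>k k'. N k \<le> k' \<Longrightarrow> (\<Sum>m\<le>k. a k' m) \<le> \<delta> / 2"
    "\<And>k S. finite S \<Longrightarrow> S \<subseteq> {N k..} \<Longrightarrow> (\<Sum>m\<in>S. a k m) \<le> \<delta> / 2" by metis
  define \<rho> where "\<rho> = rec_nat 0 (\<lambda>_. N)"
  have \<rho>S: "\<rho> (Suc k) = N (\<rho> k)" for k by (simp add: \<rho>_def)
  have mono: "strict_mono \<rho>" by (simp add: strict_mono_Suc_iff \<rho>S N(1))
  have "(\<Sum>m\<in>S. a (\<rho> k) (\<rho> m)) \<le> \<delta>" if S: "finite S" "k \<notin> S" for k S
  proof -
    have inj: "inj_on \<rho> A" for A using mono strict_mono_imp_inj_on by blast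
    have "m < k \<or> k < m" if "m \<in> S" for m using S(2) that by (metis linorder_neqE_nat)
    then have "S = {m \<in> S. m < k} \<union> {m \<in> S. k < m}" by blast
    then have "(\<Sum>m\<in>S. a (\<rho> k) (\<rho> m)) = (\<Sum>m\<in>{m \<in> S. m < k} \<union> {m \<in> S. k < m}. a (\<rho> k) (\<rho> m))" by simp
    also have "\<dots> = (\<Sum>m\<in>{m \<in> S. m < k}. a (\<rho> k) (\<rho> m)) + (\<Sum>m\<in>{m \<in> S. k < m}. a (\<rho> k) (\<rho> m))"
      using S(1) by (intro sum.union_disjoint) auto
    also have "(\<Sum>m\<in>{m \<in> S. m < k}. a (\<rho> k) (\<rho> m)) \<le> \<delta> / 2"
    proof (cases k)
      case 0
      then show ?thesis using \<delta> by simp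
    next
      case (Suc k')
      have "(\<Sum>m\<in>{m \<in> S. m < k}. a (\<rho> k) (\<rho> m)) = (\<Sum>m\<in>\<rho> ` {m \<in> S. m < k}. a (\<rho> k) m)"
        by (simp add: sum.reindex[OF inj])
      also have "\<dots> \<le> (\<Sum>m\<le>\<rho> k'. a (\<rho> k) m)"
        using nonneg strict_mono_less_eq[OF mono] Suc by (intro sum_mono2) (auto simp: less_Suc_eq_le)
      also have "\<dots> \<le> \<delta> / 2" by (rule N(2)) (simp add: Suc \<rho>S)
      finally show ?thesis .
    qed
    also have "(\<Sum>m\<in>{m \<in> S. k < m}. a (\<rho> k) (\<rho> m)) = (\<Sum>m\<in>\<rho> ` {m \<in> S. k < m}. a (\<rho> k) m)"
      by (simp add: sum.reindex[OF inj])
    also have "\<dots> \<le> \<delta> / 2"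
    proof (rule N(3))
      show "\<rho> ` {m \<in> S. k < m} \<subseteq> {N (\<rho> k)..}"
        using strict_mono_less_eq[OF mono] by (auto simp: \<rho>S[symmetric] Suc_le_eq)
    qed (use S in simp)
    finally show ?thesis by simp
  qed
  with mono show thesis by (intro that) auto
qed

definition disjoint_family :: "(nat \<Rightarrow> 'a::topological_space \<Rightarrow>\<^sub>C 'k::real_normed_field) \<Rightarrow> bool" where
  "disjoint_family f \<longleftrightarrow> (\<forall>j k x. j \<noteq> k \<longrightarrow> apply_bcontfun (f j) x = 0 \<or> apply_bcontfun (f k) x = 0)"

lemma sum_apply_bcontfun: "apply_bcontfun (\<Sum>k\<in>S. f k) x = (\<Sum>k\<in>S. apply_bcontfun (f k) x)"
  for f :: "'i \<Rightarrow> 'a::topological_space \<Rightarrow>\<^sub>C 'b::real_normed_vector"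
  by (induction S rule: infinite_finite_induct) auto

lemma norm_disjoint_sum_le:
  fixes f :: "nat \<Rightarrow> 'a::topological_space \<Rightarrow>\<^sub>C 'k::real_normed_field"
  assumes disj: "disjoint_family f" and fB: "\<And>k. norm (f k) \<le> B"
    and c: "\<And>k. k \<in> S \<Longrightarrow> norm (c k) \<le> K" and K: "0 \<le> K"
  shows "norm (\<Sum>k\<in>S. scale_bcontfun (c k) (f k)) \<le> K * B"
proof (rule norm_bound)
  fix x
  have B: "0 \<le> B" using fB[of 0] norm_ge_zero order_trans by blast
  show "norm (apply_bcontfun (\<Sum>k\<in>S. scale_bcontfun (c k) (f k)) x) \<le> K * B"
  proof (cases "finite S \<and> (\<exists>k\<in>S. apply_bcontfun (f k) x \<noteq> 0)")
    case True
    then obtain k where k: "k \<in> S" "apply_bcontfun (f k) x \<noteq> 0" by blast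
    have "apply_bcontfun (\<Sum>k\<in>S. scale_bcontfun (c k) (f k)) x
        = (\<Sum>j\<in>S. if j = k then c k * apply_bcontfun (f k) x else 0)"
      unfolding sum_apply_bcontfun using disj k(2)
      by (intro sum.cong) (auto simp: disjoint_family_def)
    also have "\<dots> = c k * apply_bcontfun (f k) x" using True k(1) by simp
    also have "norm \<dots> \<le> K * B"
      unfolding norm_mult using c[OF k(1)] K order_trans[OF norm_bounded fB] by (intro mult_mono) auto
    finally show ?thesis .
  next
    case False
    then have "apply_bcontfun (\<Sum>k\<in>S. scale_bcontfun (c k) (f k)) x = 0"
      unfolding sum_apply_bcontfun by (cases "finite S") (auto intro!: sum.neutral)
    then show ?thesis using K B by simp
  qed
qed

lemma summable_disjoint:
  fixes f :: "nat \<Rightarrow> 'a::topological_space \<Rightarrow>\<^sub>C 'k::{real_normed_field, banach}"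
  assumes disj: "disjoint_family f" and fB: "\<And>k. norm (f k) \<le> B" and c: "c \<longlonglongrightarrow> 0"
  shows "summable (\<lambda>k. scale_bcontfun (c k) (f k))"
  unfolding summable_Cauchy
proof (intro allI impI)
  fix e :: real assume e: "0 < e"
  have B: "0 \<le> B" using fB[of 0] norm_ge_zero order_trans by blast
  define e' where "e' = e / (2 * (B + 1))"
  have e': "0 < e'" "e' * B < e"
    using e B by (auto simp: e'_def field_simps add_nonneg_pos)
  have "eventually (\<lambda>k. norm (c k) < e') sequentially"
    using tendsto_norm[OF c] e'(1) by (intro order_tendstoD(2)) auto
  then obtain N where N: "\<And>k. N \<le> k \<Longrightarrow> norm (c k) < e'" by (auto simp: eventually_sequentially)
  have "norm (\<Sum>k\<in>{m..<n}. scale_bcontfun (c k) (f k)) < e" if "N \<le> m" for m n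
  proof -
    have "norm (\<Sum>k\<in>{m..<n}. scale_bcontfun (c k) (f k)) \<le> e' * B"
      using N that e'(1) by (intro norm_disjoint_sum_le[OF disj fB]) (auto intro: less_imp_le)
    then show ?thesis using e'(2) by simp
  qed
  then show "\<exists>N. \<forall>m\<ge>N. \<forall>n. norm (\<Sum>k\<in>{m..<n}. scale_bcontfun (c k) (f k)) < e" by blast
qed

lemma norm_disjoint_sums_le:
  fixes f :: "nat \<Rightarrow> 'a::topological_space \<Rightarrow>\<^sub>C 'k::real_normed_field"
  assumes disj: "disjoint_family f" and fB: "\<And>k. norm (f k) \<le> B"
    and c: "\<And>k. norm (c k) \<le> K" and sums: "(\<lambda>k. scale_bcontfun (c k) (f k)) sums g"
  shows "norm g \<le> K * B"
proof (rule LIMSEQ_le_const2)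
  show "(\<lambda>n. norm (\<Sum>k<n. scale_bcontfun (c k) (f k))) \<longlonglongrightarrow> norm g"
    using sums unfolding sums_def by (rule tendsto_norm)
  have "0 \<le> K" using c[of 0] norm_ge_zero order_trans by blast
  then show "\<exists>N. \<forall>n\<ge>N. norm (\<Sum>k<n. scale_bcontfun (c k) (f k)) \<le> K * B"
    using norm_disjoint_sum_le[OF disj fB] c by blast
qed

text \<open>
  Composition of the map of \<open>C(K)\<close> into the null sequences that is given by a convergent sequence of
  points, and of the embedding of the null sequences that is given by disjoint functions.
\<close>

definition block_op :: "(nat \<Rightarrow> 'a) \<Rightarrow> 'a \<Rightarrow> (nat \<Rightarrow> 'a \<Rightarrow>\<^sub>C 'k) \<Rightarrow>
    ('a::topological_space \<Rightarrow>\<^sub>C 'k::{real_normed_field, banach}) \<Rightarrow>\<^sub>L ('a \<Rightarrow>\<^sub>C 'k)" where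
  "block_op s s' f = Blinfun (\<lambda>g. \<Sum>k. scale_bcontfun (apply_bcontfun g (s k) - apply_bcontfun g s') (f k))"

context
  fixes s :: "nat \<Rightarrow> 'a::topological_space" and s'
    and f :: "nat \<Rightarrow> 'a \<Rightarrow>\<^sub>C 'k::{real_normed_field, banach}" and B
  assumes s: "\<And>g :: 'a \<Rightarrow>\<^sub>C 'k. (\<lambda>k. apply_bcontfun g (s k)) \<longlonglongrightarrow> apply_bcontfun g s'"
    and disj: "disjoint_family f" and fB: "\<And>k. norm (f k) \<le> B"
begin

lemma norm_coefficient: "norm (apply_bcontfun g x - apply_bcontfun g y) \<le> 2 * norm g"
  for g :: "'a \<Rightarrow>\<^sub>C 'k"
  using norm_triangle_ineq4[of "apply_bcontfun g x" "apply_bcontfun g y"] norm_bounded[of g x] norm_bounded[of g y]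
  by simp

lemma summable_block: "summable (\<lambda>k. scale_bcontfun (apply_bcontfun g (s k) - apply_bcontfun g s') (f k))"
  using s[of g] by (intro summable_disjoint[OF disj fB]) (simp add: LIM_zero)

lemma bounded_linear_block:
  "bounded_linear (\<lambda>g. \<Sum>k. scale_bcontfun (apply_bcontfun g (s k) - apply_bcontfun g s') (f k))"
proof (rule bounded_linear_intro[where K = "2 * B"])
  fix g h :: "'a \<Rightarrow>\<^sub>C 'k" and r :: real
  show "(\<Sum>k. scale_bcontfun (apply_bcontfun (g + h) (s k) - apply_bcontfun (g + h) s') (f k))
    = (\<Sum>k. scale_bcontfun (apply_bcontfun g (s k) - apply_bcontfun g s') (f k))
    + (\<Sum>k. scale_bcontfun (apply_bcontfun h (s k) - apply_bcontfun h s') (f k))"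
    unfolding suminf_add[OF summable_block summable_block]
    by (intro suminf_cong bcontfun_eqI) (simp add: algebra_simps)
  show "(\<Sum>k. scale_bcontfun (apply_bcontfun (r *\<^sub>R g) (s k) - apply_bcontfun (r *\<^sub>R g) s') (f k))
    = r *\<^sub>R (\<Sum>k. scale_bcontfun (apply_bcontfun g (s k) - apply_bcontfun g s') (f k))"
    unfolding suminf_scaleR_right[OF summable_block]
    by (intro suminf_cong bcontfun_eqI) (simp add: algebra_simps)
  have "norm (\<Sum>k. scale_bcontfun (apply_bcontfun g (s k) - apply_bcontfun g s') (f k)) \<le> (2 * norm g) * B"
    by (rule norm_disjoint_sums_le[OF disj fB norm_coefficient summable_sums[OF summable_block]])
  then show "norm (\<Sum>k. scale_bcontfun (apply_bcontfun g (s k) - apply_bcontfun g s') (f k)) \<le> norm g * (2 * B)"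
    by (simp add: algebra_simps)
qed

lemma block_op_sums:
  "(\<lambda>k. scale_bcontfun (apply_bcontfun g (s k) - apply_bcontfun g s') (f k)) sums blinfun_apply (block_op s s' f) g"
  unfolding block_op_def bounded_linear_Blinfun_apply[OF bounded_linear_block]
  by (rule summable_sums[OF summable_block])

lemma block_op_ops: "block_op s s' f \<in> ops"
  unfolding ops_iff
proof (intro allI)
  fix c and g :: "'a \<Rightarrow>\<^sub>C 'k"
  have "(\<lambda>k. scale_bcontfun c (scale_bcontfun (apply_bcontfun g (s k) - apply_bcontfun g s') (f k)))
    sums scale_bcontfun c (blinfun_apply (block_op s s' f) g)"
    by (rule bounded_linear.sums[OF bounded_linear_scale_bcontfun block_op_sums])
  with block_op_sums[of "scale_bcontfun c g"]
  show "blinfun_apply (block_op s s' f) (scale_bcontfun c g) = scale_bcontfun c (blinfun_apply (block_op s s' f) g)"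
    by (simp add: right_diff_distrib[symmetric] sums_unique2)
qed

lemma norm_block_op: "norm (block_op s s' f) \<le> 2 * B"
proof (rule norm_blinfun_bound)
  show "0 \<le> 2 * B" using order_trans[OF norm_ge_zero fB[of 0]] by simp
  show "norm (blinfun_apply (block_op s s' f) g) \<le> 2 * B * norm g" for g
    using norm_disjoint_sums_le[OF disj fB norm_coefficient block_op_sums] by (simp add: algebra_simps)
qed

lemma block_op_apply:
  "(\<lambda>k. (apply_bcontfun g (s k) - apply_bcontfun g s') * apply_bcontfun (f k) x)
     sums apply_bcontfun (blinfun_apply (block_op s s' f) g) x"
proof -
  have "bounded_linear (\<lambda>g :: 'a \<Rightarrow>\<^sub>C 'k. apply_bcontfun g x)"
    by (rule bounded_linear_intro[where K = 1]) (auto simp: norm_bounded scaleR_conv_of_real)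
  from bounded_linear.sums[OF this block_op_sums] show ?thesis by simp
qed

end

lemma sums_single_term:
  fixes h :: "nat \<Rightarrow> 'b::{comm_monoid_add, t2_space}"
  assumes "h sums l" "\<And>k. k \<noteq> j \<Longrightarrow> h k = 0"
  shows "l = h j"
proof -
  have "h = (\<lambda>k. if k = j then h k else 0)" using assms(2) by auto
  then have "h sums h j" using sums_single[of j h] by simp
  then show ?thesis using assms(1) sums_unique2 by blast
qed

context
  fixes s :: "nat \<Rightarrow> 'a::{wellorder, linorder_topology}" and s' :: 'a
  assumes s_mono: "strict_mono s" and s_less: "\<And>k. s k < s'" and s_sup: "\<And>u. u < s' \<Longrightarrow> \<exists>k. u < s k"
begin

lemma increasing_tendsto:
  fixes g :: "'a \<Rightarrow>\<^sub>C 'b::real_normed_vector"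
  shows "(\<lambda>k. apply_bcontfun g (s k)) \<longlonglongrightarrow> apply_bcontfun g s'"
proof (rule LIMSEQ_I)
  fix e :: real assume "0 < e"
  have "isCont (apply_bcontfun g) s'" using continuous_on_eq_continuous_at[of UNIV] by auto
  then obtain w where w: "w < s'" "\<And>x. w < x \<Longrightarrow> x \<le> s' \<Longrightarrow> norm (g x - g s') < e"
    using continuous_near[OF _ s_less[of 0] \<open>0 < e\<close>] by metis
  obtain k where "w < s k" using s_sup w(1) by blast
  then have "w < s n" if "k \<le> n" for n
    using strict_mono_less_eq[OF s_mono] that by (meson less_le_trans)
  then show "\<exists>N. \<forall>n\<ge>N. norm (g (s n) - g s') < e" using w(2) s_less by (meson less_imp_le)
qed

definition block :: "nat \<Rightarrow> 'a set" where
  "block k = {..s k} - (\<Union>j<k. {..s j})"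

lemma clopen_block [simp]: "clopen (block k)"
  unfolding block_def by (intro clopen_basic clopen_UN clopen_intervals) auto

lemma block_s: "s j \<in> block k \<longleftrightarrow> j = k"
  using strict_mono_less_eq[OF s_mono] by (auto simp: block_def not_le)

lemma block_s': "s' \<notin> block k"
  using s_less[of k] by (auto simp: block_def)

lemma block_disjoint: "x \<in> block j \<Longrightarrow> x \<in> block k \<Longrightarrow> j = k"
  by (cases j k rule: linorder_cases) (auto simp: block_def)

abbreviation block_ind :: "nat \<Rightarrow> 'a \<Rightarrow>\<^sub>C 'k::real_normed_field" where
  "block_ind k \<equiv> ind (block k)"

lemma disjoint_block_ind: "disjoint_family (\<lambda>k. scale_bcontfun (c k) (block_ind k))"
  using block_disjoint by (auto simp: disjoint_family_def)

lemma disjoint_block_ind': "disjoint_family block_ind"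
  using block_disjoint by (auto simp: disjoint_family_def)

lemma norm_block_ind: "norm (block_ind k :: 'a \<Rightarrow>\<^sub>C 'k::real_normed_field) \<le> 1"
  by (rule norm_bound) auto

text \<open>
  An idempotent whose range is a copy of the space of null sequences.
\<close>

definition block_proj :: "('a \<Rightarrow>\<^sub>C 'k::{real_normed_field, banach}) \<Rightarrow>\<^sub>L ('a \<Rightarrow>\<^sub>C 'k)" where
  "block_proj = block_op s s' block_ind"

lemma block_proj_ops: "block_proj \<in> ops"
  unfolding block_proj_def by (rule block_op_ops[OF increasing_tendsto disjoint_block_ind' norm_block_ind])

lemma block_proj_sums:
  "(\<lambda>k. scale_bcontfun (apply_bcontfun g (s k) - apply_bcontfun g s') (block_ind k)) sums blinfun_apply block_proj g"
  unfolding block_proj_def by (rule block_op_sums[OF increasing_tendsto disjoint_block_ind' norm_block_ind])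

lemma block_proj_at:
  fixes g :: "'a \<Rightarrow>\<^sub>C 'k::{real_normed_field, banach}"
  shows "apply_bcontfun (blinfun_apply block_proj g) (s j) = apply_bcontfun g (s j) - apply_bcontfun g s'"
    "apply_bcontfun (blinfun_apply block_proj g) s' = 0"
proof -
  note sums = block_op_apply[OF increasing_tendsto disjoint_block_ind' norm_block_ind, folded block_proj_def]
  show "apply_bcontfun (blinfun_apply block_proj g) (s j) = apply_bcontfun g (s j) - apply_bcontfun g s'"
    using sums_single_term[OF sums[of g "s j"], of j] by (simp add: block_s)
  show "apply_bcontfun (blinfun_apply block_proj g) s' = 0"
    using sums_single_term[OF sums[of g s'], of 0] by (simp add: block_s')
qed

lemma block_proj_idem: "block_proj o\<^sub>L block_proj = (block_proj :: ('a \<Rightarrow>\<^sub>C 'k::{real_normed_field, banach}) \<Rightarrow>\<^sub>L _)"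
proof (rule blinfun_eqI)
  fix g :: "'a \<Rightarrow>\<^sub>C 'k"
  show "blinfun_apply (block_proj o\<^sub>L block_proj) g = blinfun_apply block_proj g"
    using block_proj_sums[of "blinfun_apply block_proj g"] block_proj_sums[of g]
    by (simp add: block_proj_at sums_unique2)
qed

text \<open>
  The operator fixes the indicators of the blocks, and these have mutual distance one.
\<close>

lemma block_proj_not_compact: "block_proj \<notin> (compact_operators :: (('a \<Rightarrow>\<^sub>C 'k::{real_normed_field, banach}) \<Rightarrow>\<^sub>L _) set)"
proof
  assume "block_proj \<in> (compact_operators :: (('a \<Rightarrow>\<^sub>C 'k) \<Rightarrow>\<^sub>L _) set)"
  then have cpt: "compact (closure (blinfun_apply (block_proj :: ('a \<Rightarrow>\<^sub>C 'k) \<Rightarrow>\<^sub>L _) ` cball 0 1))"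
    by (rule compact_operatorsD)
  have fix_ind: "blinfun_apply block_proj (block_ind j) = (block_ind j :: 'a \<Rightarrow>\<^sub>C 'k)" for j
    using sums_single_term[OF block_proj_sums[of "block_ind j"], of j] by (simp add: block_s block_s')
  have in_closure: "block_ind j \<in> closure (blinfun_apply (block_proj :: ('a \<Rightarrow>\<^sub>C 'k) \<Rightarrow>\<^sub>L _) ` cball 0 1)" for j
  proof -
    have "blinfun_apply block_proj (block_ind j) \<in> blinfun_apply (block_proj :: ('a \<Rightarrow>\<^sub>C 'k) \<Rightarrow>\<^sub>L _) ` cball 0 1"
      using norm_block_ind by (intro imageI) simp
    then show ?thesis unfolding fix_ind using closure_subset by blast
  qed
  from cpt[unfolded compact_def, rule_format, of block_ind, OF in_closure] obtain l and \<rho> :: "nat \<Rightarrow> nat" where \<rho>: "strict_mono \<rho>" "((block_ind :: nat \<Rightarrow> 'a \<Rightarrow>\<^sub>C 'k) \<circ> \<rho>) \<longlonglongrightarrow> l"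
    by blast
  then have "Cauchy ((block_ind :: nat \<Rightarrow> 'a \<Rightarrow>\<^sub>C 'k) \<circ> \<rho>)" using LIMSEQ_imp_Cauchy by blast
  then obtain N where N: "\<And>m n. N \<le> m \<Longrightarrow> N \<le> n \<Longrightarrow>
      dist (block_ind (\<rho> m)) (block_ind (\<rho> n) :: 'a \<Rightarrow>\<^sub>C 'k) < 1"
    unfolding Cauchy_def by (metis comp_apply zero_less_one)
  have "\<rho> N \<noteq> \<rho> (Suc N)" using strict_mono_eq[OF \<rho>(1), of N "Suc N"] by simp
  then have "norm (apply_bcontfun (block_ind (\<rho> N) - block_ind (\<rho> (Suc N)) :: 'a \<Rightarrow>\<^sub>C 'k) (s (\<rho> N))) = 1"
    by (simp add: block_s)
  then have "1 \<le> norm (block_ind (\<rho> N) - block_ind (\<rho> (Suc N)) :: 'a \<Rightarrow>\<^sub>C 'k)"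
    using norm_bounded[of "block_ind (\<rho> N) - block_ind (\<rho> (Suc N)) :: 'a \<Rightarrow>\<^sub>C 'k" "s (\<rho> N)"] by simp
  then show False using N[of N "Suc N"] by (simp add: dist_norm)
qed

text \<open>
  The operator \<open>R T S\<close> has the matrix \<open>\<mu> k (g m) / \<mu> k (g k)\<close> with respect to the blocks, which differs
  from the identity matrix by rows of small sum.
\<close>

lemma block_factorization:
  fixes T :: "('a \<Rightarrow>\<^sub>C 'k::{real_normed_field, banach}) \<Rightarrow>\<^sub>L ('a \<Rightarrow>\<^sub>C 'k)"
  defines "\<mu> \<equiv> \<lambda>k f. apply_bcontfun (blinfun_apply T f) (s k) - apply_bcontfun (blinfun_apply T f) s'"
  assumes T: "T \<in> ops" and disj: "disjoint_family g" and gB: "\<And>k. norm (g k) \<le> 2"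
    and diag: "\<And>k. q \<le> norm (\<mu> k (g k))" and q: "0 < q"
    and off: "\<And>k S. finite S \<Longrightarrow> k \<notin> S \<Longrightarrow> (\<Sum>m\<in>S. norm (\<mu> k (g m))) \<le> \<delta>"
  obtains R S where "R \<in> ops" "S \<in> ops" "norm R \<le> 2 / q" "norm S \<le> 4"
    "norm ((R o\<^sub>L T o\<^sub>L S) - block_proj) \<le> 2 * \<delta> / q"
proof -
  define e where "e k = scale_bcontfun (inverse (\<mu> k (g k))) (block_ind k :: 'a \<Rightarrow>\<^sub>C 'k)" for k
  have disj_e: "disjoint_family e" unfolding e_def by (rule disjoint_block_ind)
  have nz: "\<mu> k (g k) \<noteq> 0" for k using diag[of k] q by auto
  have e_norm: "norm (e k) \<le> 1 / q" for k
  proof -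
    have "norm (e k) \<le> inverse (norm (\<mu> k (g k))) * 1"
      unfolding e_def norm_scale_bcontfun norm_inverse by (intro mult_left_mono norm_block_ind) auto
    also have "\<dots> \<le> 1 / q" using diag[of k] q by (simp add: inverse_eq_divide frac_le)
    finally show ?thesis .
  qed
  define R where "R = block_op s s' e"
  define S where "S = block_op s s' g"
  have R: "R \<in> ops" "norm R \<le> 2 / q"
    unfolding R_def using block_op_ops[OF increasing_tendsto disj_e e_norm] norm_block_op[OF increasing_tendsto disj_e e_norm]
    by auto
  have S: "S \<in> ops" "norm S \<le> 4"
    unfolding S_def using block_op_ops[OF increasing_tendsto disj gB] norm_block_op[OF increasing_tendsto disj gB]
    by auto
  note S_sums = block_op_sums[OF increasing_tendsto disj gB, folded S_def]
    and R_sums = block_op_sums[OF increasing_tendsto disj_e e_norm, folded R_def]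
  have \<mu>_add: "\<mu> k (f + h) = \<mu> k f + \<mu> k h" and \<mu>_scale: "\<mu> k (scale_bcontfun c f) = c * \<mu> k f" for k f h c
    by (simp_all add: \<mu>_def blinfun.add_right opsD[OF T] algebra_simps)
  have \<mu>_bl: "bounded_linear (\<mu> k)" for k
  proof (rule bounded_linear_intro[where K = "2 * norm T"])
    show "\<mu> k (f + h) = \<mu> k f + \<mu> k h" for f h by (rule \<mu>_add)
    show "\<mu> k (r *\<^sub>R f) = r *\<^sub>R \<mu> k f" for r f by (simp add: scaleR_bcontfun_eq \<mu>_scale scaleR_conv_of_real)
    show "norm (\<mu> k f) \<le> norm f * (2 * norm T)" for f
    proof -
      have "norm (\<mu> k f) \<le> norm (blinfun_apply T f) + norm (blinfun_apply T f)"
        unfolding \<mu>_def by (intro order_trans[OF norm_triangle_ineq4] add_mono norm_bounded)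
      then show ?thesis using norm_blinfun[of T f] by (simp add: algebra_simps)
    qed
  qed
  have \<delta>: "0 \<le> \<delta>" using off[of "{}" 0] by simp
  have close: "norm (\<mu> k (blinfun_apply S f) * inverse (\<mu> k (g k)) - (apply_bcontfun f (s k) - apply_bcontfun f s'))
      \<le> 2 * \<delta> / q * norm f" for k f
  proof -
    define c where "c m = apply_bcontfun f (s m) - apply_bcontfun f s'" for m
    have c: "norm (c m) \<le> 2 * norm f" for m
      unfolding c_def using norm_triangle_ineq4 norm_bounded[of f]
      by (smt (verit))
    have sums: "(\<lambda>m. c m * \<mu> k (g m)) sums \<mu> k (blinfun_apply S f)"
      using bounded_linear.sums[OF \<mu>_bl S_sums[of f], of k] by (simp add: \<mu>_scale c_def)
    have "norm (\<mu> k (blinfun_apply S f) - c k * \<mu> k (g k)) \<le> 2 * norm f * \<delta>"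
    proof (rule LIMSEQ_le_const2)
      show "(\<lambda>n. norm ((\<Sum>m<n. c m * \<mu> k (g m)) - c k * \<mu> k (g k)))
        \<longlonglongrightarrow> norm (\<mu> k (blinfun_apply S f) - c k * \<mu> k (g k))"
        using sums unfolding sums_def by (intro tendsto_intros)
      have "norm ((\<Sum>m<n. c m * \<mu> k (g m)) - c k * \<mu> k (g k)) \<le> 2 * norm f * \<delta>" if "k < n" for n
      proof -
        have "(\<Sum>m<n. c m * \<mu> k (g m)) - c k * \<mu> k (g k) = (\<Sum>m\<in>{..<n} - {k}. c m * \<mu> k (g m))"
          using that by (simp add: sum.remove[of "{..<n}" k])
        also have "norm \<dots> \<le> (\<Sum>m\<in>{..<n} - {k}. 2 * norm f * norm (\<mu> k (g m)))"
          by (rule sum_norm_le) (simp add: norm_mult mult_right_mono c)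
        also have "\<dots> = 2 * norm f * (\<Sum>m\<in>{..<n} - {k}. norm (\<mu> k (g m)))" by (simp add: sum_distrib_left)
        also have "\<dots> \<le> 2 * norm f * \<delta>" by (intro mult_left_mono off) auto
        finally show ?thesis .
      qed
      then show "\<exists>N. \<forall>n\<ge>N. norm ((\<Sum>m<n. c m * \<mu> k (g m)) - c k * \<mu> k (g k)) \<le> 2 * norm f * \<delta>"
        by (meson Suc_le_lessD)
    qed
    moreover have "\<mu> k (blinfun_apply S f) * inverse (\<mu> k (g k)) - c k
      = (\<mu> k (blinfun_apply S f) - c k * \<mu> k (g k)) * inverse (\<mu> k (g k))"
      using nz[of k] by (simp add: field_simps)
    moreover have "norm (inverse (\<mu> k (g k))) \<le> 1 / q"
      unfolding norm_inverse using diag[of k] q by (simp add: inverse_eq_divide frac_le)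
    ultimately have "norm (\<mu> k (blinfun_apply S f) * inverse (\<mu> k (g k)) - c k) \<le> (2 * norm f * \<delta>) * (1 / q)"
      unfolding norm_mult using \<delta> by (simp only: norm_mult) (intro mult_mono; simp)
    then show ?thesis by (simp add: c_def algebra_simps)
  qed
  have "norm ((R o\<^sub>L T o\<^sub>L S) - block_proj) \<le> 2 * \<delta> / q"
  proof (rule norm_blinfun_bound)
    show "0 \<le> 2 * \<delta> / q" using \<delta> q by simp
    fix f :: "'a \<Rightarrow>\<^sub>C 'k"
    have "(\<lambda>k. scale_bcontfun (\<mu> k (blinfun_apply S f)) (e k)
        - scale_bcontfun (apply_bcontfun f (s k) - apply_bcontfun f s') (block_ind k))
      sums (blinfun_apply R (blinfun_apply T (blinfun_apply S f)) - blinfun_apply block_proj f)"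
      by (intro sums_diff block_proj_sums) (use R_sums[of "blinfun_apply T (blinfun_apply S f)"] in \<open>simp add: \<mu>_def\<close>)
    also have "(\<lambda>k. scale_bcontfun (\<mu> k (blinfun_apply S f)) (e k)
        - scale_bcontfun (apply_bcontfun f (s k) - apply_bcontfun f s') (block_ind k))
      = (\<lambda>k. scale_bcontfun (\<mu> k (blinfun_apply S f) * inverse (\<mu> k (g k))
        - (apply_bcontfun f (s k) - apply_bcontfun f s')) (block_ind k))"
      by (intro ext bcontfun_eqI) (simp add: e_def algebra_simps)
    finally have "norm (blinfun_apply R (blinfun_apply T (blinfun_apply S f)) - blinfun_apply block_proj f)
      \<le> (2 * \<delta> / q * norm f) * 1"
      by (rule norm_disjoint_sums_le[OF disjoint_block_ind' norm_block_ind close])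
    then show "norm (blinfun_apply ((R o\<^sub>L T o\<^sub>L S) - block_proj) f) \<le> 2 * \<delta> / q * norm f"
      by (simp add: blinfun.diff_left)
  qed
  with R S show thesis using that by blast
qed

end

text \<open>
  Some point \<open>t\<close> has \<open>T f\<close>, with \<open>f\<close> in the unit ball, varying by more than \<open>r\<close> between \<open>t\<close> and points
  arbitrarily close to it. For \<open>t\<close> of uncountable cofinality no sequence of these points
  reaches \<open>t\<close>. Therefore each function is chosen together with a point \<open>b\<close> such that the
  variation persists for all points between \<open>b\<close> and \<open>t\<close>; the supremum \<open>s'\<close> of the sequence
  is one of them and takes the role of \<open>t\<close>.
\<close>

lemma oscillating_sequence:
  fixes T :: "('a::{wellorder, linorder_topology} \<Rightarrow>\<^sub>C 'k::{real_normed_field, banach, heine_borel}) \<Rightarrow>\<^sub>L ('a \<Rightarrow>\<^sub>C 'k)"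
  assumes top: "(UNIV :: 'a set) = {..\<alpha>}" and T: "T \<in> ops" and r: "0 < r"
    and far: "\<And>J. J \<in> compact_operators \<Longrightarrow> r < norm (T - J)"
  obtains s :: "nat \<Rightarrow> 'a" and s' and f :: "nat \<Rightarrow> 'a \<Rightarrow>\<^sub>C 'k"
  where "strict_mono s" "\<forall>k. s k < s'" "\<forall>u<s'. \<exists>k. u < s k" "\<forall>k. norm (f k) \<le> 1"
    "\<forall>k. r < norm (apply_bcontfun (blinfun_apply T (f k)) (s k) - apply_bcontfun (blinfun_apply T (f k)) s')"
proof -
  have "\<not> (\<forall>s y. y < s \<longrightarrow> (\<exists>b<s. \<forall>x f. b < x \<longrightarrow> x < s \<longrightarrow> norm f \<le> 1 \<longrightarrow>
      norm (apply_bcontfun (blinfun_apply T f) x - apply_bcontfun (blinfun_apply T f) s) \<le> r))"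
  proof
    assume *: "\<forall>s y. y < s \<longrightarrow> (\<exists>b<s. \<forall>x f. b < x \<longrightarrow> x < s \<longrightarrow> norm f \<le> 1 \<longrightarrow>
      norm (apply_bcontfun (blinfun_apply T f) x - apply_bcontfun (blinfun_apply T f) s) \<le> r)"
    obtain J where "J \<in> compact_operators" "norm (T - J) \<le> r"
      by (rule near_compact_if_small_oscillation[OF top T r]) (use * in blast)+
    then show False using far[of J] by simp
  qed
  then obtain t y where yt: "y < t" and osc: "\<And>b. b < t \<Longrightarrow> \<exists>x f. b < x \<and> x < t \<and> norm f \<le> 1 \<and>
      r < norm (apply_bcontfun (blinfun_apply T f) x - apply_bcontfun (blinfun_apply T f) t)"
    by (meson not_le)
  define P where "P = (\<lambda>(x, f :: 'a \<Rightarrow>\<^sub>C 'k, b). x < b \<and> b < t \<and> norm f \<le> 1 \<and> (\<forall>z. b < z \<longrightarrow> z \<le> t \<longrightarrow>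
      r < norm (apply_bcontfun (blinfun_apply T f) x - apply_bcontfun (blinfun_apply T f) z)))"
  have step: "\<exists>x f b'. P (x, f, b') \<and> b < x" if bt: "b < t" for b
  proof -
    obtain x f where x: "b < x" "x < t" "norm f \<le> 1"
      "r < norm (apply_bcontfun (blinfun_apply T f) x - apply_bcontfun (blinfun_apply T f) t)"
      using osc[OF bt] by blast
    let ?h = "blinfun_apply T f"
    \<comment> \<open>The margin by which the variation exceeds \<open>r\<close> leaves room for a neighbourhood of \<open>t\<close>.\<close>
    define e where "e = norm (apply_bcontfun ?h x - apply_bcontfun ?h t) - r"
    have e: "0 < e" using x(4) by (simp add: e_def)
    have "isCont (apply_bcontfun ?h) t" using continuous_on_eq_continuous_at[of UNIV] by auto
    then obtain w where w: "x \<le> w" "w < t" "\<And>z. w < z \<Longrightarrow> z \<le> t \<Longrightarrow> norm (?h z - ?h t) < e"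
      using continuous_near[OF _ x(2) e] by metis
    have sep: "r < norm (?h x - ?h z)" if "w < z" "z \<le> t" for z
      using w(3)[OF that] norm_triangle_ineq[of "?h x - ?h z" "?h z - ?h t"] by (simp add: e_def)
    obtain b' where b': "w < b'" "b' < t"
    proof -
      obtain x' where "w < x'" "x' < t" using osc[OF w(2)] by blast
      then show thesis by (rule that)
    qed
    have "P (x, f, b')" unfolding P_def using x(3) w(1) b' sep by auto
    then show ?thesis using x(1) by blast
  qed
  have "\<exists>S. \<forall>k. P (S k) \<and> snd (snd (S k)) < fst (S (Suc k))"
  proof (rule dependent_nat_choice)
    show "\<exists>x. P x" using step[OF yt] by blast
    fix x and k :: nat assume "P x"
    then have "snd (snd x) < t" by (auto simp: P_def split: prod.splits)
    then obtain x' f b' where "P (x', f, b')" "snd (snd x) < x'" using step by blast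
    then show "\<exists>y. P y \<and> snd (snd x) < fst y" by (intro exI[of _ "(x', f, b')"]) auto
  qed
  then obtain S where S: "\<And>k. P (S k)" "\<And>k. snd (snd (S k)) < fst (S (Suc k))" by blast
  define s where "s k = fst (S k)" for k
  define f where "f k = fst (snd (S k))" for k
  define b where "b k = snd (snd (S k))" for k
  have P: "s k < b k" "b k < t" "norm (f k) \<le> 1"
    "b k < z \<Longrightarrow> z \<le> t \<Longrightarrow> r < norm (apply_bcontfun (blinfun_apply T (f k)) (s k) - apply_bcontfun (blinfun_apply T (f k)) z)" for k z
    using S(1)[of k] by (auto simp: P_def s_def f_def b_def split: prod.splits)
  have bs: "b k < s (Suc k)" for k using S(2)[of k] by (simp add: b_def s_def)
  have mono: "strict_mono s" unfolding strict_mono_Suc_iff using P(1) bs less_trans by blast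
  define s' where "s' = (LEAST u. \<forall>k. s k \<le> u)"
  have st: "\<forall>k. s k \<le> t" using P(1,2) by (meson less_imp_le less_trans)
  have le: "\<forall>k. s k \<le> s'" unfolding s'_def by (rule LeastI[of "\<lambda>u. \<forall>k. s k \<le> u", OF st])
  have lt: "s k < s'" for k using le mono by (meson lessI less_le_trans strict_mono_less)
  have s't: "s' \<le> t" unfolding s'_def by (rule Least_le[of "\<lambda>u. \<forall>k. s k \<le> u", OF st])
  have sup: "\<exists>k. u < s k" if "u < s'" for u
    using not_less_Least[OF that[unfolded s'_def]] by (auto simp: not_le)
  have "b k < s'" for k using bs[of k] lt[of "Suc k"] by simp
  then show thesis using that[of s s' f] mono lt sup P s't by blast
qed

text \<open>
  The bounds on \<open>R\<close> and \<open>S\<close> depend on the distance \<open>r\<close> to the compact operators but not on \<open>T\<close>, which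
  is what a comparison of norms on the quotient requires. The idempotent may depend on \<open>T\<close>.
\<close>

theorem compact_approximation_or_factorization:
  fixes T :: "('a::{wellorder, linorder_topology} \<Rightarrow>\<^sub>C 'k::{real_normed_field, banach, heine_borel}) \<Rightarrow>\<^sub>L ('a \<Rightarrow>\<^sub>C 'k)"
  assumes top: "(UNIV :: 'a set) = {..\<alpha>}" and T: "T \<in> ops" and r: "0 < r" and \<epsilon>: "0 < \<epsilon>"
    and far: "\<And>J. J \<in> compact_operators \<Longrightarrow> r < norm (T - J)"
  obtains R S p where "R \<in> ops" "S \<in> ops" "p \<in> ops" "norm R \<le> 8 / r" "norm S \<le> 4"
    "p o\<^sub>L p = p" "p \<notin> compact_operators" "norm ((R o\<^sub>L T o\<^sub>L S) - p) \<le> \<epsilon>"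
proof -
  obtain s :: "nat \<Rightarrow> 'a" and s' and f :: "nat \<Rightarrow> 'a \<Rightarrow>\<^sub>C 'k"
    where "strict_mono s" "\<forall>k. s k < s'" "\<forall>u<s'. \<exists>k. u < s k" "\<forall>k. norm (f k) \<le> 1"
      "\<forall>k. r < norm (apply_bcontfun (blinfun_apply T (f k)) (s k) - apply_bcontfun (blinfun_apply T (f k)) s')"
    using oscillating_sequence[OF top T r far] .
  then have s: "strict_mono s" "\<And>k. s k < s'" "\<And>u. u < s' \<Longrightarrow> \<exists>k. u < s k"
    and f: "\<And>k. norm (f k) \<le> 1"
      "\<And>k. r < norm (apply_bcontfun (blinfun_apply T (f k)) (s k) - apply_bcontfun (blinfun_apply T (f k)) s')"
    by blast+
  define \<mu> where "\<mu> k h = apply_bcontfun (blinfun_apply T h) (s k) - apply_bcontfun (blinfun_apply T h) s'" for k h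
  have \<mu>: "functional (\<mu> k) (2 * norm T)" for k
    unfolding functional_def
  proof (intro conjI allI)
    show "\<mu> k (h + h') = \<mu> k h + \<mu> k h'" "\<mu> k (scale_bcontfun c h) = c * \<mu> k h" for h h' c
      by (simp_all add: \<mu>_def blinfun.add_right opsD[OF T] algebra_simps)
    show "norm (\<mu> k h) \<le> 2 * norm T * norm h" for h
    proof -
      have "norm (\<mu> k h) \<le> norm (blinfun_apply T h) + norm (blinfun_apply T h)"
        unfolding \<mu>_def by (intro order_trans[OF norm_triangle_ineq4] add_mono norm_bounded)
      then show ?thesis using norm_blinfun[of T h] by simp
    qed
  qed
  have null: "(\<lambda>k. \<mu> k h) \<longlonglongrightarrow> 0" for h
    using increasing_tendsto[OF s, of "blinfun_apply T h"] by (simp add: \<mu>_def LIM_zero)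
  obtain g :: "nat \<Rightarrow> 'a \<Rightarrow>\<^sub>C 'k" and \<nu> :: "nat \<Rightarrow> nat" where \<nu>: "strict_mono \<nu>" and g': "\<forall>k. norm (g k) \<le> 2"
    "\<forall>j k x. j \<noteq> k \<longrightarrow> apply_bcontfun (g j) x = 0 \<or> apply_bcontfun (g k) x = 0"
    "\<forall>k. r / 4 \<le> norm (\<mu> (\<nu> k) (g k))"
    using gliding_hump[where \<mu> = \<mu> and f = f, OF top \<mu> null f(1) f(2)[folded \<mu>_def] r] .
  note g = g'[rule_format]
  have disj: "disjoint_family g" using g(2) by (simp add: disjoint_family_def)
  \<comment> \<open>Chosen so that the error \<open>2 \<delta> / q\<close> of \<open>block_factorization\<close> with \<open>q = r/4\<close> is \<open>\<epsilon>\<close>.\<close>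
  define \<delta> where "\<delta> = \<epsilon> * r / 8"
  have \<delta>: "0 < \<delta>" using r \<epsilon> by (simp add: \<delta>_def)
  have col: "(\<lambda>k. norm (\<mu> (\<nu> k) (g m))) \<longlonglongrightarrow> 0" for m
    using tendsto_norm[OF LIMSEQ_subseq_LIMSEQ[OF null \<nu>]] by (simp add: o_def)
  have row: "summable (\<lambda>m. norm (\<mu> (\<nu> k) (g m)))" for k
  proof (rule summableI_nonneg_bounded)
    fix n
    have "\<exists>w. norm w = 1 \<and> w * \<mu> (\<nu> k) (g m) = of_real (norm (\<mu> (\<nu> k) (g m)))" for m
      using phase[of "\<mu> (\<nu> k) (g m)"] by blast
    then have "\<exists>w. \<forall>m. norm (w m) = 1 \<and> w m * \<mu> (\<nu> k) (g m) = of_real (norm (\<mu> (\<nu> k) (g m)))"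
      by (intro choice allI)
    then obtain w where w: "\<forall>m. norm (w m) = 1 \<and> w m * \<mu> (\<nu> k) (g m) = of_real (norm (\<mu> (\<nu> k) (g m)))" ..
    have "\<mu> (\<nu> k) (\<Sum>m<n. scale_bcontfun (w m) (g m)) = (\<Sum>m<n. w m * \<mu> (\<nu> k) (g m))"
      by (induction n) (auto simp: functionalD[OF \<mu>])
    also have "\<dots> = of_real (\<Sum>m<n. norm (\<mu> (\<nu> k) (g m)))" using w by simp
    finally have eq: "\<mu> (\<nu> k) (\<Sum>m<n. scale_bcontfun (w m) (g m)) = of_real (\<Sum>m<n. norm (\<mu> (\<nu> k) (g m)))" .
    have "(\<Sum>m<n. norm (\<mu> (\<nu> k) (g m))) = norm (\<mu> (\<nu> k) (\<Sum>m<n. scale_bcontfun (w m) (g m)))"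
      unfolding eq norm_of_real by (simp add: sum_nonneg)
    also have "norm (\<mu> (\<nu> k) (\<Sum>m<n. scale_bcontfun (w m) (g m)))
        \<le> 2 * norm T * norm (\<Sum>m<n. scale_bcontfun (w m) (g m))" by (rule functionalD(3)[OF \<mu>])
    also have "\<dots> \<le> 2 * norm T * (1 * 2)"
      using w by (intro mult_left_mono norm_disjoint_sum_le[OF disj g(1)]) auto
    finally show "(\<Sum>m<n. norm (\<mu> (\<nu> k) (g m))) \<le> 2 * norm T * (1 * 2)" by simp
  qed simp
  obtain \<rho> :: "nat \<Rightarrow> nat" where \<rho>: "strict_mono \<rho>"
    "\<forall>k S. finite S \<longrightarrow> k \<notin> S \<longrightarrow> (\<Sum>m\<in>S. norm (\<mu> (\<nu> (\<rho> k)) (g (\<rho> m)))) \<le> \<delta>"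
    using almost_diagonal_subsequence[where a = "\<lambda>k m. norm (\<mu> (\<nu> k) (g m))", OF norm_ge_zero col row \<delta>] .
  define z where "z k = s (\<nu> (\<rho> k))" for k
  have sub: "strict_mono (\<nu> \<circ> \<rho>)" using \<nu> \<rho>(1) by (rule strict_mono_o)
  have z: "strict_mono z" "\<And>k. z k < s'"
    using strict_mono_o[OF s(1) sub] s(2) unfolding z_def comp_def by auto
  have z_sup: "\<exists>k. u < z k" if u: "u < s'" for u
  proof -
    obtain k where "u < s k" using s(3)[OF u] by blast
    also have "s k \<le> z k" unfolding z_def
      using strict_mono_less_eq[OF s(1)] seq_suble[OF sub, of k] by simp
    finally show ?thesis by blast
  qed
  have "disjoint_family (\<lambda>k. g (\<rho> k))"
    using disj strict_mono_eq[OF \<rho>(1)] by (simp add: disjoint_family_def)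
  note disj' = this
  obtain R S where RS: "R \<in> ops" "S \<in> ops" "norm R \<le> 2 / (r / 4)" "norm S \<le> 4"
    "norm ((R o\<^sub>L T o\<^sub>L S) - block_proj z s') \<le> 2 * \<delta> / (r / 4)"
  proof (rule block_factorization[OF z z_sup T disj' g(1), of "r / 4" \<delta>])
    show "r / 4 \<le> norm (apply_bcontfun (blinfun_apply T (g (\<rho> k))) (z k) - apply_bcontfun (blinfun_apply T (g (\<rho> k))) s')" for k
      using g(3)[of "\<rho> k"] by (simp add: \<mu>_def z_def)
    show "finite S \<Longrightarrow> k \<notin> S \<Longrightarrow> (\<Sum>m\<in>S. norm (apply_bcontfun (blinfun_apply T (g (\<rho> m))) (z k)
        - apply_bcontfun (blinfun_apply T (g (\<rho> m))) s')) \<le> \<delta>" for k S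
      using \<rho>(2) by (simp add: \<mu>_def z_def)
  qed (use r in auto)
  have "2 * \<delta> / (r / 4) = \<epsilon>" using r by (simp add: \<delta>_def)
  with RS show thesis
    using that[of R S "block_proj z s'"] block_proj_ops[OF z z_sup] block_proj_idem[OF z z_sup]
      block_proj_not_compact[OF z z_sup] by simp
qed

text \<open>
  With \<open>C\<close> from the upper bound, \<open>1 \<le> n p \<le> n (R T S) + 1/2\<close>, and
  \<open>n (R T S) \<le> C (8/r) \<cdot> n T \<cdot> 4 C\<close>.
\<close>

lemma (in algebra_seminorm) bounded_below_modulo_compacts:
  assumes top: "(UNIV :: 'a set) = {..\<alpha>}"
    and idem: "\<And>p. p \<in> ops \<Longrightarrow> p \<notin> compact_operators \<Longrightarrow> n p \<noteq> 0"
  obtains c where "0 < c" "\<And>T r. T \<in> ops \<Longrightarrow> 0 < r \<Longrightarrow> n T < c * r \<Longrightarrow> \<exists>J\<in>compact_operators. norm (T - J) \<le> r"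
proof -
  obtain C0 where C0: "0 \<le> C0" "\<And>T. T \<in> ops \<Longrightarrow> n T \<le> C0 * norm T" using bounded_by_operator_norm[OF top] by blast
  define C where "C = C0 + 1"
  have C: "0 < C" "\<And>T. T \<in> ops \<Longrightarrow> n T \<le> C * norm T"
    using C0 by (auto simp: C_def algebra_simps intro: add_increasing)
  have "\<exists>J\<in>compact_operators. norm (T - J) \<le> r" if T: "T \<in> ops" and r: "0 < r" and nT: "n T < 1 / (64 * C\<^sup>2) * r" for T r
  proof (rule ccontr)
    assume "\<not> ?thesis"
    then have far: "\<And>J. J \<in> compact_operators \<Longrightarrow> r < norm (T - J)" by (meson not_le)
    have "0 < 1 / (2 * C)" using C by simp
    obtain R S p where RSp: "R \<in> ops" "S \<in> ops" "p \<in> ops" "norm R \<le> 8 / r" "norm S \<le> 4"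
      "p o\<^sub>L p = p" "p \<notin> compact_operators" "norm ((R o\<^sub>L T o\<^sub>L S) - p) \<le> 1 / (2 * C)"
      using compact_approximation_or_factorization[OF top T r \<open>0 < 1 / (2 * C)\<close> far] .
    have "n p \<le> n p * n p" using submult[OF RSp(3,3)] RSp(6) by simp
    moreover have "0 < n p" using idem[OF RSp(3,7)] nonneg[OF RSp(3)] by simp
    ultimately have p1: "1 \<le> n p" by simp
    let ?X = "R o\<^sub>L T o\<^sub>L S"
    have X: "?X \<in> ops" using RSp T by auto
    have "n p \<le> n ?X + n (?X - p)" using diff[OF X, of "?X - p"] X RSp(3) by simp
    moreover have "n (?X - p) \<le> C * (1 / (2 * C))"
    proof (rule order_trans[OF C(2)])
      show "?X - p \<in> ops" using X RSp(3) by simp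
      show "C * norm (?X - p) \<le> C * (1 / (2 * C))" using RSp(8) C(1) by (intro mult_left_mono) auto
    qed
    ultimately have half: "1 / 2 \<le> n ?X" using p1 C(1) by simp
    have "n ?X \<le> n (R o\<^sub>L T) * n S" using RSp T by (intro submult) auto
    also have "\<dots> \<le> (n R * n T) * n S" using RSp T by (intro mult_right_mono submult nonneg)
    also have "\<dots> \<le> (C * (8 / r) * n T) * (C * 4)"
    proof (intro mult_mono nonneg)
      show "n R \<le> C * (8 / r)" using C(2)[OF RSp(1)] RSp(4) C(1) by (meson less_imp_le mult_left_mono order_trans)
      show "n S \<le> C * 4" using C(2)[OF RSp(2)] RSp(5) C(1) by (meson less_imp_le mult_left_mono order_trans)
    qed (use C(1) r T nonneg RSp in auto)
    also have "\<dots> = 32 * C\<^sup>2 / r * n T" by (simp add: power2_eq_square)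
    also have "\<dots> < 32 * C\<^sup>2 / r * (1 / (64 * C\<^sup>2) * r)"
      using nT C(1) r by (intro mult_strict_left_mono) auto
    also have "\<dots> = 1 / 2" using C(1) r by simp
    finally show False using half by simp
  qed
  moreover have "0 < 1 / (64 * C\<^sup>2)" using C(1) by simp
  ultimately show thesis using that by blast
qed

section \<open>Uniqueness of the algebra norms\<close>

lemma operator_algebra_simps [simp]:
  "mult operator_algebra = blinfun_compose" "one operator_algebra = id_blinfun"
  "zero operator_algebra = 0" "add operator_algebra = (+)" "smult operator_algebra = scale_blinfun"
  by (simp_all add: operator_algebra_def)

lemma ring_operator_algebra: "ring (operator_algebra ::
    ('k::real_normed_field, ('a::topological_space \<Rightarrow>\<^sub>C 'k) \<Rightarrow>\<^sub>L ('a \<Rightarrow>\<^sub>C 'k)) module)"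
proof (rule ringI)
  show "abelian_group (operator_algebra :: ('k, ('a \<Rightarrow>\<^sub>C 'k) \<Rightarrow>\<^sub>L ('a \<Rightarrow>\<^sub>C 'k)) module)"
    by (rule abelian_groupI) (auto simp: add.assoc add.commute intro!: bexI[of _ "- x" for x])
  show "monoid (operator_algebra :: ('k, ('a \<Rightarrow>\<^sub>C 'k) \<Rightarrow>\<^sub>L ('a \<Rightarrow>\<^sub>C 'k)) module)"
    by (rule monoidI) (auto simp: compose_assoc)
qed (auto simp: compose_add_left compose_add_right)

lemma ideal_compact_operators: "ideal compact_operators (operator_algebra ::
    ('k::{real_normed_field, heine_borel}, ('a::topological_space \<Rightarrow>\<^sub>C 'k) \<Rightarrow>\<^sub>L ('a \<Rightarrow>\<^sub>C 'k)) module)"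
proof (rule idealI[OF ring_operator_algebra])
  interpret ring "operator_algebra :: ('k, ('a \<Rightarrow>\<^sub>C 'k) \<Rightarrow>\<^sub>L ('a \<Rightarrow>\<^sub>C 'k)) module"
    by (rule ring_operator_algebra)
  show "subgroup compact_operators
      (add_monoid (operator_algebra :: ('k, ('a \<Rightarrow>\<^sub>C 'k) \<Rightarrow>\<^sub>L ('a \<Rightarrow>\<^sub>C 'k)) module))"
  proof (rule add.subgroupI)
    fix T :: "('a \<Rightarrow>\<^sub>C 'k) \<Rightarrow>\<^sub>L ('a \<Rightarrow>\<^sub>C 'k)" assume T: "T \<in> compact_operators"
    have "\<ominus>\<^bsub>operator_algebra\<^esub> T = - T"
      using compact_operatorsD(1)[OF T] by (intro minus_equality) auto
    also have "\<dots> = scale_blinfun (-1) T" by (rule op_eqI) (simp add: blinfun.minus_left)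
    finally show "\<ominus>\<^bsub>operator_algebra\<^esub> T \<in> compact_operators" using compact_operators_scale[OF T] by simp
  qed (use compact_operators_zero compact_operators_add compact_operatorsD(1) in auto)
qed (auto intro: compact_operators_compose_left compact_operators_compose_right)

abbreviation coset ::
    "(('a::topological_space \<Rightarrow>\<^sub>C 'k::{real_normed_field, heine_borel}) \<Rightarrow>\<^sub>L ('a \<Rightarrow>\<^sub>C 'k))
      \<Rightarrow> (('a \<Rightarrow>\<^sub>C 'k) \<Rightarrow>\<^sub>L ('a \<Rightarrow>\<^sub>C 'k)) set" where
  "coset T \<equiv> compact_operators +>\<^bsub>operator_algebra\<^esub> T"

lemma coset_eq: "coset T = {J + T |J. J \<in> compact_operators}"
  by (auto simp: a_r_coset_def')

lemma coset_eq_iff: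
  fixes S T :: "('a::topological_space \<Rightarrow>\<^sub>C 'k::{real_normed_field, heine_borel}) \<Rightarrow>\<^sub>L ('a \<Rightarrow>\<^sub>C 'k)"
  shows "coset S = coset T \<longleftrightarrow> S - T \<in> compact_operators"
proof
  assume "coset S = coset T"
  moreover have "S \<in> coset S" unfolding coset_eq using compact_operators_zero by force
  ultimately show "S - T \<in> compact_operators" unfolding coset_eq by auto
next
  assume ST: "S - T \<in> compact_operators"
  have TS: "T - S \<in> compact_operators"
  proof -
    have "T - S = scale_blinfun (-1) (S - T)" by (rule op_eqI) (simp add: blinfun.diff_left)
    then show ?thesis using compact_operators_scale[OF ST] by simp
  qed
  have "J + S \<in> coset T" "J + T \<in> coset S" if "J \<in> compact_operators" for J
    unfolding coset_eq using compact_operators_add[OF that ST] compact_operators_add[OF that TS]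
    by (force simp: algebra_simps)+
  then show "coset S = coset T" by (auto simp: coset_eq[of S] coset_eq[of T])
qed

lemma calkin_algebra_simps [simp]:
  fixes S T :: "('a::topological_space \<Rightarrow>\<^sub>C 'k::{real_normed_field, heine_borel}) \<Rightarrow>\<^sub>L ('a \<Rightarrow>\<^sub>C 'k)"
  shows "carrier calkin_algebra = (coset ` ops :: (('a \<Rightarrow>\<^sub>C 'k) \<Rightarrow>\<^sub>L ('a \<Rightarrow>\<^sub>C 'k)) set set)"
    "zero calkin_algebra = (compact_operators :: (('a \<Rightarrow>\<^sub>C 'k) \<Rightarrow>\<^sub>L ('a \<Rightarrow>\<^sub>C 'k)) set)"
    "S \<in> ops \<Longrightarrow> T \<in> ops \<Longrightarrow> coset S \<oplus>\<^bsub>calkin_algebra\<^esub> coset T = coset (S + T)"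
    "S \<in> ops \<Longrightarrow> T \<in> ops \<Longrightarrow> coset S \<otimes>\<^bsub>calkin_algebra\<^esub> coset T = coset (S o\<^sub>L T)"
    "T \<in> ops \<Longrightarrow> c \<odot>\<^bsub>calkin_algebra\<^esub> coset T = coset (scale_blinfun c T)"
proof -
  interpret ideal compact_operators "operator_algebra :: ('k, ('a \<Rightarrow>\<^sub>C 'k) \<Rightarrow>\<^sub>L ('a \<Rightarrow>\<^sub>C 'k)) module"
    by (rule ideal_compact_operators)
  note defs = calkin_algebra_def quotient_algebra_def FactRing_def ring.defs module.defs
  show "carrier calkin_algebra = (coset ` ops :: (('a \<Rightarrow>\<^sub>C 'k) \<Rightarrow>\<^sub>L ('a \<Rightarrow>\<^sub>C 'k)) set set)"
    by (auto simp: defs A_RCOSETS_def')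
  show "zero calkin_algebra = (compact_operators :: (('a \<Rightarrow>\<^sub>C 'k) \<Rightarrow>\<^sub>L ('a \<Rightarrow>\<^sub>C 'k)) set)"
    by (simp add: defs)
  show "coset S \<oplus>\<^bsub>calkin_algebra\<^esub> coset T = coset (S + T)" if "S \<in> ops" "T \<in> ops"
    using a_rcos_sum[OF that] by (simp add: defs)
  show "coset S \<otimes>\<^bsub>calkin_algebra\<^esub> coset T = coset (S o\<^sub>L T)" if "S \<in> ops" "T \<in> ops"
    using rcoset_mult_add[OF that] by (simp add: defs)
  show "c \<odot>\<^bsub>calkin_algebra\<^esub> coset T = coset (scale_blinfun c T)" if "T \<in> ops"
  proof -
    have "coset (scale_blinfun c S) = coset (scale_blinfun c T)" if S: "S \<in> coset T" for S
    proof -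
      obtain J where J: "J \<in> compact_operators" "S = J + T" using S by (auto simp: coset_eq)
      have "scale_blinfun c S - scale_blinfun c T = scale_blinfun c J"
        unfolding J by (rule op_eqI) (simp add: blinfun.add_left blinfun.diff_left algebra_simps)
      then show ?thesis unfolding coset_eq_iff using compact_operators_scale[OF J(1)] by simp
    qed
    moreover have "T \<in> coset T" unfolding coset_eq using compact_operators_zero by force
    ultimately have "(\<Union>S\<in>coset T. coset (scale_blinfun c S)) = coset (scale_blinfun c T)" by blast
    then show ?thesis by (simp add: defs)
  qed
qed

text \<open>
  The rank-one operator \<open>S\<close> is \<open>g \<mapsto> g(t) f\<close>, for which \<open>S T S = (T f)(t) S\<close>.
\<close>

lemma (in algebra_seminorm) bounded_below:
  assumes top: "(UNIV :: 'a set) = {..\<alpha>}" and definite: "\<And>T. T \<in> ops \<Longrightarrow> n T = 0 \<Longrightarrow> T = 0"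
  obtains C where "0 < C" "\<And>T. T \<in> ops \<Longrightarrow> norm T \<le> C * n T"
proof -
  obtain C0 where C0: "0 \<le> C0" "\<And>T. T \<in> ops \<Longrightarrow> n T \<le> C0 * norm T" using bounded_by_operator_norm[OF top] by blast
  have "norm T \<le> (C0 + 1) * n T" if T: "T \<in> ops" for T
  proof (rule norm_blinfun_bound)
    show "0 \<le> (C0 + 1) * n T" using C0(1) nonneg[OF T] by simp
    fix f :: "'a \<Rightarrow>\<^sub>C 'k"
    show "norm (blinfun_apply T f) \<le> (C0 + 1) * n T * norm f"
    proof (cases "f = 0")
      case False
      show ?thesis
      proof (rule norm_bound)
        fix t
        let ?S = "Blinfun (\<lambda>g :: 'a \<Rightarrow>\<^sub>C 'k. scale_bcontfun (apply_bcontfun g t) f)"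
        have "bounded_linear (\<lambda>g :: 'a \<Rightarrow>\<^sub>C 'k. scale_bcontfun (apply_bcontfun g t) f)"
          by (rule bounded_linear_intro[where K = "norm f"])
            (auto simp: mult_right_mono norm_bounded scaleR_bcontfun_eq)
        then have S: "blinfun_apply ?S g = scale_bcontfun (apply_bcontfun g t) f" for g
          by (simp add: bounded_linear_Blinfun_apply)
        have S_ops: "?S \<in> ops" by (simp add: ops_iff S)
        have S_norm: "norm ?S \<le> norm f"
          by (rule norm_blinfun_bound)
            (auto simp: S mult.commute[of "norm f"] intro: mult_right_mono norm_bounded)
        have "?S \<noteq> 0"
        proof
          assume "?S = 0"
          then have "blinfun_apply ?S (const_bcontfun 1) = 0" by (simp only: blinfun.zero_left)
          then show False using False by (simp add: S)
        qed
        then have pos: "0 < n ?S" using definite[OF S_ops] nonneg[OF S_ops] by (metis less_le)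
        let ?c = "apply_bcontfun (blinfun_apply T f) t"
        have "(?S o\<^sub>L T) o\<^sub>L ?S = scale_blinfun ?c ?S"
          by (rule blinfun_eqI) (simp add: S opsD[OF T] mult.commute)
        then have "norm ?c * n ?S = n ((?S o\<^sub>L T) o\<^sub>L ?S)" using homogeneous[OF S_ops] by simp
        also have "\<dots> \<le> n (?S o\<^sub>L T) * n ?S" using S_ops T by (intro submult) auto
        also have "\<dots> \<le> (n ?S * n T) * n ?S" using S_ops T by (intro mult_right_mono submult nonneg)
        finally have "norm ?c \<le> n ?S * n T" using pos by (simp add: mult.commute)
        also have "\<dots> \<le> (C0 * norm f) * n T"
          using C0 S_ops S_norm by (intro mult_right_mono nonneg[OF T] order_trans[OF C0(2)] mult_left_mono)
        also have "\<dots> \<le> (C0 + 1) * n T * norm f" using nonneg[OF T] by (simp add: algebra_simps)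
        finally show "norm ?c \<le> (C0 + 1) * n T * norm f" .
      qed
    qed (simp add: blinfun.zero_right)
  qed
  moreover have "0 < C0 + 1" using C0(1) by simp
  ultimately show thesis using that by blast
qed

lemma equivalent_normsI:
  assumes "\<And>x. x \<in> carrier A \<Longrightarrow> 0 \<le> N x" "\<And>x. x \<in> carrier A \<Longrightarrow> 0 \<le> N' x"
    and "\<exists>C. \<forall>x\<in>carrier A. N x \<le> C * N' x" "\<exists>C. \<forall>x\<in>carrier A. N' x \<le> C * N x"
  shows "equivalent_norms A N N'"
proof -
  obtain C C' where C: "\<And>x. x \<in> carrier A \<Longrightarrow> N x \<le> C * N' x" "\<And>x. x \<in> carrier A \<Longrightarrow> N' x \<le> C' * N x"
    using assms(3,4) by blast
  define K where "K = max 1 (max C C')"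
  have K: "0 < K" "C \<le> K" "C' \<le> K" by (auto simp: K_def)
  have "inverse K * N x \<le> N' x \<and> N' x \<le> K * N x" if x: "x \<in> carrier A" for x
  proof
    have "N x \<le> K * N' x" using C(1)[OF x] mult_right_mono[OF K(2) assms(2)[OF x]] by simp
    then show "inverse K * N x \<le> N' x" using K(1) by (simp add: field_simps)
    show "N' x \<le> K * N x" using C(2)[OF x] mult_right_mono[OF K(3) assms(1)[OF x]] by simp
  qed
  then show ?thesis unfolding equivalent_norms_def using K(1) by (meson positive_imp_inverse_positive)
qed

theorem unique_algebra_norm_operator_algebra:
  assumes top: "(UNIV :: 'a::{wellorder, linorder_topology} set) = {..\<alpha>}"
  shows "unique_algebra_norm (operator_algebra ::
    ('k::{real_normed_field, banach, heine_borel}, ('a \<Rightarrow>\<^sub>C 'k) \<Rightarrow>\<^sub>L ('a \<Rightarrow>\<^sub>C 'k)) module)"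
  unfolding unique_algebra_norm_def
proof (intro allI impI)
  let ?A = "operator_algebra :: ('k, ('a \<Rightarrow>\<^sub>C 'k) \<Rightarrow>\<^sub>L ('a \<Rightarrow>\<^sub>C 'k)) module"
  fix N N' :: "(('a \<Rightarrow>\<^sub>C 'k) \<Rightarrow>\<^sub>L ('a \<Rightarrow>\<^sub>C 'k)) \<Rightarrow> real"
  assume N: "algebra_norm ?A N" and N': "algebra_norm ?A N'"
  have le: "\<exists>C. \<forall>T\<in>ops. M T \<le> C * M' T" if M: "algebra_norm ?A M" and M': "algebra_norm ?A M'" for M M'
  proof -
    interpret m: algebra_seminorm M using M by unfold_locales (auto simp: algebra_norm_def)
    interpret m': algebra_seminorm M' using M' by unfold_locales (auto simp: algebra_norm_def)
    obtain C where C: "0 \<le> C" "\<And>T. T \<in> ops \<Longrightarrow> M T \<le> C * norm T" using m.bounded_by_operator_norm[OF top] by blast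
    obtain C' where C': "0 < C'" "\<And>T. T \<in> ops \<Longrightarrow> norm T \<le> C' * M' T"
      using m'.bounded_below[OF top] M' by (auto simp: algebra_norm_def)
    have "M T \<le> (C * C') * M' T" if "T \<in> ops" for T
      using C(2)[OF that] mult_left_mono[OF C'(2)[OF that] C(1)] by (simp add: mult.assoc)
    then show ?thesis by blast
  qed
  show "equivalent_norms ?A N N'"
    using le[OF N N'] le[OF N' N] N N' by (intro equivalent_normsI) (auto simp: algebra_norm_def)
qed

lemma algebra_seminorm_calkin:
  fixes N :: "(('a::{wellorder, linorder_topology} \<Rightarrow>\<^sub>C 'k::{real_normed_field, banach, heine_borel}) \<Rightarrow>\<^sub>L ('a \<Rightarrow>\<^sub>C 'k)) set \<Rightarrow> real"
  assumes N: "algebra_norm calkin_algebra N"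
  shows "algebra_seminorm (\<lambda>T. N (coset T))" "T \<in> ops \<Longrightarrow> N (coset T) = 0 \<longleftrightarrow> T \<in> compact_operators"
proof -
  show "algebra_seminorm (\<lambda>T. N (coset T))"
  proof
    fix S T :: "('a \<Rightarrow>\<^sub>C 'k) \<Rightarrow>\<^sub>L ('a \<Rightarrow>\<^sub>C 'k)" and c :: 'k
    assume T: "T \<in> ops"
    show "0 \<le> N (coset T)" using N T by (auto simp: algebra_norm_def)
    show "N (coset (scale_blinfun c T)) = norm c * N (coset T)"
      using N T calkin_algebra_simps(5)[OF T, of c] by (auto simp: algebra_norm_def)
    assume S: "S \<in> ops"
    show "N (coset (S + T)) \<le> N (coset S) + N (coset T)"
      using N T S calkin_algebra_simps(3)[OF S T] by (auto simp: algebra_norm_def)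
    show "N (coset (S o\<^sub>L T)) \<le> N (coset S) * N (coset T)"
      using N T S calkin_algebra_simps(4)[OF S T] by (auto simp: algebra_norm_def)
  qed
  have "coset 0 = (compact_operators :: (('a \<Rightarrow>\<^sub>C 'k) \<Rightarrow>\<^sub>L ('a \<Rightarrow>\<^sub>C 'k)) set)" by (simp add: coset_eq)
  then have "coset T = compact_operators \<longleftrightarrow> T \<in> compact_operators" using coset_eq_iff[of T 0] by simp
  then show "T \<in> ops \<Longrightarrow> N (coset T) = 0 \<longleftrightarrow> T \<in> compact_operators"
    using N by (auto simp: algebra_norm_def)
qed

text \<open>
  If \<open>M'\<close> is small at the coset of \<open>T\<close>, then \<open>T\<close> is close to a compact operator \<open>J\<close>, and then \<open>M\<close> is
  small at the coset of \<open>T - J\<close>, which is the coset of \<open>T\<close>.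
\<close>

theorem unique_algebra_norm_calkin_algebra:
  assumes top: "(UNIV :: 'a::{wellorder, linorder_topology} set) = {..\<alpha>}"
  shows "unique_algebra_norm (calkin_algebra ::
    ('k::{real_normed_field, banach, heine_borel}, (('a \<Rightarrow>\<^sub>C 'k) \<Rightarrow>\<^sub>L ('a \<Rightarrow>\<^sub>C 'k)) set) module)"
  unfolding unique_algebra_norm_def
proof (intro allI impI)
  let ?A = "calkin_algebra :: ('k, (('a \<Rightarrow>\<^sub>C 'k) \<Rightarrow>\<^sub>L ('a \<Rightarrow>\<^sub>C 'k)) set) module"
  fix N N' :: "(('a \<Rightarrow>\<^sub>C 'k) \<Rightarrow>\<^sub>L ('a \<Rightarrow>\<^sub>C 'k)) set \<Rightarrow> real"
  assume N: "algebra_norm ?A N" and N': "algebra_norm ?A N'"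
  have le: "\<exists>C. \<forall>x\<in>carrier ?A. M x \<le> C * M' x" if M: "algebra_norm ?A M" and M': "algebra_norm ?A M'" for M M'
  proof -
    interpret m: algebra_seminorm "\<lambda>T. M (coset T)" by (rule algebra_seminorm_calkin[OF M])
    interpret m': algebra_seminorm "\<lambda>T. M' (coset T)" by (rule algebra_seminorm_calkin[OF M'])
    note zero = algebra_seminorm_calkin(2)[OF M] and zero' = algebra_seminorm_calkin(2)[OF M']
    obtain C where C: "0 \<le> C" "\<And>T. T \<in> ops \<Longrightarrow> M (coset T) \<le> C * norm T"
      using m.bounded_by_operator_norm[OF top] by blast
    obtain c where c: "0 < c" "\<And>T r. T \<in> ops \<Longrightarrow> 0 < r \<Longrightarrow> M' (coset T) < c * r \<Longrightarrow>
        \<exists>J\<in>compact_operators. norm (T - J) \<le> r"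
      using m'.bounded_below_modulo_compacts[OF top] zero' by metis
    have "M (coset T) \<le> (2 * C / c) * M' (coset T)" if T: "T \<in> ops" for T
    proof (cases "M' (coset T) = 0")
      case True
      then have "M (coset T) = 0" using zero zero' T by blast
      then show ?thesis using True by simp
    next
      case False
      then have pos: "0 < M' (coset T)" using m'.nonneg[OF T] by simp
      define r where "r = 2 * M' (coset T) / c"
      have r: "0 < r" "M' (coset T) < c * r" using pos c(1) by (auto simp: r_def)
      obtain J where J: "J \<in> compact_operators" "norm (T - J) \<le> r" using c(2)[OF T r] by blast
      have JJ: "J \<in> ops" using compact_operatorsD(1)[OF J(1)] .
      have "M (coset T) \<le> M (coset (T - J)) + M (coset J)" using m.triangle[of "T - J" J] T JJ by simp
      also have "M (coset J) = 0" using zero[OF JJ] J(1) by simp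
      also have "M (coset (T - J)) + 0 \<le> C * r"
        using C(2)[of "T - J"] T JJ mult_left_mono[OF J(2) C(1)] by simp
      also have "C * r = (2 * C / c) * M' (coset T)" by (simp add: r_def)
      finally show ?thesis .
    qed
    then show ?thesis unfolding calkin_algebra_simps(1) by blast
  qed
  show "equivalent_norms ?A N N'"
    by (rule equivalent_normsI[OF _ _ le[OF N N'] le[OF N' N]])
      (use N N' in \<open>auto simp only: algebra_norm_def\<close>)
qed

theorem corollary1p4:
  fixes \<alpha> :: "'a::{wellorder, linorder_topology}"
  assumes "(UNIV :: 'a set) = {..\<alpha>}"
  shows "unique_algebra_norm
           (operator_algebra :: (real, ('a \<Rightarrow>\<^sub>C real) \<Rightarrow>\<^sub>L ('a \<Rightarrow>\<^sub>C real)) module)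
       \<and> unique_algebra_norm
           (calkin_algebra :: (real, (('a \<Rightarrow>\<^sub>C real) \<Rightarrow>\<^sub>L ('a \<Rightarrow>\<^sub>C real)) set) module)
       \<and> unique_algebra_norm
           (operator_algebra :: (complex, ('a \<Rightarrow>\<^sub>C complex) \<Rightarrow>\<^sub>L ('a \<Rightarrow>\<^sub>C complex)) module)
       \<and> unique_algebra_norm
           (calkin_algebra :: (complex, (('a \<Rightarrow>\<^sub>C complex) \<Rightarrow>\<^sub>L ('a \<Rightarrow>\<^sub>C complex)) set) module)"
  by (intro conjI unique_algebra_norm_operator_algebra[OF assms] unique_algebra_norm_calkin_algebra[OF assms])

end
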